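(* The morphism of graded operads $q:C_*(\underline K)\to C_*(\underline W)$ determined by $q(c(n),1)=\sum_{T}(T,\omega_T)$, where the sum runs over all fully metric planar rooted binary trees $T$ with $n$ leaves taken with their standard orientation $\omega_T$, commutes with the boundary operators: for all $n\ge2$, $$q(\partial_K(c(n),1))=\partial_W\,q(c(n),1),$$ and therefore $q$ is a morphism of operads in the category of chain complexes.
   Context: $\mathbf k$ is the ground field. "Operad" means a non-$\Sigma$ pseudo-operad $\mathcal P$ with $\mathcal P(0)=\mathcal P(1)=0$ (operations $\circ_i$ satisfying the usual axioms with Koszul signs, no units). Trees. Trees are planar rooted trees all of whose vertices have at least two inputs; leaves are numbered from left to right; an internal edge joins two vertices. $T/e$ is $T$ with internal edge $e$ collapsed; $T\circ_iT'$ is the tree obtained by grafting the root of $T'$ to the $i$-th leaf of $T$ (creating one new internal edge); $c(n)$ is the corolla with $n$ leaves. An orientation of a finite set of edges $\{e_1,\dots,e_m\}$ is a symbol $\pm e_{1}\wedge\cdots\wedge e_{m}$, antisymmetric in the edges; for the empty set it is $\pm1$. The operad $C_*(\underline K)$ (cellular chains of the associahedra). $C_k(K_n)$, $n\ge2$, is the vector space spanned by pairs $(T,\omega)$, $T$ a tree with $n$ leaves and $n-k-2$ internal edges, $\omega$ an orientation of all its internal edges, modulo $(T,-\omega)=-(T,\omega)$. For $(T,\omega)\in C_k(K_r)$, $(T',\omega')\in C_l(K_s)$, $$(T,\omega)\circ_i(T',\omega')=(-1)^{rl+i(s+1)}(T\circ_iT',\omega\wedge\omega'\wedge e),$$ $e$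 being the new edge. The differential is $\partial_K(T,e_1\wedge\cdots\wedge e_m)=\sum(T',e'\wedge e_1\wedge\cdots\wedge e_m)$, over all trees $T'$ with an internal edge $e'$ such that $T'/e'=T$. As a graded operad $C_*(\underline K)$ is free on the corollas $(c(n),1)$, of degree $n-2$. The operad $C_*(\underline W)$ (cubical chains of the $W$-construction). A metric tree is a tree each of whose internal edges is labeled "metric" or "non-metric"; it is fully metric if all internal edges are metric. $C_k(W_n)$ is the vector space spanned by pairs $(T,\omega)$, $T$ a metric tree with $n$ leaves and exactly $k$ metric edges, $\omega$ an orientation of the metric edges, modulo $(T,-\omega)=-(T,\omega)$. $(T,\omega)\circ_i(T',\omega')=(T\circ_iT',\omega\wedge\omega')$, the new edge being non-metric. The differential is $$\partial_W(T,e_1\wedge\cdots\wedge e_k)=\sum_{1\le i\le k}(-1)^i\big[(T/e_i,e_1\wedge\cdots\widehat{e_i}\cdots\wedge e_k)-(T_i,e_1\wedge\cdots\widehat{e_i}\cdots\wedge e_k)\big],$$ where $T_i$ is $T$ with $e_i$ changed to non-metric. Standard orientation $\omega_T$. In a binary tree an internal edge is left-leaning if it joins a vertex to its right child and right-leaning if it joins a vertex to its left child. $\max(n)$ is the binary $n$-tree with all internal edges left-leaning (bracketing $\bullet(\bullet(\cdots(\bullet\bullet)))$). An elementary move $T\rightsquigarrow T'$ is the replacement, at a vertex $v$ of $T$ whose right child is a vertex $u$, of the configuration $A(BC)$ ($A$ the left subtree of $v$; $B,C$ the subtrees of $u$) by $(AB)C$; the edge $e=vu$ is replaced by a new edge $e'$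 joining $v$ to the new left child $u'$ carrying $A,B$; all other edges (including the outgoing edge of $v$ and the outgoing edges of $A,B,C$) are identified with those of $T$. Then $\omega_{\max(n)}=e_1\wedge\cdots\wedge e_{n-2}$, with edges numbered in sequence starting at the root and moving away from it; and if $T\rightsquigarrow T'$ is an elementary move replacing the edge $e=vu$ of $T$ (joining $v$ to its right child $u$) by the edge $e'$ of $T'$ (joining $v$ to its new left child $u'$), with all other edges of $T'$ identified with those of $T$, then $\omega_{T'}$ is obtained from $\omega_T$ by substituting $e'$ for $e$ and multiplying by $-1$. This determines $\omega_T$ unambiguously for every fully metric binary tree $T$. *)

theory Defs
  imports "HOL-Library.Poly_Mapping" "HOL-Library.List_Lexorder"
begin

section \<open>Planar rooted trees\<close>

text \<open>A vertex is addressed by the path from the root to it: \<open>[]\<close> is the root, and \<open>p @ [j]\<close> is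
  the \<open>j\<close>-th child (counted from \<open>0\<close>, from left to right) of \<open>p\<close>.  The internal edge joining a
  non-root vertex \<open>p @ [j]\<close> to its parent \<open>p\<close> is denoted by the address \<open>p @ [j]\<close>.\<close>

datatype ptree = Leaf | Node "ptree list"

type_synonym addr = "nat list"

fun children :: "ptree \<Rightarrow> ptree list" where
  "children Leaf = []"
| "children (Node ts) = ts"

fun subtree :: "ptree \<Rightarrow> addr \<Rightarrow> ptree option" where
  "subtree t [] = Some t"
| "subtree Leaf (j # a) = None"
| "subtree (Node ts) (j # a) = (if j < length ts then subtree (ts ! j) a else None)"

fun subst :: "ptree \<Rightarrow> addr \<Rightarrow> ptree \<Rightarrow> ptree" where
  "subst t [] s = s"
| "subst Leaf (j # a) s = Leaf"
| "subst (Node ts) (j # a) s = Node (ts[j := subst (ts ! j) a s])"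

definition internal_edges :: "ptree \<Rightarrow> addr set" where
  "internal_edges t = {a. a \<noteq> [] \<and> (\<exists>ts. subtree t a = Some (Node ts))}"

primrec leaf_addrs :: "ptree \<Rightarrow> addr list" where
  "leaf_addrs Leaf = [[]]"
| "leaf_addrs (Node ts) =
     concat (map2 (\<lambda>j. map ((#) j)) [0..<length ts] (map leaf_addrs ts))"

definition leaf_count :: "ptree \<Rightarrow> nat" where
  "leaf_count t = length (leaf_addrs t)"

text \<open>The tree \<open>Leaf\<close> without vertices is excluded, in accordance with \<open>\<P>(1) = 0\<close>.\<close>

definition ptrees :: "nat \<Rightarrow> ptree set" where
  "ptrees n = {t. t \<noteq> Leaf \<and> (\<forall>a ts. subtree t a = Some (Node ts) \<longrightarrow> 2 \<le> length ts)
                  \<and> leaf_count t = n}"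

definition binary_ptrees :: "nat \<Rightarrow> ptree set" where
  "binary_ptrees n = {t \<in> ptrees n. \<forall>a ts. subtree t a = Some (Node ts) \<longrightarrow> length ts = 2}"

definition corolla :: "nat \<Rightarrow> ptree" where
  "corolla n = Node (replicate n Leaf)"

text \<open>Leaves are numbered from \<open>1\<close>.  Under grafting, the edges of \<open>t\<close> keep their addresses, an edge
  \<open>a\<close> of \<open>s\<close> becomes \<open>leaf_addr t i @ a\<close>, and the new edge is \<open>leaf_addr t i\<close>.\<close>

definition leaf_addr :: "ptree \<Rightarrow> nat \<Rightarrow> addr" where
  "leaf_addr t i = leaf_addrs t ! (i - 1)"

definition graft :: "nat \<Rightarrow> ptree \<Rightarrow> ptree \<Rightarrow> ptree" where
  "graft i t s = subst t (leaf_addr t i) s"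

text \<open>\<open>collapse t e\<close> is \<open>t/e\<close>: the subtrees at the vertex \<open>e\<close> are spliced, in place of that vertex,
  into the list of subtrees at its parent.  \<open>collapse_addr t e\<close> sends the address of a vertex of
  \<open>t\<close> to the address of its image in \<open>t/e\<close>; it identifies the edges of \<open>t\<close> other than \<open>e\<close> with
  the edges of \<open>t/e\<close>.\<close>

definition collapse :: "ptree \<Rightarrow> addr \<Rightarrow> ptree" where
  "collapse t e =
     (let p = butlast e; j = last e; ts = children (the (subtree t p))
      in subst t p (Node (take j ts @ children (ts ! j) @ drop (Suc j) ts)))"

definition collapse_addr :: "ptree \<Rightarrow> addr \<Rightarrow> addr \<Rightarrow> addr" where
  "collapse_addr t e d =
     (let p = butlast e; j = last e; c = length (children (the (subtree t e)))
      in if take (length p) d \<noteq> p then d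
         else case drop (length p) d of
             [] \<Rightarrow> d
           | l # r \<Rightarrow>
               if l < j then d
               else if l = j then (case r of [] \<Rightarrow> p | i # r' \<Rightarrow> p @ (j + i) # r')
               else p @ (l + c - 1) # r)"


section \<open>Chains and orientations\<close>

definition scale :: "'k::comm_ring_1 \<Rightarrow> ('b \<Rightarrow>\<^sub>0 'k) \<Rightarrow> ('b \<Rightarrow>\<^sub>0 'k)" where
  "scale c x = Poly_Mapping.map ((*) c) x"

definition lin_ext :: "('a \<Rightarrow> ('b \<Rightarrow>\<^sub>0 'k)) \<Rightarrow> ('a \<Rightarrow>\<^sub>0 'k) \<Rightarrow> ('b \<Rightarrow>\<^sub>0 'k::comm_ring_1)" where
  "lin_ext f x = (\<Sum>b\<in>Poly_Mapping.keys x. scale (Poly_Mapping.lookup x b) (f b))"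

text \<open>The value of \<open>e\<^sub>1 \<and> \<dots> \<and> e\<^sub>m\<close> relative to the wedge of the same elements in increasing order:
  the sign of the sorting permutation, and \<open>0\<close> if an element is repeated.\<close>

primrec wedge_sign :: "'e::linorder list \<Rightarrow> int" where
  "wedge_sign [] = (1 :: int)"
| "wedge_sign (e # es) =
     (if e \<in> set es then 0 else (-1) ^ length (filter (\<lambda>d. d < e) es) * wedge_sign es)"

text \<open>The space spanned by the pairs \<open>(b, \<omega>)\<close>, with \<open>\<omega>\<close> an orientation of a finite set of edges
  depending on \<open>b\<close>, modulo \<open>(b, -\<omega>) = -(b, \<omega>)\<close>, has a basis formed by the \<open>b\<close>, each taken with
  the wedge of its edges in increasing (lexicographic) order.  It is represented by its coordinates
  in this basis, and \<open>osym b [e\<^sub>1, \<dots>, e\<^sub>m]\<close> is the class of \<open>(b, e\<^sub>1 \<and> \<dots> \<and> e\<^sub>m)\<close>.  The reference order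
  plays no role: the operations below are given by formulas for arbitrary orientations, and the
  lemmas \<open>K_comp_osym\<close>, \<open>K_bd_osym\<close>, \<open>W_comp_osym\<close>, \<open>W_bd_osym\<close> show that these formulas hold for all
  orientations.\<close>

definition osym :: "'b \<Rightarrow> addr list \<Rightarrow> ('b \<Rightarrow>\<^sub>0 'k::comm_ring_1)" where
  "osym b es = Poly_Mapping.single b (of_int (wedge_sign es))"


section \<open>Operads of chain complexes and their morphisms\<close>

text \<open>The structure carried by an operad of chain complexes: the space of elements of arity \<open>n\<close> and
  degree \<open>k\<close>, the operations \<open>\<circ>\<^sub>i\<close>, and the boundary.\<close>

record 'c dg_structure =
  chain_space :: "nat \<Rightarrow> nat \<Rightarrow> 'c set"
  circ :: "nat \<Rightarrow> 'c \<Rightarrow> 'c \<Rightarrow> 'c"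
  bdry :: "'c \<Rightarrow> 'c"

definition graded_operad_hom ::
  "('a \<Rightarrow>\<^sub>0 'k::field) dg_structure \<Rightarrow> ('b \<Rightarrow>\<^sub>0 'k) dg_structure
     \<Rightarrow> (('a \<Rightarrow>\<^sub>0 'k) \<Rightarrow> ('b \<Rightarrow>\<^sub>0 'k)) \<Rightarrow> bool" where
  "graded_operad_hom P Q q \<longleftrightarrow>
     (\<forall>n k. \<forall>x\<in>chain_space P n k. q x \<in> chain_space Q n k)
   \<and> (\<forall>n k. \<forall>x\<in>chain_space P n k. \<forall>y\<in>chain_space P n k. q (x + y) = q x + q y)
   \<and> (\<forall>n k c. \<forall>x\<in>chain_space P n k. q (scale c x) = scale c (q x))
   \<and> (\<forall>r s k l i. \<forall>x\<in>chain_space P r k. \<forall>y\<in>chain_space P s l. 1 \<le> i \<and> i \<le> r \<longrightarrow>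
        q (circ P i x y) = circ Q i (q x) (q y))"

definition dg_operad_hom ::
  "('a \<Rightarrow>\<^sub>0 'k::field) dg_structure \<Rightarrow> ('b \<Rightarrow>\<^sub>0 'k) dg_structure
     \<Rightarrow> (('a \<Rightarrow>\<^sub>0 'k) \<Rightarrow> ('b \<Rightarrow>\<^sub>0 'k)) \<Rightarrow> bool" where
  "dg_operad_hom P Q q \<longleftrightarrow>
     graded_operad_hom P Q q \<and> (\<forall>n k. \<forall>x\<in>chain_space P n k. q (bdry P x) = bdry Q (q x))"


section \<open>Cellular chains of the associahedra\<close>

definition edge_list :: "ptree \<Rightarrow> addr list" where
  "edge_list t = sorted_list_of_set (internal_edges t)"

definition K_degree :: "ptree \<Rightarrow> nat" where
  "K_degree t = leaf_count t - card (internal_edges t) - 2"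

definition K_graft ::
  "nat \<Rightarrow> ptree \<Rightarrow> addr list \<Rightarrow> ptree \<Rightarrow> addr list \<Rightarrow> (ptree \<Rightarrow>\<^sub>0 'k::comm_ring_1)" where
  "K_graft i t es s ds =
     scale ((-1) ^ (leaf_count t * K_degree s + i * (leaf_count s + 1)))
       (osym (graft i t s) (es @ map ((@) (leaf_addr t i)) ds @ [leaf_addr t i]))"

text \<open>The map applied to \<open>es\<close> is the identification of the edges of \<open>t = t'/e'\<close> with the edges of
  \<open>t'\<close> other than \<open>e'\<close>.\<close>

definition K_expand :: "ptree \<Rightarrow> addr list \<Rightarrow> (ptree \<Rightarrow>\<^sub>0 'k::comm_ring_1)" where
  "K_expand t es =
     (\<Sum>(t', e') \<in> {(t', e'). t' \<in> ptrees (leaf_count t) \<and> e' \<in> internal_edges t' \<and> collapse t' e' = t}.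
        osym t' (e' # map (inv_into (internal_edges t' - {e'}) (collapse_addr t' e')) es))"

definition K_operad :: "(ptree \<Rightarrow>\<^sub>0 'k::field) dg_structure" where
  "K_operad =
     \<lparr> chain_space = (\<lambda>n k. {x. \<forall>t\<in>Poly_Mapping.keys x.
                           t \<in> ptrees n \<and> card (internal_edges t) + k + 2 = n}),
       circ = (\<lambda>i x y. lin_ext (\<lambda>t. lin_ext (\<lambda>s. K_graft i t (edge_list t) s (edge_list s)) y) x),
       bdry = lin_ext (\<lambda>t. K_expand t (edge_list t)) \<rparr>"


section \<open>Cubical chains of the W-construction\<close>

text \<open>A metric tree is a pair of a tree and the set of its metric edges.\<close>

type_synonym mtree = "ptree \<times> addr set"

definition W_graft ::
  "nat \<Rightarrow> mtree \<Rightarrow> addr list \<Rightarrow> mtree \<Rightarrow> addr list \<Rightarrow> (mtree \<Rightarrow>\<^sub>0 'k::comm_ring_1)" where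
  "W_graft i T es S ds =
     (let p = leaf_addr (fst T) i
      in osym (graft i (fst T) (fst S), snd T \<union> (@) p ` snd S) (es @ map ((@) p) ds))"

text \<open>Here the edges are numbered from \<open>0\<close>, whence the exponent \<open>Suc i\<close>.\<close>

definition W_faces :: "mtree \<Rightarrow> addr list \<Rightarrow> (mtree \<Rightarrow>\<^sub>0 'k::comm_ring_1)" where
  "W_faces T es =
     (\<Sum>i<length es. scale ((-1) ^ Suc i)
        (let t = fst T; e = es ! i; M = snd T - {e}; ds = take i es @ drop (Suc i) es
         in osym (collapse t e, collapse_addr t e ` M) (map (collapse_addr t e) ds)
            - osym (t, M) ds))"

definition W_operad :: "(mtree \<Rightarrow>\<^sub>0 'k::field) dg_structure" where
  "W_operad =
     \<lparr> chain_space = (\<lambda>n k. {x. \<forall>T\<in>Poly_Mapping.keys x.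
                           fst T \<in> ptrees n \<and> snd T \<subseteq> internal_edges (fst T) \<and> card (snd T) = k}),
       circ = (\<lambda>i x y. lin_ext (\<lambda>T. lin_ext (\<lambda>S.
                 W_graft i T (sorted_list_of_set (snd T)) S (sorted_list_of_set (snd S))) y) x),
       bdry = lin_ext (\<lambda>T. W_faces T (sorted_list_of_set (snd T))) \<rparr>"


section \<open>The standard orientation of a binary tree\<close>

text \<open>\<open>right_comb m\<close> is the tree \<open>max (m + 1)\<close>.\<close>

primrec right_comb :: "nat \<Rightarrow> ptree" where
  "right_comb 0 = Leaf"
| "right_comb (Suc m) = Node [Leaf, right_comb m]"

definition elementary_move :: "addr \<Rightarrow> ptree \<Rightarrow> ptree \<Rightarrow> bool" where
  "elementary_move v t t' \<longleftrightarrow>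
     (\<exists>A B C. subtree t v = Some (Node [A, Node [B, C]]) \<and> t' = subst t v (Node [Node [A, B], C]))"

text \<open>The effect of an elementary move on edges, as addresses relative to the vertex \<open>v\<close>.  The
  second equation replaces \<open>e\<close> by \<open>e'\<close>, the others follow the subtrees \<open>A\<close>, \<open>B\<close>, \<open>C\<close>.\<close>

fun move_rel :: "addr \<Rightarrow> addr" where
  "move_rel (0 # r) = 0 # 0 # r"
| "move_rel [Suc 0] = [0]"
| "move_rel (Suc 0 # 0 # r) = 0 # Suc 0 # r"
| "move_rel (Suc 0 # Suc 0 # r) = Suc 0 # r"
| "move_rel r = r"

definition move_edge :: "addr \<Rightarrow> addr \<Rightarrow> addr" where
  "move_edge v d = (if take (length v) d = v then v @ move_rel (drop (length v) d) else d)"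

text \<open>\<open>standard_orientation t \<epsilon> es\<close> holds if \<open>\<omega>\<^sub>t = \<epsilon> e\<^sub>1 \<and> \<dots> \<and> e\<^sub>m\<close> is obtained from the orientation
  of \<open>max(n)\<close> by a sequence of elementary moves.\<close>

inductive standard_orientation :: "ptree \<Rightarrow> int \<Rightarrow> addr list \<Rightarrow> bool" where
  max: "2 \<le> n \<Longrightarrow>
     standard_orientation (right_comb (n - 1)) 1 (map (\<lambda>j. replicate j 1) [1..<n - 1])"
| move: "standard_orientation t \<epsilon> es \<Longrightarrow> elementary_move v t t' \<Longrightarrow>
     standard_orientation t' (- \<epsilon>) (map (move_edge v) es)"

definition standard_chain :: "ptree \<Rightarrow> (mtree \<Rightarrow>\<^sub>0 'k::field)" where
  "standard_chain t =
     (THE x. \<exists>\<epsilon> es. standard_orientation t \<epsilon> es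
                  \<and> x = scale (of_int \<epsilon>) (osym (t, internal_edges t) es))"


definition comparison_map :: "((ptree \<Rightarrow>\<^sub>0 'k::field) \<Rightarrow> (mtree \<Rightarrow>\<^sub>0 'k)) \<Rightarrow> bool" where
  "comparison_map q \<longleftrightarrow>
     graded_operad_hom K_operad W_operad q
   \<and> (\<forall>n\<ge>2. q (osym (corolla n) []) = (\<Sum>t\<in>binary_ptrees n. standard_chain t))"


section \<open>Independence of the reference order of edges\<close>

lemma lookup_scale [simp]:
  "Poly_Mapping.lookup (scale c x) b = c * Poly_Mapping.lookup x b"
  by (auto simp: scale_def Poly_Mapping.map.rep_eq when_def)

lemma scale_scale: "scale a (scale b x) = scale (a * b) x"
  by (rule poly_mapping_eqI) (simp add: mult.assoc)

lemma scale_one [simp]: "scale 1 x = x"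
  by (rule poly_mapping_eqI) simp

lemma scale_zero [simp]: "scale 0 x = 0" "scale c 0 = 0"
  by (rule poly_mapping_eqI, simp)+

lemma scale_minus: "scale c (- x) = - scale c x" "scale (- c) x = - scale c x"
  by (rule poly_mapping_eqI, simp)+

lemma scale_diff: "scale c (x - y) = scale c x - scale c y"
  by (rule poly_mapping_eqI) (simp add: lookup_minus algebra_simps)

lemma scale_sum: "scale c (sum f A) = (\<Sum>a\<in>A. scale c (f a))"
  by (rule poly_mapping_eqI) (simp add: lookup_sum sum_distrib_left)

lemma lin_ext_single: "lin_ext f (Poly_Mapping.single b c) = scale c (f b)"
  by (cases "c = 0") (simp_all add: lin_ext_def)

lemma wedge_sign_swap:
  "wedge_sign (xs @ b # a # ys) = - wedge_sign (xs @ a # b # ys)"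
proof (induction xs)
  case Nil
  show ?case by (cases a b rule: linorder_cases) auto
next
  case (Cons x xs)
  have "length (filter (\<lambda>d. d < x) (xs @ b # a # ys)) = length (filter (\<lambda>d. d < x) (xs @ a # b # ys))"
    by simp
  moreover have "x \<in> set (xs @ b # a # ys) \<longleftrightarrow> x \<in> set (xs @ a # b # ys)" by auto
  ultimately show ?case using Cons by (simp del: set_append filter_append)
qed

definition alternating :: "('e list \<Rightarrow> 'c::ab_group_add) \<Rightarrow> bool" where
  "alternating G \<longleftrightarrow> (\<forall>xs a b ys. G (xs @ b # a # ys) = - G (xs @ a # b # ys))"

lemma alternating_insort:
  fixes G :: "'e::linorder list \<Rightarrow> ('b \<Rightarrow>\<^sub>0 'k::comm_ring_1)"
  assumes "alternating G" "sorted zs"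
  shows "G (xs @ a # zs) = scale ((-1) ^ length (filter (\<lambda>d. d < a) zs)) (G (xs @ insort a zs))"
  using assms(2)
proof (induction zs arbitrary: xs)
  case (Cons z zs)
  show ?case
  proof (cases "a \<le> z")
    case True
    then have "filter (\<lambda>d. d < a) (z # zs) = []" using Cons.prems by (auto simp: filter_empty_conv)
    then show ?thesis using True by (simp del: filter.simps)
  next
    case False
    have "G (xs @ a # z # zs) = - G (xs @ z # a # zs)"
      using assms(1) unfolding alternating_def by blast
    moreover have "insort a (z # zs) = z # insort a zs"
      "filter (\<lambda>d. d < a) (z # zs) = z # filter (\<lambda>d. d < a) zs" using False by auto
    ultimately show ?thesis using Cons.IH[of "xs @ [z]"] Cons.prems
      by (simp add: scale_minus del: insort_key.simps filter.simps)
  qed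
qed simp

lemma alternating_sort:
  fixes G :: "'e::linorder list \<Rightarrow> ('b \<Rightarrow>\<^sub>0 'k::comm_ring_1)"
  assumes "alternating G"
  shows "distinct es \<Longrightarrow> G (xs @ es) = scale (of_int (wedge_sign es)) (G (xs @ sort es))"
proof (induction es arbitrary: xs)
  case (Cons a es)
  have "length (filter (\<lambda>d. d < a) (sort es)) = length (filter (\<lambda>d. d < a) es)"
    by (simp add: filter_sort)
  moreover have "G (xs @ a # es) = scale (of_int (wedge_sign es)) (G (xs @ a # sort es))"
    using Cons.IH[of "xs @ [a]"] Cons.prems by simp
  ultimately show ?case
    using Cons.prems alternating_insort[OF assms, of "sort es" xs a]
    by (simp add: scale_scale mult.commute)
qed simp

lemma alternating_sorted_list_of_set:
  fixes G :: "'e::linorder list \<Rightarrow> ('b \<Rightarrow>\<^sub>0 'k::comm_ring_1)"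
  assumes "alternating G" "distinct es" "set es = E"
  shows "scale (of_int (wedge_sign es)) (G (sorted_list_of_set E)) = G es"
proof -
  have "sorted_list_of_set E = sort es"
    unfolding assms(3)[symmetric] using assms(2)
    by (simp only: sorted_list_of_set_sort_remdups distinct_remdups_id)
  then show ?thesis using alternating_sort[OF assms(1,2), of "[]"] by simp
qed

lemma osym_alternating: "alternating (\<lambda>es. osym b (xs @ map f es @ ys))"
  unfolding alternating_def
proof (intro allI)
  fix us vs a c
  have "wedge_sign (xs @ map f (us @ c # a # vs) @ ys) = - wedge_sign (xs @ map f (us @ a # c # vs) @ ys)"
    using wedge_sign_swap[of "xs @ map f us" "f c" "f a" "map f vs @ ys"] by simp
  then show "osym b (xs @ map f (us @ c # a # vs) @ ys) = - osym b (xs @ map f (us @ a # c # vs) @ ys)"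
    unfolding osym_def by (simp only: of_int_minus single_uminus)
qed

lemma alternating_scale: "alternating G \<Longrightarrow> alternating (\<lambda>es. scale c (G es))"
  unfolding alternating_def by (metis scale_minus(1))

lemma alternating_diff:
  assumes "alternating F" "alternating G"
  shows "alternating (\<lambda>es. F es - G es)"
  unfolding alternating_def
proof (intro allI)
  fix xs ys a b
  have "F (xs @ b # a # ys) = - F (xs @ a # b # ys)" "G (xs @ b # a # ys) = - G (xs @ a # b # ys)"
    using assms unfolding alternating_def by blast+
  then show "F (xs @ b # a # ys) - G (xs @ b # a # ys) = - (F (xs @ a # b # ys) - G (xs @ a # b # ys))"
    by simp
qed

lemma osym_swap: "osym b (xs @ d # e # ys) = - osym b (xs @ e # d # ys)"
  unfolding osym_def wedge_sign_swap[of xs d e ys] by (simp add: single_uminus)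

lemma osym_edge_list: "osym t (edge_list t) = Poly_Mapping.single t 1"
proof -
  have "wedge_sign es = 1" if "sorted es" "distinct es" for es :: "addr list"
    using that
  proof (induction es)
    case (Cons a es)
    then have "filter (\<lambda>d. d < a) es = []" by (simp add: filter_empty_conv not_less)
    with Cons show ?case by simp
  qed simp
  then show ?thesis by (simp add: osym_def edge_list_def)
qed

lemma K_comp_osym:
  assumes "distinct es" "set es = internal_edges t" "distinct ds" "set ds = internal_edges s"
  shows "circ K_operad i (osym t es) (osym s ds) = K_graft i t es s ds"
proof -
  have 1: "alternating (\<lambda>es. K_graft i t es s (edge_list s) :: ptree \<Rightarrow>\<^sub>0 'a)"
    unfolding K_graft_def using osym_alternating[where xs = "[]" and f = "\<lambda>x. x"]
    by (intro alternating_scale) simp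
  have 2: "alternating (\<lambda>ds. K_graft i t es s ds :: ptree \<Rightarrow>\<^sub>0 'a)"
    unfolding K_graft_def by (intro alternating_scale osym_alternating)
  have "circ K_operad i (osym t es) (osym s ds) = scale (of_int (wedge_sign ds))
      (scale (of_int (wedge_sign es))
        (K_graft i t (sorted_list_of_set (internal_edges t)) s (edge_list s)) :: ptree \<Rightarrow>\<^sub>0 'a)"
    by (simp add: K_operad_def osym_def[of t] osym_def[of s] lin_ext_single scale_scale edge_list_def
        mult.commute)
  also have "\<dots> = scale (of_int (wedge_sign ds)) (K_graft i t es s (sorted_list_of_set (internal_edges s)))"
    unfolding alternating_sorted_list_of_set[OF 1 assms(1,2)] by (simp only: edge_list_def)
  also have "\<dots> = K_graft i t es s ds"
    by (rule alternating_sorted_list_of_set[OF 2 assms(3,4)])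
  finally show ?thesis .
qed

lemma K_bd_osym:
  assumes "distinct es" "set es = internal_edges t"
  shows "bdry K_operad (osym t es) = K_expand t es"
proof -
  have *: "osym t' (e' # map f (xs @ b # a # ys)) = - osym t' (e' # map f (xs @ a # b # ys))"
    for t' :: ptree and e' f xs ys a b
    using osym_swap[of t' "e' # map f xs" "f b" "f a" "map f ys"] by simp
  have "alternating (\<lambda>es. K_expand t es :: ptree \<Rightarrow>\<^sub>0 'a)"
    unfolding alternating_def K_expand_def sum_negf[symmetric]
    by (intro allI sum.cong refl) (unfold split_def, rule *)
  note alternating_sorted_list_of_set[OF this assms]
  then show ?thesis
    by (simp add: K_operad_def osym_def[of t] lin_ext_single edge_list_def)
qed

lemma W_comp_osym:
  assumes "distinct es" "set es = M" "distinct ds" "set ds = N"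
  shows "circ W_operad i (osym (t, M) es) (osym (s, N) ds) = W_graft i (t, M) es (s, N) ds"
proof -
  have 1: "alternating (\<lambda>es. W_graft i (t, M) es (s, N) (sorted_list_of_set N) :: mtree \<Rightarrow>\<^sub>0 'a)"
    unfolding W_graft_def using osym_alternating[where xs = "[]" and f = "\<lambda>x. x"]
    by (simp add: Let_def)
  have 2: "alternating (\<lambda>ds. W_graft i (t, M) es (s, N) ds :: mtree \<Rightarrow>\<^sub>0 'a)"
    unfolding W_graft_def using osym_alternating[where ys = "[]"] by (simp add: Let_def)
  have "circ W_operad i (osym (t, M) es) (osym (s, N) ds) = scale (of_int (wedge_sign ds))
      (scale (of_int (wedge_sign es))
        (W_graft i (t, M) (sorted_list_of_set M) (s, N) (sorted_list_of_set N)) :: mtree \<Rightarrow>\<^sub>0 'a)"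
    by (simp add: W_operad_def osym_def[of "(t, M)"] osym_def[of "(s, N)"] lin_ext_single
        scale_scale mult.commute)
  also have "\<dots> = scale (of_int (wedge_sign ds)) (W_graft i (t, M) es (s, N) (sorted_list_of_set N))"
    unfolding alternating_sorted_list_of_set[OF 1 assms(1,2)] ..
  also have "\<dots> = W_graft i (t, M) es (s, N) ds"
    by (rule alternating_sorted_list_of_set[OF 2 assms(3,4)])
  finally show ?thesis .
qed

lemma alternating_faces:
  fixes F :: "'e \<Rightarrow> 'e list \<Rightarrow> ('b \<Rightarrow>\<^sub>0 'k::comm_ring_1)"
  assumes F: "\<And>e. alternating (F e)"
  shows "alternating (\<lambda>es. \<Sum>i<length es. scale ((-1) ^ Suc i) (F (es ! i) (take i es @ drop (Suc i) es)))"
proof -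
  define H where
    "H es i = scale ((-1) ^ Suc i) (F (es ! i) (take i es @ drop (Suc i) es))" for es :: "'e list" and i
  have "(\<Sum>i<length (xs @ b # a # ys). H (xs @ b # a # ys) i) =
        - (\<Sum>i<length (xs @ a # b # ys). H (xs @ a # b # ys) i)" for xs ys a b
  proof -
    let ?u = "xs @ b # a # ys" and ?v = "xs @ a # b # ys" and ?p = "length xs"
    let ?\<pi> = "\<lambda>i. if i = ?p then Suc ?p else if i = Suc ?p then ?p else i"
    have H: "H ?u i = - H ?v (?\<pi> i)" if i: "i < length ?u" for i
    proof -
      have "i < ?p \<or> i = ?p \<or> i = Suc ?p \<or> (i = ?p + 2 + (i - ?p - 2) \<and> i - ?p - 2 < length ys)"
        using i by auto
      then consider "i < ?p" | "i = ?p" | "i = Suc ?p" | j where "i = ?p + 2 + j" "j < length ys"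
        by blast
      then show ?thesis
      proof cases
        case 1
        then have "?\<pi> i = i" by simp
        moreover have "F (xs ! i) ((take i xs @ drop (Suc i) xs) @ b # a # ys) =
            - F (xs ! i) ((take i xs @ drop (Suc i) xs) @ a # b # ys)"
          using F unfolding alternating_def by blast
        ultimately show ?thesis using 1 by (simp add: H_def nth_append scale_minus)
      next
        case 2
        then show ?thesis by (simp add: H_def nth_append scale_minus)
      next
        case 3
        then show ?thesis by (simp add: H_def nth_append scale_minus)
      next
        case 4
        then have "?\<pi> i = i" by simp
        moreover have "F (ys ! j) (xs @ b # a # (take j ys @ drop (Suc j) ys)) =
            - F (ys ! j) (xs @ a # b # (take j ys @ drop (Suc j) ys))"
          using F unfolding alternating_def by blast
        moreover have "drop (3 + j) (c # d # ys) = drop (Suc j) ys" for c d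
          by (simp add: numeral_3_eq_3)
        ultimately show ?thesis using 4 by (simp add: H_def nth_append scale_minus)
      qed
    qed
    have "bij_betw ?\<pi> {..<length ?u} {..<length ?v}"
      by (rule bij_betw_byWitness[where f' = ?\<pi>]) (auto split: if_splits)
    then have "(\<Sum>i<length ?u. H ?v (?\<pi> i)) = (\<Sum>i<length ?v. H ?v i)"
      by (rule sum.reindex_bij_betw)
    moreover have "(\<Sum>i<length ?u. H ?u i) = (\<Sum>i<length ?u. - H ?v (?\<pi> i))"
      using H by (intro sum.cong) auto
    ultimately show ?thesis by (simp add: sum_negf)
  qed
  then show ?thesis unfolding alternating_def H_def by blast
qed

lemma W_bd_osym:
  assumes "distinct es" "set es = M"
  shows "bdry W_operad (osym (t, M) es) = W_faces (t, M) es"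
proof -
  have "alternating (\<lambda>ds.
          osym (collapse t e, collapse_addr t e ` (M - {e})) (map (collapse_addr t e) ds)
            - osym (t, M - {e}) ds :: mtree \<Rightarrow>\<^sub>0 'a)" for e
    using osym_alternating[of _ "[]" "collapse_addr t e" "[]"] osym_alternating[of _ "[]" "\<lambda>d. d" "[]"]
    by (intro alternating_diff) simp_all
  then have "alternating (\<lambda>es. W_faces (t, M) es :: mtree \<Rightarrow>\<^sub>0 'a)"
    unfolding W_faces_def Let_def fst_conv snd_conv by (rule alternating_faces)
  from alternating_sorted_list_of_set[OF this assms] show ?thesis
    by (simp add: W_operad_def osym_def[of "(t, M)"] lin_ext_single)
qed

end

theory Submission
  imports Defs "HOL-Library.Sublist"
begin

text \<open>The standard orientation has a closed form that carries the whole argument.  List the vertices of a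
binary tree \<open>t\<close> in symmetric order (left subtree, vertex, right subtree).  A non-root vertex stands
for the edge below it, and the root \<open>[]\<close> for a formal edge below the root.  Then \<open>[] \<and> \<omega>\<^sub>t\<close> is the
wedge of this list.  For the right comb this holds because its list already starts with the root and
moves away from it.  An elementary move keeps the positions of all vertices in the list and
exchanges the names of just two of them, \<open>v\<close> and the vertex above it (\<open>inorder_move\<close>); this
transposition is the sign in the definition of \<open>\<omega>\<close>.  Hence \<open>\<omega>\<^sub>t\<close> does not depend on the chosen moves,
and relative to the increasing order of the edges it is the sign of the list
(\<open>standard_chain_closed_form\<close>).

Let \<open>q(c(n))\<close> be the sum of all binary trees.  Its boundary has faces of two kinds.  A face that
collapses the edge of a configuration \<open>A(BC)\<close> at \<open>v\<close> also arises from the tree with \<open>(AB)C\<close> at \<open>v\<close>,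
with the opposite sign, so these faces cancel (\<open>collapse_terms_cancel\<close>).  A face that makes an edge
non-metric is a composite \<open>t \<circ>\<^sub>i s\<close> of two binary trees.  In symmetric order, the list of the composite
is the list of \<open>t\<close> with the list of \<open>s\<close> inserted after \<open>i - 1\<close> entries; permuting blocks shows that
the face has the sign \<open>(-1)^(r m + i (m + 1))\<close>, where \<open>r\<close> and \<open>m\<close> are the numbers of leaves of \<open>t\<close> and \<open>s\<close>
(\<open>std_sign_graft\<close>).  This is the sign of \<open>c(r) \<circ>\<^sub>i c(m)\<close> in the boundary of the corolla
(\<open>bdry_corolla\<close>), which settles the identity on corollas (\<open>comparison_bdry_corolla\<close>).

The operad of cellular chains is free on corollas.  Concretely, every tree arises from a corolla by
grafting corollas, its edges being created in lexicographic order (\<open>ptree_induct\<close>), which gives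
uniqueness and suggests the definition of \<open>comparison\<close>.  For compatibility with all compositions,
the main point is that the last edge may be replaced by any edge that carries only leaves; the
parallel associativity law makes the choice irrelevant, the exchange of two edges in the orientation
accounting for its sign (\<open>comparison_top_edge\<close>).  The general case follows from sequential
associativity on both sides (\<open>K_circ_assoc\<close>, \<open>W_circ_assoc\<close>).

Both boundaries are derivations (\<open>K_derivation_osym\<close>, \<open>W_derivation\<close>), so compatibility with the
boundary passes from corollas to all trees (\<open>comparison_bdry_basis\<close>).\<close>

section \<open>Linear maps between spaces of chains\<close>

abbreviation keys :: "('a \<Rightarrow>\<^sub>0 'k::zero) \<Rightarrow> 'a set" where
  "keys \<equiv> Poly_Mapping.keys"

abbreviation basis :: "'a \<Rightarrow> ('a \<Rightarrow>\<^sub>0 'k::zero_neq_one)" where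
  "basis b \<equiv> Poly_Mapping.single b 1"

abbreviation edges :: "ptree \<Rightarrow> addr set" where
  "edges \<equiv> internal_edges"

abbreviation circ_K :: "nat \<Rightarrow> (ptree \<Rightarrow>\<^sub>0 'k::field) \<Rightarrow> _" where "circ_K \<equiv> circ K_operad"
abbreviation circ_W :: "nat \<Rightarrow> (mtree \<Rightarrow>\<^sub>0 'k::field) \<Rightarrow> _" where "circ_W \<equiv> circ W_operad"
abbreviation bd_K :: "(ptree \<Rightarrow>\<^sub>0 'k::field) \<Rightarrow> _" where "bd_K \<equiv> bdry K_operad"
abbreviation bd_W :: "(mtree \<Rightarrow>\<^sub>0 'k::field) \<Rightarrow> _" where "bd_W \<equiv> bdry W_operad"

definition chain_linear :: "(('a \<Rightarrow>\<^sub>0 'k::comm_ring_1) \<Rightarrow> ('b \<Rightarrow>\<^sub>0 'k)) \<Rightarrow> bool" where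
  "chain_linear F \<longleftrightarrow> (\<forall>x y. F (x + y) = F x + F y) \<and> (\<forall>c x. F (scale c x) = scale c (F x))"

lemma chain_linearI:
  "(\<And>x y. F (x + y) = F x + F y) \<Longrightarrow> (\<And>c x. F (scale c x) = scale c (F x)) \<Longrightarrow> chain_linear F"
  by (simp add: chain_linear_def)

lemma chain_linear_add: "chain_linear F \<Longrightarrow> F (x + y) = F x + F y"
  and chain_linear_scale: "chain_linear F \<Longrightarrow> F (scale c x) = scale c (F x)"
  by (simp_all add: chain_linear_def)

lemma chain_linear_zero: "chain_linear F \<Longrightarrow> F 0 = 0"
  using chain_linear_scale[of F 0 0] by simp

lemma chain_linear_uminus: "chain_linear F \<Longrightarrow> F (- x) = - F x"
  using chain_linear_scale[of F "-1" x] by (simp add: scale_minus(2))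

lemma chain_linear_diff: "chain_linear F \<Longrightarrow> F (x - y) = F x - F y"
  using chain_linear_add[of F x "- y"] by (simp add: chain_linear_uminus)

lemma chain_linear_sum: "chain_linear F \<Longrightarrow> F (sum f A) = (\<Sum>a\<in>A. F (f a))"
  by (induction A rule: infinite_finite_induct) (simp_all add: chain_linear_zero chain_linear_add)

lemma scale_add: "scale c (x + y) = scale c x + scale c y"
  by (rule poly_mapping_eqI) (simp add: lookup_add algebra_simps)

lemma scale_left_add: "scale (c + d) x = scale c x + scale d x"
  by (rule poly_mapping_eqI) (simp add: lookup_add algebra_simps)

lemma lin_ext_superset:
  assumes "finite A" "keys x \<subseteq> A"
  shows "lin_ext f x = (\<Sum>b\<in>A. scale (Poly_Mapping.lookup x b) (f b))"
  unfolding lin_ext_def using assms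
  by (intro sum.mono_neutral_left) (auto simp: in_keys_iff)

lemma chain_linear_lin_ext: "chain_linear (lin_ext f)"
proof (rule chain_linearI)
  fix x y :: "'a \<Rightarrow>\<^sub>0 'b"
  have "keys (x + y) \<subseteq> keys x \<union> keys y" by (rule keys_add)
  then show "lin_ext f (x + y) = lin_ext f x + lin_ext f y"
    by (simp add: lin_ext_superset[of "keys x \<union> keys y"] lookup_add scale_left_add sum.distrib)
next
  fix c and x :: "'a \<Rightarrow>\<^sub>0 'b"
  have "keys (scale c x) \<subseteq> keys x" by (auto simp: in_keys_iff)
  then show "lin_ext f (scale c x) = scale c (lin_ext f x)"
    by (simp add: lin_ext_superset[of "keys x"] scale_sum scale_scale)
qed

lemma chain_as_sum: "x = (\<Sum>b\<in>keys x. scale (Poly_Mapping.lookup x b) (basis b))"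
proof (rule poly_mapping_eqI)
  fix k
  have "Poly_Mapping.lookup (\<Sum>b\<in>keys x. scale (Poly_Mapping.lookup x b) (basis b)) k
      = (\<Sum>b\<in>keys x. if b = k then Poly_Mapping.lookup x b else 0)"
    unfolding lookup_sum by (intro sum.cong) (auto simp: lookup_single when_def)
  then show "Poly_Mapping.lookup x k = Poly_Mapping.lookup (\<Sum>b\<in>keys x. scale (Poly_Mapping.lookup x b) (basis b)) k"
    by (simp add: in_keys_iff)
qed

text \<open>Identities between linear maps are checked on those basis elements that occur in the argument, so
that conditions on trees, such as their arity, can be read off from \<open>keys\<close>.\<close>

lemma chain_linear_eq_on:
  assumes "chain_linear F" "chain_linear G" "\<And>b. b \<in> keys x \<Longrightarrow> F (basis b) = G (basis b)"
  shows "F x = G x"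
proof -
  have "F x = (\<Sum>b\<in>keys x. scale (Poly_Mapping.lookup x b) (F (basis b)))"
    by (subst chain_as_sum) (simp add: chain_linear_sum chain_linear_scale assms(1))
  also have "\<dots> = (\<Sum>b\<in>keys x. scale (Poly_Mapping.lookup x b) (G (basis b)))"
    using assms(3) by (intro sum.cong) auto
  also have "\<dots> = G x"
    by (subst (3) chain_as_sum) (simp add: chain_linear_sum chain_linear_scale assms(2))
  finally show ?thesis .
qed

lemma chain_bilinear_eq_on:
  assumes F: "\<And>y. chain_linear (\<lambda>x. F x y)" "\<And>x. chain_linear (F x)"
    and G: "\<And>y. chain_linear (\<lambda>x. G x y)" "\<And>x. chain_linear (G x)"
    and eq: "\<And>a b. a \<in> keys x \<Longrightarrow> b \<in> keys y \<Longrightarrow> F (basis a) (basis b) = G (basis a) (basis b)"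
  shows "F x y = G x y"
proof (rule chain_linear_eq_on[OF F(1) G(1)])
  fix a assume "a \<in> keys x"
  then show "F (basis a) y = G (basis a) y" by (rule chain_linear_eq_on[OF F(2) G(2) eq])
qed

lemma chain_trilinear_eq_on:
  assumes F: "\<And>y z. chain_linear (\<lambda>x. F x y z)" "\<And>x z. chain_linear (\<lambda>y. F x y z)" "\<And>x y. chain_linear (F x y)"
    and G: "\<And>y z. chain_linear (\<lambda>x. G x y z)" "\<And>x z. chain_linear (\<lambda>y. G x y z)" "\<And>x y. chain_linear (G x y)"
    and eq: "\<And>a b c. a \<in> keys x \<Longrightarrow> b \<in> keys y \<Longrightarrow> c \<in> keys z \<Longrightarrow>
      F (basis a) (basis b) (basis c) = G (basis a) (basis b) (basis c)"
  shows "F x y z = G x y z"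
proof (rule chain_linear_eq_on[OF F(1) G(1)])
  fix a assume "a \<in> keys x"
  then show "F (basis a) y z = G (basis a) y z" by (rule chain_bilinear_eq_on[OF F(2,3) G(2,3) eq])
qed

lemma lin_ext_linear_param:
  assumes "\<And>b. chain_linear (\<lambda>y. f y b)"
  shows "chain_linear (\<lambda>y. lin_ext (f y) x)"
  using assms unfolding chain_linear_def lin_ext_def
  by (auto simp: scale_add sum.distrib scale_sum scale_scale mult.commute)

lemma K_circ_linear: "chain_linear (\<lambda>x. circ_K i x y)" "chain_linear (circ_K i x)"
  unfolding K_operad_def by (simp_all add: chain_linear_lin_ext lin_ext_linear_param)

lemma W_circ_linear: "chain_linear (\<lambda>x. circ_W i x y)" "chain_linear (circ_W i x)"
  unfolding W_operad_def by (simp_all add: chain_linear_lin_ext lin_ext_linear_param)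

lemma bdry_linear: "chain_linear bd_K" "chain_linear bd_W"
  unfolding K_operad_def W_operad_def by (simp_all add: chain_linear_lin_ext)

lemma chain_linear_comp: "chain_linear F \<Longrightarrow> chain_linear G \<Longrightarrow> chain_linear (\<lambda>x. F (G x))"
  by (simp add: chain_linear_def)

lemma chain_linear_id: "chain_linear (\<lambda>x. x)"
  by (simp add: chain_linear_def)

lemma chain_linear_scaled: "chain_linear F \<Longrightarrow> chain_linear (\<lambda>x. scale c (F x))"
  by (simp add: chain_linear_def scale_add scale_scale mult.commute)

lemma chain_linear_plus: "chain_linear F \<Longrightarrow> chain_linear G \<Longrightarrow> chain_linear (\<lambda>x. F x + G x)"
  by (simp add: chain_linear_def scale_add)

lemmas chain_linear_intros = chain_linear_id chain_linear_scaled chain_linear_plus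
  chain_linear_comp[OF K_circ_linear(1)] chain_linear_comp[OF K_circ_linear(2)]
  chain_linear_comp[OF W_circ_linear(1)] chain_linear_comp[OF W_circ_linear(2)]
  chain_linear_comp[OF bdry_linear(1)] chain_linear_comp[OF bdry_linear(2)]

section \<open>Signs of orderings\<close>

lemma wedge_sign_square: "distinct xs \<Longrightarrow> wedge_sign xs * wedge_sign xs = 1"
proof (induction xs)
  case (Cons a xs)
  have "((-1) ^ n * w) * ((-1) ^ n * w) = w * (w :: int)" for n w
    by (cases "even n") auto
  then show ?case using Cons by (simp only: wedge_sign.simps distinct.simps if_False simp_thms)
qed simp

lemma wedge_sign_cases: "distinct xs \<Longrightarrow> wedge_sign xs = 1 \<or> wedge_sign xs = -1"
  using wedge_sign_square[of xs] by (simp add: square_eq_1_iff)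

lemma wedge_sign_sorted: "sorted xs \<Longrightarrow> distinct xs \<Longrightarrow> wedge_sign xs = 1"
proof (induction xs)
  case (Cons a es)
  then have "filter (\<lambda>d. d < a) es = []" by (simp add: filter_empty_conv not_less)
  with Cons show ?case by simp
qed simp

text \<open>The address of the root is the least one, so that a formal edge below the root can be prepended.\<close>

lemma wedge_sign_root: "[] \<notin> set es \<Longrightarrow> wedge_sign (([] :: addr) # es) = wedge_sign es"
  by simp

lemma alternating_swap_blocks:
  assumes "alternating G"
  shows "G (us @ xs @ ys @ vs :: 'e list) = scale ((-1) ^ (length xs * length ys)) (G (us @ ys @ xs @ vs) :: 'b \<Rightarrow>\<^sub>0 'k::comm_ring_1)"
proof -
  have one: "G (us @ a # ys @ vs) = scale ((-1) ^ length ys) (G (us @ ys @ a # vs))" for a us vs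
  proof (induction ys arbitrary: us)
    case (Cons y ys)
    have "G (us @ a # y # ys @ vs) = - G (us @ y # a # ys @ vs)"
      using assms unfolding alternating_def by blast
    then show ?case using Cons[of "us @ [y]"] by (simp add: scale_minus)
  qed simp
  show ?thesis
  proof (induction xs arbitrary: us)
    case (Cons x xs)
    show ?case using Cons[of "us @ [x]"] one[of us x "xs @ vs"]
      by (simp add: scale_scale power_add mult.commute)
  qed simp
qed

text \<open>Both lists have the same sorted form, and the sign of the permutation between them is the product of
the signs of their sorting permutations.\<close>

lemma alternating_reorder:
  assumes "alternating (G :: 'e::linorder list \<Rightarrow> ('b \<Rightarrow>\<^sub>0 'k::comm_ring_1))"
    and "distinct xs" "distinct ys" "set xs = set ys"
  shows "G ys = scale (of_int (wedge_sign xs * wedge_sign ys)) (G xs)"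
proof -
  have s: "sort xs = sort ys"
    using assms by (metis sorted_list_of_set_sort_remdups distinct_remdups_id)
  have "G xs = scale (of_int (wedge_sign xs)) (G (sort xs))"
    and y: "G ys = scale (of_int (wedge_sign ys)) (G (sort ys))"
    using alternating_sort[OF assms(1), of xs "[]"] alternating_sort[OF assms(1), of ys "[]"] assms by auto
  then have "scale (of_int (wedge_sign xs * wedge_sign ys)) (G xs)
     = scale (of_int (wedge_sign ys * (wedge_sign xs * wedge_sign xs))) (G (sort xs))"
    by (simp add: scale_scale ac_simps)
  with y show ?thesis by (simp add: wedge_sign_square assms(2) s)
qed

lemma osym_swap_blocks:
  "osym b (us @ xs @ ys @ vs) = scale ((-1) ^ (length xs * length ys)) (osym b (us @ ys @ xs @ vs))"
  by (rule alternating_swap_blocks) (use osym_alternating[of b "[]" "\<lambda>x. x" "[]"] in simp)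

lemma wedge_sign_swap_blocks:
  fixes xs :: "addr list"
  shows "wedge_sign (us @ xs @ ys @ vs) = (-1) ^ (length xs * length ys) * wedge_sign (us @ ys @ xs @ vs)"
proof -
  have "(osym () (us @ xs @ ys @ vs) :: unit \<Rightarrow>\<^sub>0 int) = scale ((-1) ^ (length xs * length ys)) (osym () (us @ ys @ xs @ vs))"
    by (rule osym_swap_blocks)
  from arg_cong[OF this, of "\<lambda>x. Poly_Mapping.lookup x ()"] show ?thesis by (simp add: osym_def)
qed

text \<open>Reordering a block changes the sign of the whole list by the relative sign of the two orders alone;
the elements of the block may be renamed by an arbitrary \<open>f\<close>, because the renamed list is still
alternating in the block.  The map \<open>f\<close> will be the identification of edges under a move or a grafting.\<close>

lemma wedge_sign_reorder:
  fixes us vs :: "addr list" and xs ys :: "'e::linorder list"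
  assumes "distinct xs" "distinct ys" "set xs = set ys"
  shows "wedge_sign (us @ map f ys @ vs) = wedge_sign xs * wedge_sign ys * wedge_sign (us @ map f xs @ vs)"
proof -
  have "(osym () (us @ map f ys @ vs) :: unit \<Rightarrow>\<^sub>0 int) =
      scale (of_int (wedge_sign xs * wedge_sign ys)) (osym () (us @ map f xs @ vs))"
    by (rule alternating_reorder[OF osym_alternating assms])
  from arg_cong[OF this, of "\<lambda>x. Poly_Mapping.lookup x ()"] show ?thesis by (simp add: osym_def)
qed

lemma wedge_sign_transpose:
  fixes a b :: addr
  shows "wedge_sign (us @ b # xs @ a # vs) = - wedge_sign (us @ a # xs @ b # vs)"
proof -
  have "wedge_sign (us @ b # xs @ a # vs) = (-1) ^ length xs * wedge_sign (us @ xs @ b # a # vs)"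
    using wedge_sign_swap_blocks[of us "[b]" xs "a # vs"] by simp
  also have "\<dots> = - ((-1) ^ length xs * wedge_sign (us @ xs @ a # b # vs))"
    using wedge_sign_swap[of "us @ xs" b a vs] by simp
  also have "(-1) ^ length xs * wedge_sign (us @ xs @ a # b # vs) = wedge_sign (us @ a # xs @ b # vs)"
    using wedge_sign_swap_blocks[of us "[a]" xs "b # vs"] by simp
  finally show ?thesis .
qed

lemma osym_single: "osym b es = scale (of_int (wedge_sign es)) (basis b)"
  by (rule poly_mapping_eqI) (simp add: osym_def lookup_single when_def)

lemma single_osym:
  "distinct es \<Longrightarrow> (basis b :: 'a \<Rightarrow>\<^sub>0 'b::comm_ring_1) = scale (of_int (wedge_sign es)) (osym b es)"
proof -
  assume "distinct es"
  then have "of_int (wedge_sign es) * of_int (wedge_sign es) = (1 :: 'b)"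
    by (simp only: wedge_sign_square of_int_1 flip: of_int_mult)
  then show ?thesis by (simp add: osym_single scale_scale)
qed

section \<open>Vertices, leaves and grafting\<close>

definition vertices :: "ptree \<Rightarrow> addr set" where
  "vertices t = {a. \<exists>ts. subtree t a = Some (Node ts)}"

text \<open>Covers both the condition that vertices have at least two inputs and binarity, which behave alike
under grafting and cutting.\<close>

definition every_arity :: "(nat \<Rightarrow> bool) \<Rightarrow> ptree \<Rightarrow> bool" where
  "every_arity P t \<longleftrightarrow> (\<forall>a ts. subtree t a = Some (Node ts) \<longrightarrow> P (length ts))"

lemma ptrees_iff: "t \<in> ptrees n \<longleftrightarrow> t \<noteq> Leaf \<and> every_arity ((\<le>) 2) t \<and> leaf_count t = n"
  by (auto simp: ptrees_def every_arity_def)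

lemma binary_ptrees_iff: "t \<in> binary_ptrees n \<longleftrightarrow> t \<noteq> Leaf \<and> every_arity (\<lambda>k. k = 2) t \<and> leaf_count t = n"
  by (auto simp: ptrees_def binary_ptrees_def every_arity_def)

lemma vertices_Leaf [simp]: "vertices Leaf = {}"
proof -
  have "subtree Leaf a \<noteq> Some (Node ts)" for a ts by (cases a) auto
  then show ?thesis by (simp add: vertices_def)
qed

lemma vertices_Node: "vertices (Node ts) = insert [] (\<Union>j<length ts. (#) j ` vertices (ts ! j))"
proof (rule set_eqI)
  fix a show "a \<in> vertices (Node ts) \<longleftrightarrow> a \<in> insert [] (\<Union>j<length ts. (#) j ` vertices (ts ! j))"
    by (cases a) (auto simp: vertices_def)
qed

lemma Nil_in_vertices_iff: "[] \<in> vertices t \<longleftrightarrow> t \<noteq> Leaf"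
  by (cases t) (auto simp: vertices_def)

lemma internal_edges_vertices: "edges t = vertices t - {[]}"
  by (auto simp: internal_edges_def vertices_def)

lemma vertices_internal_edges: "t \<noteq> Leaf \<Longrightarrow> vertices t = insert [] (edges t)"
  by (auto simp: internal_edges_vertices Nil_in_vertices_iff)

lemma finite_vertices [simp]: "finite (vertices t)"
proof (induction t)
  case (Node ts)
  then show ?case by (simp add: vertices_Node)
qed simp

lemma finite_internal_edges [simp]: "finite (edges t)"
  by (simp add: internal_edges_vertices)

lemma every_arity_Leaf [simp]: "every_arity P Leaf"
  using vertices_Leaf unfolding vertices_def every_arity_def by blast

lemma every_arity_Node: "every_arity P (Node ts) \<longleftrightarrow> P (length ts) \<and> (\<forall>t\<in>set ts. every_arity P t)"
proof
  assume *: "every_arity P (Node ts)"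
  have "P (length us)" if "j < length ts" "subtree (ts ! j) a = Some (Node us)" for j a us
    using * that unfolding every_arity_def by (metis subtree.simps(3))
  moreover have "P (length ts)" using * unfolding every_arity_def by (metis subtree.simps(1))
  ultimately show "P (length ts) \<and> (\<forall>t\<in>set ts. every_arity P t)"
    by (auto simp: every_arity_def in_set_conv_nth)
next
  assume *: "P (length ts) \<and> (\<forall>t\<in>set ts. every_arity P t)"
  show "every_arity P (Node ts)" unfolding every_arity_def
  proof (intro allI impI)
    fix a us assume "subtree (Node ts) a = Some (Node us)"
    then show "P (length us)" using *
      by (cases a) (auto simp: every_arity_def split: if_splits dest: nth_mem)
  qed
qed

lemma subtree_append:
  "subtree t (p @ q) = (case subtree t p of None \<Rightarrow> None | Some s \<Rightarrow> subtree s q)"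
  by (induction t p rule: subtree.induct) auto

lemma subtree_subst_append:
  "subtree t p \<noteq> None \<Longrightarrow> subtree (subst t p s) (p @ q) = subtree s q"
  by (induction t p s rule: subst.induct) (auto split: if_splits)

lemma subtree_subst_same: "subtree t p \<noteq> None \<Longrightarrow> subtree (subst t p s) p = Some s"
  using subtree_subst_append[of t p s "[]"] by simp

lemma subst_subst: "subtree t p \<noteq> None \<Longrightarrow> subst (subst t p u) (p @ q) s = subst t p (subst u q s)"
  by (induction t p u rule: subst.induct) (auto split: if_splits)

lemma subst_subst_same: "subst (subst t p u) p s = subst t p s"
proof (induction t p u rule: subst.induct)
  case (3 ts j p u)
  then show ?case by (cases "j < length ts") (auto simp: not_less list_update_beyond)
qed auto

lemma subst_subtree: "subtree t p = Some s \<Longrightarrow> subst t p s = t"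
  by (induction t p s rule: subst.induct) (auto split: if_splits)

lemma prefix_appendI [simp]: "prefix p (p @ q)"
  by (simp add: prefix_def)

lemma subtree_subst_not_prefix:
  "\<not> prefix p a \<Longrightarrow> subtree (subst t p s) a =
     (if prefix a p then map_option (\<lambda>u. subst u (drop (length a) p) s) (subtree t a) else subtree t a)"
proof (induction t p s arbitrary: a rule: subst.induct)
  case (3 ts j p s)
  show ?case
  proof (cases a)
    case (Cons i b)
    then show ?thesis using 3 by (cases "i = j") auto
  qed (use 3 in simp)
next
  case (2 j q s)
  then show ?case by (cases a) auto
qed (auto split: list.splits simp: prefix_def)

lemma subst_commute:
  "\<not> prefix p q \<Longrightarrow> \<not> prefix q p \<Longrightarrow> subst (subst t p s) q u = subst (subst t q u) p s"
proof (induction t p s arbitrary: q rule: subst.induct)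
  case (3 ts j p s)
  show ?case
  proof (cases q)
    case (Cons k r)
    with 3 show ?thesis by (cases "k = j"; cases "j < length ts"; cases "k < length ts") (auto simp: list_update_swap not_less list_update_beyond)
  qed (use 3 in auto)
next
  case (2 j a s)
  then show ?case by (cases q) auto
qed (auto simp: prefix_def)

lemma vertices_subst:
  "subtree t p = Some Leaf \<Longrightarrow> vertices (subst t p s) = vertices t \<union> (@) p ` vertices s"
proof (induction t p s rule: subst.induct)
  case (3 ts j p s)
  then have j: "j < length ts" and l: "subtree (ts ! j) p = Some Leaf" by (auto split: if_splits)
  then have *: "vertices (subst (ts ! j) p s) = vertices (ts ! j) \<union> (@) p ` vertices s" using 3 by simp
  have "(\<Union>i<length ts. (#) i ` vertices (ts[j := subst (ts ! j) p s] ! i)) =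
     (\<Union>i<length ts. (#) i ` vertices (ts ! i)) \<union> (#) j ` (@) p ` vertices s"
  proof -
    have "(#) i ` vertices (ts[j := subst (ts ! j) p s] ! i) =
        (#) i ` vertices (ts ! i) \<union> (if i = j then (#) j ` (@) p ` vertices s else {})" for i
      using * j by (cases "i = j") auto
    with j show ?thesis by (auto split: if_splits)
  qed
  then show ?case by (simp add: vertices_Node image_image)
qed auto

lemma not_prefix_leaf_vertex: "subtree t p = Some Leaf \<Longrightarrow> d \<in> vertices t \<Longrightarrow> \<not> prefix p d"
proof
  assume "subtree t p = Some Leaf" "d \<in> vertices t" "prefix p d"
  then obtain q ts where "subtree Leaf q = Some (Node ts)"
    by (auto simp: prefix_def vertices_def subtree_append)
  then show False by (cases q) auto
qed

lemma not_prefix_leaf_leaf: "subtree t p = Some Leaf \<Longrightarrow> subtree t q = Some Leaf \<Longrightarrow> p \<noteq> q \<Longrightarrow> \<not> prefix p q"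
proof
  assume "subtree t p = Some Leaf" "subtree t q = Some Leaf" "prefix p q" "p \<noteq> q"
  then obtain r where r: "q = p @ r" "r \<noteq> []" by (auto simp: prefix_def)
  with \<open>subtree t p = Some Leaf\<close> \<open>subtree t q = Some Leaf\<close> have "subtree Leaf r = Some Leaf"
    by (simp add: subtree_append)
  with r show False by (cases r) auto
qed

lemma vertices_subst_disjoint: "subtree t p = Some Leaf \<Longrightarrow> vertices t \<inter> (@) p ` A = {}"
  using not_prefix_leaf_vertex by fastforce

lemma leaf_not_Nil: "subtree t p = Some Leaf \<Longrightarrow> t \<noteq> Leaf \<Longrightarrow> p \<noteq> []"
  by auto

lemma leaf_not_vertex: "subtree t p = Some Leaf \<Longrightarrow> p \<notin> vertices t"
  by (simp add: vertices_def)

lemma internal_edges_subst: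
  assumes "subtree t p = Some Leaf" "t \<noteq> Leaf" "s \<noteq> Leaf"
  shows "edges (subst t p s) = edges t \<union> (@) p ` edges s \<union> {p}"
  using vertices_subst[OF assms(1), of s] leaf_not_Nil[OF assms(1,2)] assms(2,3)
  by (auto simp: internal_edges_vertices Nil_in_vertices_iff)

lemma card_internal_edges_subst:
  assumes "subtree t p = Some Leaf" "t \<noteq> Leaf" "s \<noteq> Leaf"
  shows "card (edges (subst t p s)) = card (edges t) + card (edges s) + 1"
proof -
  have "card ((@) p ` edges s) = card (edges s)"
    by (simp add: card_image inj_on_def)
  moreover have "p \<notin> edges t \<union> (@) p ` edges s"
    using leaf_not_vertex[OF assms(1)] by (auto simp: internal_edges_vertices)
  moreover have "edges t \<inter> (@) p ` edges s = {}"
    using vertices_subst_disjoint[OF assms(1)] by (auto simp: internal_edges_vertices)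
  ultimately show ?thesis unfolding internal_edges_subst[OF assms]
    by (simp add: card_Un_disjoint)
qed

lemma every_arity_subst:
  "subtree t p = Some Leaf \<Longrightarrow> every_arity P (subst t p s) \<longleftrightarrow> every_arity P t \<and> every_arity P s"
proof (induction t p s rule: subst.induct)
  case (3 ts j p s)
  then have j: "j < length ts" and l: "subtree (ts ! j) p = Some Leaf" by (auto split: if_splits)
  have "(\<forall>i<length ts. every_arity P (ts[j := subst (ts ! j) p s] ! i)) \<longleftrightarrow> (\<forall>i<length ts. every_arity P (ts ! i)) \<and> every_arity P s"
    using j "3.IH"[OF l] by (metis nth_list_update)
  then show ?case by (auto simp: every_arity_Node all_set_conv_all_nth)
qed auto

lemma subst_not_Leaf: "t \<noteq> Leaf \<Longrightarrow> p \<noteq> [] \<Longrightarrow> subst t p s \<noteq> Leaf"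
  by (cases t; cases p) auto

subsection \<open>The order of the leaves\<close>

lemma leaf_addrs_Node: "leaf_addrs (Node ts) = concat (map (\<lambda>j. map ((#) j) (leaf_addrs (ts ! j))) [0..<length ts])"
  unfolding leaf_addrs.simps by (rule arg_cong[of _ _ concat], rule nth_equalityI) auto

lemma set_leaf_addrs: "set (leaf_addrs t) = {a. subtree t a = Some Leaf}"
proof (induction t)
  case Leaf
  have "subtree Leaf a = Some Leaf \<longleftrightarrow> a = []" for a by (cases a) auto
  then show ?case by auto
next
  case (Node ts)
  have "a \<in> set (leaf_addrs (Node ts)) \<longleftrightarrow> subtree (Node ts) a = Some Leaf" for a
    using Node by (cases a) (auto simp: leaf_addrs_Node simp del: leaf_addrs.simps)
  then show ?case by blast
qed

lemma sorted_leaf_addrs: "sorted_wrt (<) (leaf_addrs t)"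
proof (induction t)
  case (Node ts)
  have *: "sorted_wrt (<) (concat (map (\<lambda>j. map ((#) j) (leaf_addrs (ts ! j))) js))"
    if "sorted_wrt (<) js" "set js \<subseteq> {..<length ts}" for js
    using that Node by (induction js) (auto simp: sorted_wrt_append sorted_wrt_map)
  show ?case unfolding leaf_addrs_Node by (rule *) auto
qed simp

lemma distinct_leaf_addrs: "distinct (leaf_addrs t)"
  using sorted_leaf_addrs[of t] by (simp add: strict_sorted_iff)

lemma leaf_addr_less: "1 \<le> i \<Longrightarrow> i < j \<Longrightarrow> j \<le> leaf_count t \<Longrightarrow> leaf_addr t i < leaf_addr t j"
  using sorted_wrt_nth_less[OF sorted_leaf_addrs, of "i - 1" "j - 1" t] by (simp add: leaf_addr_def leaf_count_def)

lemma leaf_addr_index: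
  assumes "subtree t p = Some Leaf"
  obtains i where "1 \<le> i" "i \<le> leaf_count t" "leaf_addr t i = p"
proof -
  have "p \<in> set (leaf_addrs t)" using assms by (simp add: set_leaf_addrs)
  then obtain k where "k < length (leaf_addrs t)" "leaf_addrs t ! k = p" by (auto simp: in_set_conv_nth)
  then show ?thesis using that[of "Suc k"] by (simp add: leaf_addr_def leaf_count_def)
qed

lemma subtree_leaf_addr: "1 \<le> i \<Longrightarrow> i \<le> leaf_count t \<Longrightarrow> subtree t (leaf_addr t i) = Some Leaf"
proof -
  assume "1 \<le> i" "i \<le> leaf_count t"
  then have "leaf_addr t i \<in> set (leaf_addrs t)" by (auto simp: leaf_addr_def leaf_count_def)
  then show ?thesis by (simp add: set_leaf_addrs)
qed

lemma leaf_addr_inj: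
  "1 \<le> i \<Longrightarrow> i \<le> leaf_count t \<Longrightarrow> 1 \<le> j \<Longrightarrow> j \<le> leaf_count t \<Longrightarrow> leaf_addr t i = leaf_addr t j \<longleftrightarrow> i = j"
  using distinct_leaf_addrs[of t] by (auto simp: leaf_addr_def leaf_count_def nth_eq_iff_index_eq)

text \<open>The two parts \<open>X\<close> and \<open>Y\<close> around the leaf are the same for all grafted trees, whence the order of
the quantifiers.\<close>

lemma leaf_addrs_subst_split:
  "subtree t p = Some Leaf \<Longrightarrow> \<exists>X Y. leaf_addrs t = X @ p # Y \<and>
     (\<forall>s. leaf_addrs (subst t p s) = X @ map ((@) p) (leaf_addrs s) @ Y)"
proof (induction t arbitrary: p)
  case Leaf
  then have "p = []" by (cases p) auto
  then show ?case by (intro exI[of _ "[]"]) (simp add: map_idI)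
next
  case (Node ts)
  then obtain j q where p: "p = j # q" by (cases p) auto
  with Node.prems have j: "j < length ts" and l: "subtree (ts ! j) q = Some Leaf" by (auto split: if_splits)
  from Node.IH[OF nth_mem[OF j] l] obtain X Y where XY: "leaf_addrs (ts ! j) = X @ q # Y"
    "\<And>s. leaf_addrs (subst (ts ! j) q s) = X @ map ((@) q) (leaf_addrs s) @ Y" by blast
  have ups: "[0..<length ts] = [0..<j] @ j # [Suc j..<length ts]"
    using j upt_add_eq_append[of 0 j "length ts - j"] by (simp add: upt_conv_Cons)
  define f where "f us i = map ((#) i) (leaf_addrs (us ! i))" for us i
  have ff: "map (f (ts[j := u])) [0..<j] = map (f ts) [0..<j]"
    "map (f (ts[j := u])) [Suc j..<length ts] = map (f ts) [Suc j..<length ts]" for u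
    by (auto simp: f_def)
  let ?L = "concat (map (f ts) [0..<j])" and ?R = "concat (map (f ts) [Suc j..<length ts])"
  have "leaf_addrs (Node ts) = ?L @ f ts j @ ?R"
    unfolding leaf_addrs_Node f_def[symmetric] ups by simp
  moreover have "leaf_addrs (Node (ts[j := u])) = ?L @ f (ts[j := u]) j @ ?R" for u
    unfolding leaf_addrs_Node f_def[symmetric] length_list_update ups by (simp add: ff)
  ultimately show ?case
    by (intro exI[of _ "?L @ map ((#) j) X"] exI[of _ "map ((#) j) Y @ ?R"])
      (auto simp: p f_def j XY)
qed

lemma leaf_addrs_subst:
  assumes "1 \<le> i" "i \<le> leaf_count t"
  shows "leaf_addrs (subst t (leaf_addr t i) s) =
    take (i - 1) (leaf_addrs t) @ map ((@) (leaf_addr t i)) (leaf_addrs s) @ drop i (leaf_addrs t)"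
proof -
  define p where "p = leaf_addr t i"
  from leaf_addrs_subst_split[OF subtree_leaf_addr[OF assms]] obtain X Y where
    XY: "leaf_addrs t = X @ p # Y" "leaf_addrs (subst t p s) = X @ map ((@) p) (leaf_addrs s) @ Y"
    unfolding p_def[symmetric] by blast
  have "leaf_addrs t ! length X = leaf_addrs t ! (i - 1)"
    unfolding leaf_addr_def[symmetric] p_def[symmetric] by (simp add: XY(1))
  moreover have "length X < length (leaf_addrs t)" "i - 1 < length (leaf_addrs t)"
    using assms XY(1) by (auto simp: leaf_count_def)
  ultimately have "length X = i - 1"
    using distinct_leaf_addrs[of t] by (simp only: nth_eq_iff_index_eq)
  then have "i = Suc (length X)" using assms by simp
  then show ?thesis unfolding p_def[symmetric] XY by simp
qed

lemma leaf_count_subst: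
  assumes "subtree t p = Some Leaf"
  shows "leaf_count (subst t p s) + 1 = leaf_count t + leaf_count s"
proof -
  from leaf_addrs_subst_split[OF assms] obtain X Y where
    XY: "leaf_addrs t = X @ p # Y" "leaf_addrs (subst t p s) = X @ map ((@) p) (leaf_addrs s) @ Y" by blast
  then show ?thesis unfolding leaf_count_def by simp
qed

lemma leaf_addr_graft_inner:
  assumes "1 \<le> i" "i \<le> leaf_count t" "1 \<le> j" "j \<le> leaf_count s"
  shows "leaf_addr (graft i t s) (i + j - 1) = leaf_addr t i @ leaf_addr s j"
proof -
  let ?x = "take (i - 1) (leaf_addrs t)"
  have lx: "length ?x = i - 1" using assms by (simp add: leaf_count_def)
  have e: "i + j - 1 - 1 = length ?x + (j - 1)" using assms lx by simp
  have "j - 1 < length (leaf_addrs s)" using assms by (auto simp: leaf_count_def)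
  then show ?thesis
    unfolding leaf_addr_def[of _ "i + j - 1"] graft_def leaf_addrs_subst[OF assms(1,2)] e nth_append_length_plus
    by (simp add: nth_append leaf_addr_def)
qed

lemma leaf_addr_graft_before:
  assumes "1 \<le> i" "i \<le> leaf_count t" "1 \<le> k" "k < i"
  shows "leaf_addr (graft i t s) k = leaf_addr t k"
proof -
  have "k - 1 < i - 1" "k - 1 < length (leaf_addrs t)" using assms by (auto simp: leaf_count_def)
  then show ?thesis
    unfolding leaf_addr_def[of _ k] graft_def leaf_addrs_subst[OF assms(1,2)] by (simp add: nth_append)
qed

lemma leaf_addr_graft_after:
  assumes "1 \<le> i" "i \<le> leaf_count t" "i < k" "k \<le> leaf_count t"
  shows "leaf_addr (graft i t s) (k + leaf_count s - 1) = leaf_addr t k"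
proof -
  let ?x = "take (i - 1) (leaf_addrs t)" and ?y = "map ((@) (leaf_addr t i)) (leaf_addrs s)"
  have "length ?x = i - 1" "length ?y = leaf_count s" using assms by (simp_all add: leaf_count_def)
  then have e: "k + leaf_count s - 1 - 1 = length (?x @ ?y) + (k - 1 - i)" using assms by simp
  have "i + (k - 1 - i) = k - 1" using assms by simp
  then show ?thesis
    unfolding leaf_addr_def[of _ "k + leaf_count s - 1"] graft_def leaf_addrs_subst[OF assms(1,2)] append_assoc[symmetric] e nth_append_length_plus
    using assms by (simp add: leaf_count_def leaf_addr_def)
qed

subsection \<open>Trees with given arity\<close>

lemma leaf_count_Leaf [simp]: "leaf_count Leaf = 1"
  by (simp add: leaf_count_def)

lemma leaf_count_Node: "leaf_count (Node ts) = (\<Sum>t\<leftarrow>ts. leaf_count t)"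
proof -
  have "(\<Sum>j\<leftarrow>[0..<length ts]. leaf_count (ts ! j)) = (\<Sum>t\<leftarrow>ts. leaf_count t)"
    by (metis (no_types, lifting) map_map map_nth comp_def map_eq_conv)
  then show ?thesis
    unfolding leaf_count_def leaf_addrs_Node by (simp add: length_concat o_def)
qed

lemma leaf_count_pos: "every_arity ((\<le>) 2) t \<Longrightarrow> 1 \<le> leaf_count t"
proof (induction t)
  case (Node ts)
  then obtain u us where "ts = u # us" by (cases ts) (auto simp: every_arity_Node)
  with Node have "1 \<le> leaf_count u" by (auto simp: every_arity_Node)
  then show ?case using \<open>ts = u # us\<close> by (simp add: leaf_count_Node)
qed simp

lemma sum_list_ge_length: "(\<And>x. x \<in> set xs \<Longrightarrow> 1 \<le> f x) \<Longrightarrow> length xs \<le> (\<Sum>x\<leftarrow>xs. f x :: nat)"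
  by (induction xs) (auto, fastforce)

lemma ptrees_ge_2: "t \<in> ptrees n \<Longrightarrow> 2 \<le> n"
proof -
  assume t: "t \<in> ptrees n"
  then obtain ts where ts: "t = Node ts" by (cases t) (auto simp: ptrees_iff)
  with t have "2 \<le> length ts" "\<And>u. u \<in> set ts \<Longrightarrow> 1 \<le> leaf_count u"
    by (auto simp: ptrees_iff every_arity_Node intro!: leaf_count_pos[simplified])
  with sum_list_ge_length[of ts leaf_count] t ts show ?thesis by (auto simp: ptrees_iff leaf_count_Node)
qed

text \<open>A vertex joins at least two subtrees, each of which has more leaves than vertices, and adds only one
vertex.\<close>

lemma internal_edges_bound: "t \<in> ptrees n \<Longrightarrow> card (edges t) + 2 \<le> n"
proof -
  have v: "card (vertices t) < leaf_count t" if "every_arity ((\<le>) 2) t" for t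
    using that
  proof (induction t)
    case (Node ts)
    have a: "2 \<le> length ts" "\<And>t. t \<in> set ts \<Longrightarrow> card (vertices t) < leaf_count t"
      using Node by (auto simp: every_arity_Node)
    have c: "card (vertices (Node ts)) \<le> Suc (card (\<Union>j<length ts. (#) j ` vertices (ts ! j)))"
      unfolding vertices_Node by (simp add: card_insert_le_m1 card_insert_if)
    have "card (\<Union>j<length ts. (#) j ` vertices (ts ! j)) \<le> (\<Sum>j<length ts. card ((#) j ` vertices (ts ! j)))"
      by (rule card_UN_le) simp
    also have "\<dots> = (\<Sum>j<length ts. card (vertices (ts ! j)))"
      by (simp add: card_image)
    finally have d: "card (\<Union>j<length ts. (#) j ` vertices (ts ! j)) \<le> (\<Sum>j<length ts. card (vertices (ts ! j)))" .
    have "(\<Sum>j<length ts. card (vertices (ts ! j))) + length ts = (\<Sum>j<length ts. card (vertices (ts ! j)) + 1)"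
      by (simp only: sum.distrib) simp
    also have "\<dots> \<le> (\<Sum>j<length ts. leaf_count (ts ! j))"
      using a(2) by (intro sum_mono) (simp add: Suc_leI)
    also have "\<dots> = leaf_count (Node ts)"
      by (simp add: leaf_count_Node sum_list_sum_nth atLeast0LessThan)
    finally have "(\<Sum>j<length ts. card (vertices (ts ! j))) + length ts \<le> leaf_count (Node ts)" .
    with c d show ?case using a(1) by simp
  qed simp
  assume t: "t \<in> ptrees n"
  then have "vertices t = insert [] (edges t)" by (simp add: ptrees_iff vertices_internal_edges)
  moreover have "[] \<notin> edges t" by (simp add: internal_edges_def)
  ultimately have "card (vertices t) = Suc (card (edges t))"
    using card_insert_disjoint[OF finite_internal_edges] by metis
  with t v[of t] show ?thesis by (simp add: ptrees_iff)
qed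

text \<open>Each child has fewer leaves than the tree, because it has a sibling with at least one leaf.\<close>

lemma finite_ptrees: "finite (ptrees n)"
proof (induction n rule: less_induct)
  case (less n)
  let ?U = "insert Leaf (\<Union>m<n. ptrees m)"
  have sub: "ptrees n \<subseteq> Node ` {ts. set ts \<subseteq> ?U \<and> length ts \<le> n}"
  proof
    fix t assume t: "t \<in> ptrees n"
    then obtain ts where ts: "t = Node ts" by (cases t) (auto simp: ptrees_iff)
    have a: "2 \<le> length ts" "\<And>u. u \<in> set ts \<Longrightarrow> every_arity ((\<le>) 2) u" and n: "n = (\<Sum>u\<leftarrow>ts. leaf_count u)"
      using t by (auto simp: ts ptrees_iff every_arity_Node leaf_count_Node)
    have len: "length ts \<le> n" unfolding n by (rule sum_list_ge_length) (rule leaf_count_pos[OF a(2)])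
    have "u \<in> ?U" if u: "u \<in> set ts" for u
    proof -
      from split_list[OF u] obtain xs ys where xy: "ts = xs @ u # ys" by blast
      have "length (xs @ ys) \<le> (\<Sum>x\<leftarrow>xs @ ys. leaf_count x)"
        by (intro sum_list_ge_length leaf_count_pos a(2)) (auto simp: xy)
      moreover have "1 \<le> length (xs @ ys)" using a(1) by (simp add: xy)
      ultimately have "0 < (\<Sum>x\<leftarrow>xs @ ys. leaf_count x)" by linarith
      then have "leaf_count u < n" by (auto simp: n xy)
      then show ?thesis using a(2)[OF u] by (simp add: ptrees_iff)
    qed
    then show "t \<in> Node ` {ts. set ts \<subseteq> ?U \<and> length ts \<le> n}" unfolding ts using len by (intro imageI) blast
  qed
  have "finite {ts. set ts \<subseteq> ?U \<and> length ts \<le> n}"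
    by (rule finite_lists_length_le) (use less in auto)
  from finite_subset[OF sub finite_imageI[OF this]] show ?case .
qed

lemma graft_ptrees:
  assumes "t \<in> ptrees r" "s \<in> ptrees m" "1 \<le> i" "i \<le> r"
  shows "graft i t s \<in> ptrees (r + m - 1)"
proof -
  have l: "subtree t (leaf_addr t i) = Some Leaf" using assms by (intro subtree_leaf_addr) (auto simp: ptrees_iff)
  then have "graft i t s \<noteq> Leaf"
    using assms unfolding graft_def by (intro subst_not_Leaf leaf_not_Nil[OF l]) (auto simp: ptrees_iff)
  then show ?thesis
    using assms l leaf_count_subst[OF l, of s] by (auto simp: ptrees_iff graft_def every_arity_subst)
qed

text \<open>The inverse of grafting: the part above the edge is cut off and a leaf is put in its place, whose
number is the index of the composition.\<close>

lemma cut_ptree: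
  assumes t: "t \<in> ptrees n" and e: "e \<in> edges t"
  obtains r m i u s where "u \<in> ptrees r" "s \<in> ptrees m" "1 \<le> i" "i \<le> r" "t = graft i u s"
    "leaf_addr u i = e" "n + 1 = r + m" "u = subst t e Leaf" "subtree t e = Some s"
proof -
  from e obtain ts where s: "subtree t e = Some (Node ts)" and ne: "e \<noteq> []" by (auto simp: internal_edges_def)
  let ?u = "subst t e Leaf" and ?s = "Node ts"
  have l: "subtree ?u e = Some Leaf" using s by (simp add: subtree_subst_same)
  have g: "subst ?u e ?s = t" using s by (simp add: subst_subst_same subst_subtree)
  have u: "?u \<noteq> Leaf" using t ne by (intro subst_not_Leaf) (auto simp: ptrees_iff)
  obtain i where i: "1 \<le> i" "i \<le> leaf_count ?u" "leaf_addr ?u i = e" using leaf_addr_index[OF l] .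
  have "leaf_count t + 1 = leaf_count ?u + leaf_count ?s" using leaf_count_subst[OF l, of ?s] g by simp
  moreover have "every_arity ((\<le>) 2) ?u \<and> every_arity ((\<le>) 2) ?s"
    using t every_arity_subst[OF l, of "(\<le>) 2" ?s] g by (simp add: ptrees_iff)
  ultimately show ?thesis using t i u s g
    by (intro that[of ?u "leaf_count ?u" ?s "leaf_count ?s" i]) (auto simp: ptrees_iff graft_def)
qed

lemma graft_inj:
  assumes "t \<in> ptrees r" "1 \<le> i" "i \<le> r" "t' \<in> ptrees r'" "1 \<le> i'" "i' \<le> r'"
    and "graft i t s = graft i' t' s'" "leaf_addr t i = leaf_addr t' i'"
  shows "t = t'" "i = i'" "s = s'"
proof -
  have l: "subtree t (leaf_addr t i) = Some Leaf" "subtree t' (leaf_addr t' i') = Some Leaf"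
    using assms(1-6) by (auto simp only: ptrees_iff intro!: subtree_leaf_addr)
  show s: "s = s'" using assms(7,8) subtree_subst_same[of t "leaf_addr t i" s] subtree_subst_same[of t' "leaf_addr t' i'" s'] l
    by (simp add: graft_def)
  have "subst (graft i t s) (leaf_addr t i) Leaf = t" "subst (graft i' t' s') (leaf_addr t' i') Leaf = t'"
    unfolding graft_def subst_subst_same using l by (simp_all add: subst_subtree)
  with assms(7,8) show t: "t = t'" by simp
  with assms show "i = i'" using leaf_addr_inj[of i t i'] by (simp add: ptrees_iff)
qed

section \<open>Collapsing an edge\<close>

lemma collapse_Node_top:
  "collapse (Node (as @ u # bs)) [length as] = Node (as @ children u @ bs)"
  by (simp add: collapse_def Let_def)

lemma collapse_Node:
  "e \<noteq> [] \<Longrightarrow> collapse (Node (as @ u # bs)) (length as # e) = Node (as @ collapse u e # bs)"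
  by (simp add: collapse_def Let_def list_update_append)

lemma collapse_addr_Node_top:
  "collapse_addr (Node (as @ u # bs)) [length as] d =
     (case d of [] \<Rightarrow> []
      | l # r \<Rightarrow> if l < length as then d
          else if l = length as then (case r of [] \<Rightarrow> [] | i # r' \<Rightarrow> (length as + i) # r')
          else (l + length (children u) - 1) # r)"
  by (simp add: collapse_addr_def Let_def nth_append split: list.split)

lemma collapse_addr_Node:
  "e \<noteq> [] \<Longrightarrow> collapse_addr (Node (as @ u # bs)) (length as # e) d =
     (case d of [] \<Rightarrow> [] | l # r \<Rightarrow> if l = length as then l # collapse_addr u e r else d)"
proof -
  assume "e \<noteq> []"
  then obtain v k where "e = v @ [k]" by (cases e rule: rev_cases) auto
  then show ?thesis by (cases d) (simp_all add: collapse_addr_def split: list.split)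
qed

lemma split_at_index:
  assumes "j < length ts" obtains as u bs where "ts = as @ u # bs" "length as = j" "u = ts ! j"
  using that[OF id_take_nth_drop[OF assms]] assms by simp

lemma internal_edges_split:
  assumes "e \<in> edges t"
  obtains as u bs e' where "t = Node (as @ u # bs)" "e = length as # e'" "e' \<in> vertices u"
proof -
  from assms obtain ts where t: "t = Node ts" by (cases t) (auto simp: internal_edges_vertices)
  with assms obtain j e' where e: "e = j # e'" "j < length ts" "e' \<in> vertices (ts ! j)"
    by (auto simp: internal_edges_vertices vertices_Node)
  obtain as u bs where s: "ts = as @ u # bs" "length as = j" using split_at_index[OF e(2)] .
  then have "ts ! j = u" by auto
  with e have "e' \<in> vertices u" by simp
  then show ?thesis by (rule that[OF t[unfolded s(1)] e(1)[folded s(2)]])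
qed

text \<open>The addresses that a list of trees contributes when its members become the children number
\<open>k\<close>, \<open>k + 1\<close>, \<dots> of a vertex.  Splicing in a list of children is a matter of shifting \<open>k\<close>.\<close>

primrec forest :: "(ptree \<Rightarrow> addr list) \<Rightarrow> nat \<Rightarrow> ptree list \<Rightarrow> addr list" where
  "forest g k [] = []"
| "forest g k (u # us) = map ((#) k) (g u) @ forest g (Suc k) us"

lemma forest_append: "forest g k (us @ vs) = forest g k us @ forest g (k + length us) vs"
  by (induction us arbitrary: k) auto

lemma forest_heads: "d \<in> set (forest g k us) \<Longrightarrow> \<exists>l r. d = l # r \<and> k \<le> l \<and> l < k + length us"
proof (induction us arbitrary: k)
  case (Cons u us)
  then consider "d \<in> (#) k ` set (g u)" | "d \<in> set (forest g (Suc k) us)" by auto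
  then show ?case by cases (auto dest!: Cons.IH)
qed simp

lemma forest_shift: "map (\<lambda>d. (hd d + m) # tl d) (forest g k us) = forest g (k + m) us"
  by (induction us arbitrary: k) (auto simp: o_def)

text \<open>Leaves and vertices are listed by the same recursion, with \<open>pre\<close> the contribution of the root, and
are treated together.  At the vertex below the collapsed edge there are three blocks of children:
the numbers in the first are unchanged, those in the second are shifted by the position of the
collapsed vertex, and those in the third by the number of its children minus one.\<close>

lemma collapse_addresses:
  assumes g: "\<And>ts. g (Node ts) = pre @ forest g 0 ts" and pre: "pre = [] \<or> pre = [[]]"
  shows "e \<in> edges t \<Longrightarrow> g (collapse t e) = map (collapse_addr t e) (filter (\<lambda>d. d \<noteq> e) (g t))"
proof (induction e arbitrary: t)
  case (Cons j e t)
  from internal_edges_split[OF Cons.prems] obtain as u bs where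
    t: "t = Node (as @ u # bs)" and j: "j = length as" and e: "e \<in> vertices u" by auto
  let ?c = "collapse_addr t (j # e)" and ?f = "filter (\<lambda>d. d \<noteq> j # e)"
  have gt: "g t = pre @ forest g 0 as @ map ((#) j) (g u) @ forest g (Suc j) bs"
    by (simp add: t g forest_append j)
  have f: "?f (forest g 0 as) = forest g 0 as" "?f (forest g (Suc j) bs) = forest g (Suc j) bs" "?f pre = pre"
    using pre by (auto simp: filter_id_conv j dest: forest_heads)
  have cpre: "map ?c pre = pre"
    using pre by (cases e) (auto simp: t j collapse_addr_Node collapse_addr_Node_top)
  have cas: "map ?c (forest g 0 as) = forest g 0 as"
    by (cases e) (auto simp: map_idI t j collapse_addr_Node collapse_addr_Node_top intro!: map_idI dest!: forest_heads)
  show ?case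
  proof (cases e)
    case Nil
    with e obtain cs where u: "u = Node cs" by (cases u) auto
    have "?f (map ((#) j) pre) = []" using pre Nil by auto
    moreover have "?f (map ((#) j) (forest g 0 cs)) = map ((#) j) (forest g 0 cs)"
      by (auto simp: filter_id_conv Nil dest: forest_heads)
    ultimately have "map ?c (?f (map ((#) j) (g u))) = map (\<lambda>d. (hd d + j) # tl d) (forest g 0 cs)"
      by (auto simp: u g t Nil j collapse_addr_Node_top dest!: forest_heads)
    also have "\<dots> = forest g j cs" by (simp add: forest_shift)
    finally have m: "map ?c (?f (map ((#) j) (g u))) = forest g j cs" .
    have "map ?c (forest g (Suc j) bs) = map (\<lambda>d. (hd d + length cs - 1) # tl d) (forest g (Suc j) bs)"
      by (auto simp: u g t Nil j collapse_addr_Node_top dest!: forest_heads)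
    also have "\<dots> = map (\<lambda>d. (hd d + length cs - 1) # tl d) (map (\<lambda>d. (hd d + Suc 0) # tl d) (forest g j bs))"
      using forest_shift[of "Suc 0" g j bs] by simp
    also have "\<dots> = map (\<lambda>d. (hd d + length cs) # tl d) (forest g j bs)"
      by simp
    also have "\<dots> = forest g (j + length cs) bs" by (rule forest_shift)
    finally have b: "map ?c (forest g (Suc j) bs) = forest g (j + length cs) bs" .
    have "g (collapse t (j # e)) = pre @ forest g 0 as @ forest g j cs @ forest g (j + length cs) bs"
      by (simp add: t j Nil u collapse_Node_top g forest_append)
    then show ?thesis by (simp only: gt filter_append map_append f cpre cas m b)
  next
    case (Cons k e')
    then have ne: "e \<noteq> []" by simp
    with e have "e \<in> edges u" by (simp add: internal_edges_vertices)
    note IH = Cons.IH[OF this]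
    have b: "map ?c (forest g (Suc j) bs) = forest g (Suc j) bs"
      by (auto simp: t j collapse_addr_Node[OF ne] intro!: map_idI dest!: forest_heads)
    have "?f (map ((#) j) (g u)) = map ((#) j) (filter (\<lambda>d. d \<noteq> e) (g u))"
      by (simp add: filter_map o_def)
    then have m: "map ?c (?f (map ((#) j) (g u))) = map ((#) j) (g (collapse u e))"
      by (simp add: IH t j collapse_addr_Node[OF ne] o_def)
    have "g (collapse t (j # e)) = pre @ forest g 0 as @ map ((#) j) (g (collapse u e)) @ forest g (Suc j) bs"
      by (simp add: t j collapse_Node[OF ne] g forest_append)
    then show ?thesis by (simp only: gt filter_append map_append f cpre cas m b)
  qed
qed (simp add: internal_edges_def)

primrec preorder :: "ptree \<Rightarrow> addr list" where
  "preorder Leaf = []"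
| "preorder (Node ts) = [] # concat (map2 (\<lambda>j. map ((#) j)) [0..<length ts] (map preorder ts))"

lemma preorder_Node: "preorder (Node ts) = [] # concat (map (\<lambda>j. map ((#) j) (preorder (ts ! j))) [0..<length ts])"
  unfolding preorder.simps by (rule arg_cong[of _ _ "\<lambda>x. [] # concat x"], rule nth_equalityI) auto

lemma concat_forest: "concat (map (\<lambda>j. map ((#) (k + j)) (g (ts ! j))) [0..<length ts]) = forest g k ts"
proof (induction ts arbitrary: k)
  case (Cons u us)
  show ?case using Cons[of "Suc k"] by (simp add: upt_conv_Cons map_Suc_upt[symmetric] o_def del: upt_Suc)
qed simp

lemma set_preorder: "set (preorder t) = vertices t"
  by (induction t) (auto simp: vertices_Node preorder_Node simp del: preorder.simps(2))

lemma distinct_preorder: "distinct (preorder t)"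
proof (induction t)
  case (Node ts)
  have *: "distinct (concat (map (\<lambda>j. map ((#) j) (preorder (ts ! j))) js))"
    if "distinct js" "set js \<subseteq> {..<length ts}" for js
    using that Node by (induction js) (auto simp: distinct_map)
  have "distinct (concat (map (\<lambda>j. map ((#) j) (preorder (ts ! j))) [0..<length ts]))" by (rule *) auto
  then show ?case unfolding preorder_Node by auto
qed simp

lemma leaf_addrs_collapse:
  assumes "e \<in> edges t"
  shows "leaf_addrs (collapse t e) = map (collapse_addr t e) (leaf_addrs t)"
proof -
  have g: "leaf_addrs (Node ts) = [] @ forest leaf_addrs 0 ts" for ts
    using concat_forest[of 0 leaf_addrs ts] by (simp only: leaf_addrs_Node) simp
  have "filter (\<lambda>d. d \<noteq> e) (leaf_addrs t) = leaf_addrs t"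
    using assms by (auto simp: filter_id_conv set_leaf_addrs internal_edges_def)
  with collapse_addresses[of leaf_addrs "[]", OF g _ assms] show ?thesis by simp
qed

lemma preorder_collapse:
  "e \<in> edges t \<Longrightarrow> preorder (collapse t e) = map (collapse_addr t e) (filter (\<lambda>d. d \<noteq> e) (preorder t))"
proof (rule collapse_addresses[of preorder "[[]]"])
  show "preorder (Node ts) = [[]] @ forest preorder 0 ts" for ts
    using concat_forest[of 0 preorder ts] unfolding preorder_Node by simp
qed simp_all

lemma collapse_addr_Nil: "e \<in> edges t \<Longrightarrow> collapse_addr t e [] = []"
  by (auto simp: collapse_addr_def Let_def internal_edges_def)

text \<open>The list of vertices of the collapsed tree has no repetitions and is the image of the list of the
other vertices, by \<open>preorder_collapse\<close>; the root is removed on both sides.\<close>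

lemma bij_collapse_addr:
  assumes "e \<in> edges t"
  shows "bij_betw (collapse_addr t e) (edges t - {e}) (edges (collapse t e))"
proof -
  let ?l = "filter (\<lambda>d. d \<noteq> e) (preorder t)"
  have v: "bij_betw (collapse_addr t e) (set ?l) (vertices (collapse t e))"
    unfolding bij_betw_def set_preorder[of "collapse t e", symmetric] preorder_collapse[OF assms]
    using distinct_preorder[of "collapse t e", unfolded preorder_collapse[OF assms]] by (simp add: distinct_map)
  have l: "set ?l = vertices t - {e}" by (auto simp: set_preorder)
  have n: "[] \<in> vertices t - {e}" using assms by (cases t; cases e) (auto simp: internal_edges_def vertices_Node)
  have "bij_betw (collapse_addr t e) (vertices t - {e} - {[]}) (vertices (collapse t e) - {[]})"
  proof (rule bij_betw_DiffI[OF v[unfolded l]])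
    show "{[]} \<subseteq> vertices (collapse t e)"
      using bij_betwE[OF v[unfolded l]] n collapse_addr_Nil[OF assms] by force
  qed (use n collapse_addr_Nil[OF assms] in auto)
  moreover have "vertices t - {e} - {[]} = edges t - {e}" by (auto simp: internal_edges_vertices)
  ultimately show ?thesis by (simp add: internal_edges_vertices)
qed

lemma leaf_count_collapse: "e \<in> edges t \<Longrightarrow> leaf_count (collapse t e) = leaf_count t"
  by (simp add: leaf_count_def leaf_addrs_collapse)

lemma leaf_addr_collapse:
  "e \<in> edges t \<Longrightarrow> 1 \<le> i \<Longrightarrow> i \<le> leaf_count t \<Longrightarrow> leaf_addr (collapse t e) i = collapse_addr t e (leaf_addr t i)"
  by (simp add: leaf_addr_def leaf_addrs_collapse leaf_count_def)

lemma card_internal_edges_collapse: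
  "e \<in> edges t \<Longrightarrow> card (edges (collapse t e)) + 1 = card (edges t)"
  using bij_betw_same_card[OF bij_collapse_addr] card_Suc_Diff1[of "edges t" e] by simp

lemma every_arity_collapse:
  "e \<in> edges t \<Longrightarrow> every_arity ((\<le>) 2) t \<Longrightarrow> every_arity ((\<le>) 2) (collapse t e)"
proof (induction e arbitrary: t)
  case (Cons j e t)
  from internal_edges_split[OF Cons.prems(1)] obtain as u bs where
    t: "t = Node (as @ u # bs)" and j: "j = length as" and e: "e \<in> vertices u" by auto
  show ?case
  proof (cases "e = []")
    case True
    with e obtain cs where u: "u = Node cs" by (cases u) auto
    show ?thesis using Cons.prems(2) by (auto simp: t j True u collapse_Node_top every_arity_Node)
  next
    case False
    with e have "e \<in> edges u" by (simp add: internal_edges_vertices)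
    with Cons.IH[of u] Cons.prems(2) False show ?thesis by (auto simp: t j collapse_Node every_arity_Node)
  qed
qed (simp add: internal_edges_def)

lemma collapse_ptrees:
  assumes "t \<in> ptrees n" "e \<in> edges t" shows "collapse t e \<in> ptrees n"
proof -
  from internal_edges_split[OF assms(2)] obtain as u bs e' where
    t: "t = Node (as @ u # bs)" "e = length as # e'" by metis
  then have "collapse t e \<noteq> Leaf" by (cases "e' = []") (auto simp: collapse_Node collapse_Node_top)
  then show ?thesis using assms by (simp add: ptrees_iff every_arity_collapse leaf_count_collapse)
qed

subsection \<open>Collapsing and grafting\<close>

text \<open>If the collapsed edge is neither \<open>p\<close> nor above \<open>p\<close>, everything above \<open>p\<close> moves along with \<open>p\<close>.\<close>

lemma collapse_addr_append:
  "\<not> prefix p e \<Longrightarrow> e \<noteq> [] \<Longrightarrow> collapse_addr t e (p @ a) = collapse_addr t e p @ a"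
proof -
  assume p: "\<not> prefix p e" and e: "e \<noteq> []"
  define v j where "v = butlast e" and "j = last e"
  have e: "e = v @ [j]" using e by (simp add: v_def j_def)
  show ?thesis
  proof (cases "prefix v p")
    case True
    then obtain r where r: "p = v @ r" by (auto simp: prefix_def)
    with p e obtain l r' where l: "r = l # r'" by (cases r) (auto simp: prefix_def)
    have "l = j \<Longrightarrow> r' \<noteq> []" using p by (auto simp: e r l)
    then show ?thesis by (auto simp: collapse_addr_def e r l split: list.split)
  next
    case False
    have "take (length v) p \<noteq> v" using False by (metis append_take_drop_id prefix_def)
    moreover have "take (length v) (p @ a) \<noteq> v"
    proof
      assume "take (length v) (p @ a) = v"
      then have v: "v = take (length v) p @ take (length v - length p) a" by simp
      show False
      proof (cases "length v \<le> length p")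
        case True
        with v have "v = take (length v) p" by simp
        then have "p = v @ drop (length v) p" by (metis append_take_drop_id)
        with False show False by (metis prefix_appendI)
      next
        case False
        with v have "v = p @ take (length v - length p) a" by simp
        then have "e = p @ (take (length v - length p) a @ [j])" using e by simp
        with p show False by (metis prefix_appendI)
      qed
    qed
    ultimately show ?thesis by (simp add: collapse_addr_def e)
  qed
qed

lemma collapse_addr_subst:
  assumes e: "e \<in> edges t" and p: "subtree t p = Some Leaf"
  shows "collapse_addr (subst t p s) e = collapse_addr t e"
proof -
  from e obtain us where us: "subtree t e = Some (Node us)" "e \<noteq> []" by (auto simp: internal_edges_def)
  have np: "\<not> prefix p e" using not_prefix_leaf_vertex[OF p] us by (auto simp: vertices_def)
  have "length (children (the (subtree (subst t p s) e))) = length us"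
  proof (cases "prefix e p")
    case True
    then obtain q where q: "p = e @ q" by (auto simp: prefix_def)
    with np have "q \<noteq> []" by auto
    then obtain l r where "q = l # r" by (cases q) auto
    with us q np show ?thesis by (simp add: subtree_subst_not_prefix)
  qed (use us np in \<open>simp add: subtree_subst_not_prefix\<close>)
  then show ?thesis using us by (intro ext) (simp add: collapse_addr_def)
qed

text \<open>Collapsing an edge of the lower tree carries the grafted tree to the new address of the leaf.\<close>

lemma collapse_subst_outer:
  "e \<in> edges t \<Longrightarrow> subtree t p = Some Leaf \<Longrightarrow>
     collapse (subst t p s) e = subst (collapse t e) (collapse_addr t e p) s"
proof (induction e arbitrary: t p)
  case (Cons j e t)
  from internal_edges_split[OF Cons.prems(1)] obtain as u bs where
    t: "t = Node (as @ u # bs)" and j: "j = length as" and e: "e \<in> vertices u" by auto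
  from Cons.prems(2) t obtain l q where p: "p = l # q" by (cases p) auto
  consider "l < length as" | "l = length as" | k where "l = length as + Suc k" "k < length bs"
    using Cons.prems(2) by (auto simp: t p split: if_splits) (metis add_Suc_right less_imp_Suc_add nat_add_left_cancel_less linorder_neqE_nat Suc_less_eq)
  then show ?case
  proof cases
    case 1
    then have s: "subst t p s = Node (as[l := subst (as ! l) q s] @ u # bs)"
      by (simp add: t p list_update_append nth_append)
    show ?thesis
      using 1 collapse_Node_top[of "as[l := subst (as ! l) q s]" u bs] collapse_Node[of e "as[l := subst (as ! l) q s]" u bs]
      unfolding s by (cases "e = []")
        (auto simp: t j p collapse_Node collapse_Node_top collapse_addr_Node collapse_addr_Node_top list_update_append nth_append)
  next
    case 2
    then have s: "subst t p s = Node (as @ subst u q s # bs)" and l: "subtree u q = Some Leaf"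
      using Cons.prems(2) by (simp_all add: t p)
    show ?thesis
    proof (cases "e = []")
      case True
      with e obtain cs where u: "u = Node cs" by (cases u) auto
      with l obtain i r where q: "q = i # r" "i < length cs" by (cases q) (auto split: if_splits)
      show ?thesis unfolding s
        using q by (simp add: t j p True 2 u collapse_Node_top collapse_addr_Node_top list_update_append nth_append)
    next
      case False
      with e have "e \<in> edges u" by (simp add: internal_edges_vertices)
      from Cons.IH[OF this l] show ?thesis unfolding s
        by (simp add: t j p 2 False collapse_Node collapse_addr_Node)
    qed
  next
    case 3
    then have s: "subst t p s = Node (as @ u # bs[k := subst (bs ! k) q s])"
      by (simp add: t p list_update_append nth_append)
    show ?thesis
    proof (cases "e = []")
      case True
      with e obtain cs where u: "u = Node cs" by (cases u) auto
      show ?thesis unfolding s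
        using 3 by (simp add: t j p True u collapse_Node_top collapse_addr_Node_top list_update_append nth_append)
    next
      case False
      then show ?thesis unfolding s
        using 3 by (simp add: t j p collapse_Node collapse_addr_Node list_update_append nth_append)
    qed
  qed
qed (simp add: internal_edges_def)

lemma collapse_subst_inner:
  "subtree t p = Some u \<Longrightarrow> e \<noteq> [] \<Longrightarrow> collapse (subst t p s) (p @ e) = subst t p (collapse s e)"
  by (simp add: collapse_def Let_def butlast_append subtree_subst_append subst_subst)

lemma collapse_addr_subst_inner:
  "subtree t p = Some u \<Longrightarrow> e \<noteq> [] \<Longrightarrow> collapse_addr (subst t p s) (p @ e) (p @ d) = p @ collapse_addr s e d"
  by (auto simp: collapse_addr_def Let_def butlast_append subtree_subst_append split: list.split)

lemma collapse_addr_not_prefix: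
  "e \<noteq> [] \<Longrightarrow> \<not> prefix p d \<Longrightarrow> collapse_addr t (p @ e) d = d"
proof -
  assume e: "e \<noteq> []" and d: "\<not> prefix p d"
  have "take (length (p @ butlast e)) d \<noteq> p @ butlast e"
  proof
    assume "take (length (p @ butlast e)) d = p @ butlast e"
    then have "d = p @ butlast e @ drop (length (p @ butlast e)) d"
      by (metis append_assoc append_take_drop_id)
    with d show False by (metis prefix_appendI)
  qed
  with e show ?thesis by (simp add: collapse_addr_def Let_def butlast_append)
qed

section \<open>Composition and boundary on oriented trees\<close>

definition orients :: "'e list \<Rightarrow> 'e set \<Rightarrow> bool" where
  "orients es A \<longleftrightarrow> distinct es \<and> set es = A"

lemma sign_cong: "(even a \<longleftrightarrow> even b) \<Longrightarrow> (-1) ^ a = ((-1) ^ b :: 'a::ring_1)"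
  by (simp add: minus_one_power_iff)

lemma append_append_fun: "(@) (p @ q) = (\<lambda>x. p @ q @ x)"
  by auto

lemma orients_length: "orients es A \<Longrightarrow> length es = card A"
  by (auto simp: orients_def distinct_card)

lemma orients_exists: "finite A \<Longrightarrow> orients (sorted_list_of_set A) A"
  by (simp add: orients_def)

lemma orients_edge_list: "orients (edge_list t) (edges t)"
  by (simp add: orients_exists edge_list_def)

lemma single_sorted: "finite (A :: addr set) \<Longrightarrow> basis b = osym b (sorted_list_of_set A)"
  by (simp add: osym_def wedge_sign_sorted)

lemma orients_graft:
  assumes "t \<in> ptrees r" "s \<in> ptrees m" "1 \<le> i" "i \<le> r" "orients es (edges t)" "orients ds (edges s)"
  shows "orients (es @ map ((@) (leaf_addr t i)) ds @ [leaf_addr t i]) (edges (graft i t s))"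
proof -
  let ?p = "leaf_addr t i"
  have l: "subtree t ?p = Some Leaf" using assms by (intro subtree_leaf_addr) (auto simp: ptrees_iff)
  have "?p \<notin> edges t" using leaf_not_vertex[OF l] by (simp add: internal_edges_vertices)
  moreover have "edges t \<inter> (@) ?p ` edges s = {}"
    using vertices_subst_disjoint[OF l] by (auto simp: internal_edges_vertices)
  moreover have "edges (graft i t s) = edges t \<union> (@) ?p ` edges s \<union> {?p}"
    unfolding graft_def using l assms by (intro internal_edges_subst) (auto simp: ptrees_iff)
  moreover have "[] \<notin> edges s" by (simp add: internal_edges_def)
  ultimately show ?thesis using assms(5,6) by (auto simp: orients_def distinct_map inj_on_def)
qed

lemma graft_edges:
  assumes "t \<in> ptrees r" "s \<in> ptrees m" "1 \<le> i" "i \<le> r"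
  shows "edges (graft i t s) = edges t \<union> (@) (leaf_addr t i) ` edges s \<union> {leaf_addr t i}"
  using orients_graft[OF assms orients_edge_list orients_edge_list] by (auto simp: orients_def edge_list_def)

lemma leaf_addr_not_prefix:
  assumes "t \<in> ptrees r" "1 \<le> i" "i \<le> r" "d \<in> edges t"
  shows "\<not> prefix (leaf_addr t i) d"
proof -
  have "subtree t (leaf_addr t i) = Some Leaf" using assms by (intro subtree_leaf_addr) (auto simp: ptrees_iff)
  from not_prefix_leaf_vertex[OF this] assms(4) show ?thesis by (simp add: internal_edges_vertices)
qed

lemma subtree_leaf_addr_ptrees: "t \<in> ptrees r \<Longrightarrow> 1 \<le> i \<Longrightarrow> i \<le> r \<Longrightarrow> subtree t (leaf_addr t i) = Some Leaf"
  by (rule subtree_leaf_addr) (auto simp: ptrees_iff)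

text \<open>The sign in terms of the degree \<open>l\<close> of the second factor, which avoids truncated subtraction: the
second factor has \<open>length ds + l + 2\<close> leaves.\<close>

lemma K_circ_osym:
  assumes "orients es (edges t)" "orients ds (edges s)" "t \<in> ptrees r" "s \<in> ptrees (card (edges s) + l + 2)"
  shows "circ_K i (osym t es) (osym s ds) =
    scale ((-1) ^ (r * l + i * (length ds + l + 1))) (osym (graft i t s) (es @ map ((@) (leaf_addr t i)) ds @ [leaf_addr t i]))"
proof -
  have "leaf_count t = r" "leaf_count s = length ds + l + 2" using assms orients_length[OF assms(2)] by (auto simp: ptrees_iff)
  then have "K_graft i t es s ds = scale ((-1) ^ (r * l + i * (length ds + l + 1)))
      (osym (graft i t s) (es @ map ((@) (leaf_addr t i)) ds @ [leaf_addr t i]) :: ptree \<Rightarrow>\<^sub>0 'a)"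
    unfolding K_graft_def using orients_length[OF assms(2)]
    by (intro arg_cong[where f = "\<lambda>c. scale c _"] sign_cong) (cases "even i"; simp add: K_degree_def)
  then show ?thesis using assms by (simp add: orients_def K_comp_osym)
qed

lemma ptrees_degree:
  assumes "t \<in> ptrees n" obtains l where "n = card (edges t) + l + 2"
  using internal_edges_bound[OF assms] that[of "n - card (edges t) - 2"] by simp

lemma graft_graft_inner:
  assumes "t \<in> ptrees r" "s \<in> ptrees m" "1 \<le> i" "i \<le> r" "1 \<le> j" "j \<le> m"
  shows "graft (i + j - 1) (graft i t s) u = graft i t (graft j s u)"
    and "leaf_addr (graft i t s) (i + j - 1) = leaf_addr t i @ leaf_addr s j"
proof -
  show l: "leaf_addr (graft i t s) (i + j - 1) = leaf_addr t i @ leaf_addr s j"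
    using assms by (intro leaf_addr_graft_inner) (auto simp: ptrees_iff)
  show "graft (i + j - 1) (graft i t s) u = graft i t (graft j s u)"
    unfolding graft_def[of "i + j - 1"] l using subtree_leaf_addr_ptrees[OF assms(1,3,4)] by (simp add: graft_def subst_subst)
qed

lemma graft_graft_parallel:
  assumes "t \<in> ptrees r" "s \<in> ptrees m" "1 \<le> i" "i < k" "k \<le> r"
  shows "graft (k + m - 1) (graft i t s) u = graft i (graft k t u) s"
    and "leaf_addr (graft i t s) (k + m - 1) = leaf_addr t k"
    and "leaf_addr (graft k t u) i = leaf_addr t i"
proof -
  have m: "m = leaf_count s" using assms by (simp add: ptrees_iff)
  show l: "leaf_addr (graft i t s) (k + m - 1) = leaf_addr t k"
    unfolding m using assms by (intro leaf_addr_graft_after) (auto simp: ptrees_iff)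
  show l': "leaf_addr (graft k t u) i = leaf_addr t i"
    using assms by (intro leaf_addr_graft_before) (auto simp: ptrees_iff)
  have a: "subtree t (leaf_addr t i) = Some Leaf" "subtree t (leaf_addr t k) = Some Leaf"
    using assms by (auto intro!: subtree_leaf_addr_ptrees)
  have ne: "leaf_addr t i \<noteq> leaf_addr t k"
    using assms leaf_addr_inj[of i t k] by (simp add: ptrees_iff)
  show "graft (k + m - 1) (graft i t s) u = graft i (graft k t u) s"
    unfolding graft_def[of "k + m - 1"] graft_def[of i "graft k t u"] l l'
    using not_prefix_leaf_leaf[OF a ne] not_prefix_leaf_leaf[OF a(2,1)] ne by (simp add: graft_def subst_commute)
qed

text \<open>Both sides are the same tree.  Their orientations differ in that the edge created by \<open>\<circ>\<^sub>i\<close> stands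
before or after the edges of \<open>u\<close> and the edge created by \<open>\<circ>\<^sub>j\<close>; the resulting sign is the quotient of
the signs in the definition of the composition.\<close>

lemma K_circ_assoc:
  assumes t: "t \<in> ptrees r" "orients es (edges t)" and s: "s \<in> ptrees m" "orients ds (edges s)"
    and u: "u \<in> ptrees n" "orients fs (edges u)" and ij: "1 \<le> i" "i \<le> r" "1 \<le> j" "j \<le> m"
  shows "circ_K (i + j - 1) (circ_K i (osym t es) (osym s ds)) (osym u fs)
       = circ_K i (osym t es) (circ_K j (osym s ds) (osym u fs))"
proof -
  obtain l where l: "m = card (edges s) + l + 2" using ptrees_degree[OF s(1)] .
  obtain h where h: "n = card (edges u) + h + 2" using ptrees_degree[OF u(1)] .
  let ?p = "leaf_addr t i" and ?q = "leaf_addr s j"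
  have g1: "graft i t s \<in> ptrees (r + m - 1)" and g2: "graft j s u \<in> ptrees (m + n - 1)"
    using t s u ij by (auto intro!: graft_ptrees simp del: One_nat_def)
  have o1: "orients (es @ map ((@) ?p) ds @ [?p]) (edges (graft i t s))"
    using t s ij by (intro orients_graft)
  have o2: "orients (ds @ map ((@) ?q) fs @ [?q]) (edges (graft j s u))"
    using s u ij by (intro orients_graft)
  have c2: "card (edges (graft j s u)) = card (edges s) + card (edges u) + 1"
    using orients_length[OF o2] orients_length[OF s(2)] orients_length[OF u(2)] by simp
  note gg = graft_graft_inner[OF t(1) s(1) ij]
  let ?T = "graft i t (graft j s u)"
  let ?w = "es @ map ((@) ?p) ds @ [?p] @ map ((@) (?p @ ?q)) fs @ [?p @ ?q]"
  let ?w' = "es @ map ((@) ?p) (ds @ map ((@) ?q) fs @ [?q]) @ [?p]"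
  obtain i' where i': "i = Suc i'" using ij by (cases i) auto
  note s' = s(1)[unfolded l] and u' = u(1)[unfolded h]
  have g2': "graft j s u \<in> ptrees (card (edges (graft j s u)) + (l + h) + 2)"
    using g2 unfolding c2 l h by (simp add: add_ac)
  have "circ_K i (osym t es) (osym s ds) = scale ((-1) ^ (r * l + i * (length ds + l + 1)))
      (osym (graft i t s) (es @ map ((@) ?p) ds @ [?p]) :: ptree \<Rightarrow>\<^sub>0 'a)"
    by (rule K_circ_osym[OF t(2) s(2) t(1) s'])
  moreover have "circ_K (i + j - 1) (osym (graft i t s) (es @ map ((@) ?p) ds @ [?p])) (osym u fs) =
      scale ((-1) ^ ((r + m - 1) * h + (i + j - 1) * (length fs + h + 1))) (osym ?T ?w :: ptree \<Rightarrow>\<^sub>0 'a)"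
    using K_circ_osym[OF o1 u(2) g1 u', of "i + j - 1"] unfolding gg by (simp only: append_assoc)
  ultimately have L: "circ_K (i + j - 1) (circ_K i (osym t es) (osym s ds)) (osym u fs) =
     scale ((-1) ^ (r * l + i * (length ds + l + 1)) * (-1) ^ ((r + m - 1) * h + (i + j - 1) * (length fs + h + 1)))
       (osym ?T ?w :: ptree \<Rightarrow>\<^sub>0 'a)"
    by (simp only: chain_linear_scale[OF K_circ_linear(1)] scale_scale)
  have "circ_K j (osym s ds) (osym u fs) = scale ((-1) ^ (m * h + j * (length fs + h + 1)))
      (osym (graft j s u) (ds @ map ((@) ?q) fs @ [?q]) :: ptree \<Rightarrow>\<^sub>0 'a)"
    by (rule K_circ_osym[OF s(2) u(2) s(1) u'])
  moreover have "circ_K i (osym t es) (osym (graft j s u) (ds @ map ((@) ?q) fs @ [?q])) =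
     scale ((-1) ^ (r * (l + h) + i * (length (ds @ map ((@) ?q) fs @ [?q]) + (l + h) + 1))) (osym ?T ?w' :: ptree \<Rightarrow>\<^sub>0 'a)"
    using K_circ_osym[OF t(2) o2 t(1) g2', of i] by (simp only: append_assoc)
  ultimately have R: "circ_K i (osym t es) (circ_K j (osym s ds) (osym u fs)) =
     scale ((-1) ^ (m * h + j * (length fs + h + 1)) * (-1) ^ (r * (l + h) + i * (length ds + length fs + 1 + (l + h) + 1)))
       (osym ?T ?w' :: ptree \<Rightarrow>\<^sub>0 'a)"
    by (simp add: chain_linear_scale[OF K_circ_linear(2)] scale_scale)
  have "osym ?T ?w = scale ((-1) ^ (length fs + 1)) (osym ?T ?w' :: ptree \<Rightarrow>\<^sub>0 'a)"
    using osym_swap_blocks[of ?T "es @ map ((@) ?p) ds" "[?p]" "map ((@) (?p @ ?q)) fs @ [?p @ ?q]" "[]"]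
    by (simp add: o_def append_append_fun)
  moreover have "(-1) ^ (r * l + i * (length ds + l + 1)) * (-1) ^ ((r + m - 1) * h + (i + j - 1) * (length fs + h + 1)) * (-1) ^ (length fs + 1)
     = ((-1) ^ (m * h + j * (length fs + h + 1)) * (-1) ^ (r * (l + h) + i * (length ds + length fs + 1 + (l + h) + 1)) :: 'a)"
    unfolding orients_length[OF s(2)] i' l power_add[symmetric]
    by (rule sign_cong) (cases "even r"; cases "even l"; cases "even h"; cases "even i'"; cases "even j";
        cases "even (card (edges s))"; cases "even (length fs)"; simp)
  ultimately show ?thesis unfolding L R by (simp only: scale_scale)
qed

subsection \<open>The operad of cubical chains\<close>

lemma W_circ_osym:
  assumes "orients es M" "orients ds N"
  shows "circ_W i (osym (t, M) es) (osym (s, N) ds) =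
    osym (graft i t s, M \<union> (@) (leaf_addr t i) ` N) (es @ map ((@) (leaf_addr t i)) ds)"
  using assms by (simp add: orients_def W_comp_osym W_graft_def Let_def)

definition metric_trees :: "nat \<Rightarrow> nat \<Rightarrow> mtree set" where
  "metric_trees n k = {(t, M). t \<in> ptrees n \<and> M \<subseteq> edges t \<and> card M = k}"

lemma W_chain_iff: "x \<in> chain_space W_operad n k \<longleftrightarrow> keys x \<subseteq> metric_trees n k"
  by (force simp: W_operad_def metric_trees_def)

lemma metric_tree_cases:
  assumes "T \<in> metric_trees n k"
  obtains t M where "T = (t, M)" "t \<in> ptrees n" "M \<subseteq> edges t" "finite M" "card M = k"
  using assms finite_subset[OF _ finite_internal_edges] by (auto simp: metric_trees_def)

lemma orients_W_graft:
  assumes "t \<in> ptrees r" "1 \<le> i" "i \<le> r" "orients es M" "orients ds N" "M \<subseteq> edges t"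
  shows "orients (es @ map ((@) (leaf_addr t i)) ds) (M \<union> (@) (leaf_addr t i) ` N)"
proof -
  have "M \<inter> (@) (leaf_addr t i) ` N = {}"
    using assms(6) leaf_addr_not_prefix[OF assms(1-3)] by fastforce
  then show ?thesis using assms(4,5) by (auto simp: orients_def distinct_map inj_on_def)
qed

lemma W_circ_assoc_osym:
  assumes t: "t \<in> ptrees r" "M \<subseteq> edges t" "orients es M" and s: "s \<in> ptrees m" "N \<subseteq> edges s" "orients ds N"
    and u: "orients fs L" and ij: "1 \<le> i" "i \<le> r" "1 \<le> j" "j \<le> m"
  shows "circ_W (i + j - 1) (circ_W i (osym (t, M) es) (osym (s, N) ds)) (osym (u, L) fs)
       = circ_W i (osym (t, M) es) (circ_W j (osym (s, N) ds) (osym (u, L) fs))"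
  by (simp add: append_append_fun W_circ_osym[OF orients_W_graft[OF t(1) ij(1,2) t(3) s(3) t(2)] u]
    W_circ_osym[OF t(3) orients_W_graft[OF s(1) ij(3,4) s(3) u s(2)]] W_circ_osym[OF t(3) s(3)] W_circ_osym[OF s(3) u] graft_graft_inner[OF t(1) s(1) ij] o_def image_image image_Un Un_assoc del: One_nat_def)

text \<open>The trees agree, and the orientations differ by an exchange of the blocks of edges of \<open>s\<close> and \<open>u\<close>.\<close>

lemma W_circ_parallel_osym:
  assumes t: "t \<in> ptrees r" "M \<subseteq> edges t" "orients es M" and s: "s \<in> ptrees m" "orients ds N"
    and u: "orients fs L" and ik: "1 \<le> i" "i < k" "k \<le> r"
  shows "circ_W (k + m - 1) (circ_W i (osym (t, M) es) (osym (s, N) ds)) (osym (u, L) fs)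
       = scale ((-1) ^ (length ds * length fs)) (circ_W i (circ_W k (osym (t, M) es) (osym (u, L) fs)) (osym (s, N) ds))"
proof -
  have "i \<le> r" "1 \<le> k" using ik by auto
  note W = W_circ_osym[OF orients_W_graft[OF t(1) ik(1) this(1) t(3) s(2) t(2)] u]
    W_circ_osym[OF orients_W_graft[OF t(1) this(2) ik(3) t(3) u t(2)] s(2)]
  show ?thesis
    by (simp add: W osym_swap_blocks[of _ es "map ((@) (leaf_addr t i)) ds" "map ((@) (leaf_addr t k)) fs" "[]", simplified] W_circ_osym[OF t(3) s(2)] W_circ_osym[OF t(3) u] graft_graft_parallel[OF t(1) s(1) ik] Un_ac del: One_nat_def)
qed

lemma W_circ_assoc:
  assumes x: "x \<in> chain_space W_operad r a" and y: "y \<in> chain_space W_operad m b" and z: "z \<in> chain_space W_operad n c"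
    and ij: "1 \<le> i" "i \<le> r" "1 \<le> j" "j \<le> m"
  shows "circ_W (i + j - 1) (circ_W i x y) z = circ_W i x (circ_W j y z)"
proof (rule chain_trilinear_eq_on[of "\<lambda>x y z. circ_W (i + j - 1) (circ_W i x y) z" "\<lambda>x y z. circ_W i x (circ_W j y z)"])
  fix T S U assume "T \<in> keys x" "S \<in> keys y" "U \<in> keys z"
  then have "T \<in> metric_trees r a" "S \<in> metric_trees m b" "U \<in> metric_trees n c" using x y z unfolding W_chain_iff by auto
  then obtain t M s N u L where T: "T = (t, M)" "t \<in> ptrees r" "M \<subseteq> edges t" "finite M"
    and S: "S = (s, N)" "s \<in> ptrees m" "N \<subseteq> edges s" "finite N" and U: "U = (u, L)" "finite L"
    by (elim metric_tree_cases)
  show "circ_W (i + j - 1) (circ_W i (basis T) (basis S)) (basis U) = (circ_W i (basis T) (circ_W j (basis S) (basis U)) :: mtree \<Rightarrow>\<^sub>0 'a)"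
    unfolding T(1) S(1) U(1) single_sorted[OF T(4), of "(t, M)"] single_sorted[OF S(4), of "(s, N)"] single_sorted[OF U(2), of "(u, L)"]
    using T S U ij by (intro W_circ_assoc_osym orients_exists) auto
qed (intro chain_linear_intros)+

lemma W_circ_parallel:
  assumes x: "x \<in> chain_space W_operad r a" and y: "y \<in> chain_space W_operad m b" and z: "z \<in> chain_space W_operad n c"
    and ik: "1 \<le> i" "i < k" "k \<le> r"
  shows "circ_W (k + m - 1) (circ_W i x y) z = scale ((-1) ^ (b * c)) (circ_W i (circ_W k x z) y)"
proof (rule chain_trilinear_eq_on[of "\<lambda>x y z. circ_W (k + m - 1) (circ_W i x y) z" "\<lambda>x y z. scale _ (circ_W i (circ_W k x z) y)"])
  fix T S U assume "T \<in> keys x" "S \<in> keys y" "U \<in> keys z"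
  then have "T \<in> metric_trees r a" "S \<in> metric_trees m b" "U \<in> metric_trees n c" using x y z unfolding W_chain_iff by auto
  then obtain t M s N u L where T: "T = (t, M)" "t \<in> ptrees r" "M \<subseteq> edges t" "finite M"
    and S: "S = (s, N)" "s \<in> ptrees m" "finite N" "card N = b" and U: "U = (u, L)" "finite L" "card L = c"
    by (elim metric_tree_cases)
  have bc: "b * c = length (sorted_list_of_set N) * length (sorted_list_of_set L)" using S U by simp
  show "circ_W (k + m - 1) (circ_W i (basis T) (basis S)) (basis U)
      = (scale ((-1) ^ (b * c)) (circ_W i (circ_W k (basis T) (basis U)) (basis S)) :: mtree \<Rightarrow>\<^sub>0 'a)"
    unfolding T(1) S(1) U(1) single_sorted[OF T(4), of "(t, M)"] single_sorted[OF S(3), of "(s, N)"] single_sorted[OF U(2), of "(u, L)"] bc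
    using T S U ik by (intro W_circ_parallel_osym orients_exists) auto
qed (intro chain_linear_intros)+

subsection \<open>The boundary of a composite\<close>

lemma sum_lessThan_add: "(\<Sum>i<(a::nat) + b. f i) = (\<Sum>i<a. f i) + (\<Sum>j<b. f (a + j) :: 'a::comm_monoid_add)"
  by (induction b) (simp_all add: add.assoc)

text \<open>The part of the cubical boundary due to the metric edge \<open>e\<close>, without its sign; \<open>ds\<close> orders the
other metric edges.\<close>

definition face :: "ptree \<Rightarrow> addr set \<Rightarrow> addr \<Rightarrow> addr list \<Rightarrow> (mtree \<Rightarrow>\<^sub>0 'k::comm_ring_1)" where
  "face t M e ds = osym (collapse t e, collapse_addr t e ` (M - {e})) (map (collapse_addr t e) ds) - osym (t, M - {e}) ds"

lemma W_bdry_osym: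
  assumes "orients es M"
  shows "bd_W (osym (t, M) es) =
    (\<Sum>i<length es. scale ((-1) ^ Suc i) (face t M (es ! i) (take i es @ drop (Suc i) es)))"
  using assms by (simp add: orients_def W_bd_osym W_faces_def Let_def face_def)

lemma orients_remove_nth:
  "orients es M \<Longrightarrow> i < length es \<Longrightarrow> orients (take i es @ drop (Suc i) es) (M - {es ! i})"
proof -
  assume o: "orients es M" and i: "i < length es"
  then have e: "es = take i es @ es ! i # drop (Suc i) es" by (simp add: id_take_nth_drop)
  with o have "distinct (take i es @ es ! i # drop (Suc i) es)" "M = set (take i es @ es ! i # drop (Suc i) es)"
    unfolding orients_def by metis+
  then show ?thesis by (auto simp: orients_def)
qed

lemma orients_collapse:
  assumes "e \<in> edges t" "M \<subseteq> edges t" "orients ds (M - {e})"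
  shows "orients (map (collapse_addr t e) ds) (collapse_addr t e ` (M - {e}))"
proof -
  have "inj_on (collapse_addr t e) (edges t - {e})"
    using bij_collapse_addr[OF assms(1)] by (simp add: bij_betw_def)
  then have "inj_on (collapse_addr t e) (M - {e})" using assms(2) by (auto intro: inj_on_subset)
  then show ?thesis using assms(3) by (auto simp: orients_def distinct_map)
qed

lemma face_graft_outer:
  assumes t: "t \<in> ptrees r" "M \<subseteq> edges t" and i: "1 \<le> i" "i \<le> r" and e: "e \<in> M"
    and o: "orients ds (M - {e})" "orients fs N"
  shows "face (graft i t s) (M \<union> (@) (leaf_addr t i) ` N) e (ds @ map ((@) (leaf_addr t i)) fs)
    = circ_W i (face t M e ds) (osym (s, N) fs)"
proof -
  let ?p = "leaf_addr t i" and ?c = "collapse_addr t e"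
  have l: "subtree t ?p = Some Leaf" and lc: "i \<le> leaf_count t" using t i by (auto intro!: subtree_leaf_addr_ptrees simp: ptrees_iff)
  have ee: "e \<in> edges t" "e \<noteq> []" using e t by (auto simp: internal_edges_def)
  have np: "\<not> prefix ?p e" using leaf_addr_not_prefix[OF t(1) i ee(1)] .
  have M: "M \<union> (@) ?p ` N - {e} = (M - {e}) \<union> (@) ?p ` N" using np by auto
  have c: "collapse_addr (graft i t s) e = ?c" unfolding graft_def by (rule collapse_addr_subst[OF ee(1) l])
  have q: "leaf_addr (collapse t e) i = ?c ?p" using leaf_addr_collapse[OF ee(1) i(1) lc] .
  have cc: "collapse (graft i t s) e = graft i (collapse t e) s"
    unfolding graft_def q by (rule collapse_subst_outer[OF ee(1) l])
  have ca: "?c (?p @ a) = ?c ?p @ a" for a by (rule collapse_addr_append[OF np ee(2)])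
  show ?thesis
    unfolding face_def chain_linear_diff[OF W_circ_linear(1)] W_circ_osym[OF o] W_circ_osym[OF orients_collapse[OF ee(1) t(2) o(1)] o(2)]
    by (simp add: M c cc q image_Un image_image o_def ca)
qed

lemma face_graft_inner:
  assumes t: "t \<in> ptrees r" "M \<subseteq> edges t" and i: "1 \<le> i" "i \<le> r" and e: "e \<in> N" "N \<subseteq> edges s"
    and o: "orients es M" "orients fs (N - {e})"
  shows "face (graft i t s) (M \<union> (@) (leaf_addr t i) ` N) (leaf_addr t i @ e) (es @ map ((@) (leaf_addr t i)) fs)
    = circ_W i (osym (t, M) es) (face s N e fs)"
proof -
  let ?p = "leaf_addr t i" and ?c = "collapse_addr s e" and ?C = "collapse_addr (graft i t s) (leaf_addr t i @ e)"
  have l: "subtree t ?p = Some Leaf" using t i by (auto intro!: subtree_leaf_addr_ptrees)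
  have ee: "e \<in> edges s" "e \<noteq> []" using e by (auto simp: internal_edges_def)
  have np: "\<not> prefix ?p d" if "d \<in> M" for d using leaf_addr_not_prefix[OF t(1) i] that t by auto
  have M: "M \<union> (@) ?p ` N - {?p @ e} = M \<union> (@) ?p ` (N - {e})"
    using np prefix_appendI[of ?p e] by blast
  have cc: "collapse (graft i t s) (?p @ e) = graft i t (collapse s e)"
    unfolding graft_def by (rule collapse_subst_inner[OF l ee(2)])
  have ca: "?C (?p @ a) = ?p @ ?c a" for a unfolding graft_def by (rule collapse_addr_subst_inner[OF l ee(2)])
  have cM: "?C d = d" if "d \<in> M" for d by (rule collapse_addr_not_prefix[OF ee(2) np[OF that]])
  have "?C ` M = M" "map ?C es = es" using cM o by (auto simp: orients_def intro!: map_idI)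
  then show ?thesis
    unfolding face_def chain_linear_diff[OF W_circ_linear(2)] W_circ_osym[OF o] W_circ_osym[OF o(1) orients_collapse[OF ee(1) e(2) o(2)]]
    by (simp add: M cc image_Un image_image o_def ca)
qed

text \<open>In the orientation of the composite the edges of \<open>t\<close> precede those of \<open>s\<close>, so the first \<open>length es\<close>
faces come from \<open>t\<close> and the position of the others is shifted by \<open>length es\<close>.\<close>

lemma W_derivation_osym:
  assumes t: "t \<in> ptrees r" "M \<subseteq> edges t" "orients es M" and i: "1 \<le> i" "i \<le> r"
    and s: "N \<subseteq> edges s" "orients ds N"
  shows "bd_W (circ_W i (osym (t, M) es) (osym (s, N) ds)) =
    circ_W i (bd_W (osym (t, M) es)) (osym (s, N) ds)
    + scale ((-1) ^ length es) (circ_W i (osym (t, M) es) (bd_W (osym (s, N) ds)))"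
proof -
  let ?p = "leaf_addr t i" and ?a = "length es"
  let ?L = "es @ map ((@) ?p) ds" and ?M = "M \<union> (@) ?p ` N"
  let ?f = "\<lambda>j. scale ((-1) ^ Suc j) (face (graft i t s) ?M (?L ! j) (take j ?L @ drop (Suc j) ?L)) :: mtree \<Rightarrow>\<^sub>0 'a"
  have "bd_W (circ_W i (osym (t, M) es) (osym (s, N) ds)) = (\<Sum>j<?a + length ds. ?f j)"
    unfolding W_circ_osym[OF t(3) s(2)] W_bdry_osym[OF orients_W_graft[OF t(1) i t(3) s(2) t(2)]] by simp
  also have "\<dots> = (\<Sum>j<?a. ?f j) + (\<Sum>j<length ds. ?f (?a + j))" by (rule sum_lessThan_add)
  also have "(\<Sum>j<?a. ?f j) = (\<Sum>j<?a. scale ((-1) ^ Suc j)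
       (circ_W i (face t M (es ! j) (take j es @ drop (Suc j) es)) (osym (s, N) ds)))"
  proof (rule sum.cong[OF refl], goal_cases)
    case (1 j)
    then have j: "j < length es" by simp
    then have e: "es ! j \<in> M" using t(3) by (auto simp: orients_def)
    show ?case
      using face_graft_outer[OF t(1,2) i e orients_remove_nth[OF t(3) j] s(2), of s, where 'a = 'a] j by (simp add: nth_append)
  qed
  also have "\<dots> = circ_W i (bd_W (osym (t, M) es)) (osym (s, N) ds)"
    unfolding W_bdry_osym[OF t(3)] chain_linear_sum[OF W_circ_linear(1)] chain_linear_scale[OF W_circ_linear(1)] ..
  also have "(\<Sum>j<length ds. ?f (?a + j)) = (\<Sum>j<length ds. scale ((-1) ^ ?a) (scale ((-1) ^ Suc j)
       (circ_W i (osym (t, M) es) (face s N (ds ! j) (take j ds @ drop (Suc j) ds)))))"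
  proof (rule sum.cong[OF refl], goal_cases)
    case (1 j)
    then have j: "j < length ds" by simp
    then have e: "ds ! j \<in> N" using s by (auto simp: orients_def)
    have d: "take (?a + j) ?L @ drop (Suc (?a + j)) ?L = es @ map ((@) ?p) (take j ds @ drop (Suc j) ds)"
      by (simp add: take_map drop_map)
    show ?case
      unfolding d using face_graft_inner[OF t(1,2) i e s(1) t(3) orients_remove_nth[OF s(2) j], where 'a = 'a] j
      by (simp add: nth_append scale_scale power_add)
  qed
  also have "\<dots> = scale ((-1) ^ ?a) (circ_W i (osym (t, M) es) (bd_W (osym (s, N) ds)))"
    unfolding W_bdry_osym[OF s(2)] chain_linear_sum[OF W_circ_linear(2)] chain_linear_scale[OF W_circ_linear(2)] scale_sum ..
  finally show ?thesis .
qed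

definition expansions :: "ptree \<Rightarrow> (ptree \<times> addr) set" where
  "expansions t = {(t', e'). t' \<in> ptrees (leaf_count t) \<and> e' \<in> edges t' \<and> collapse t' e' = t}"

text \<open>The edge of the expansion \<open>t'\<close> that becomes a given edge of \<open>t' / e'\<close>.\<close>

definition lift_edge :: "ptree \<Rightarrow> addr \<Rightarrow> addr \<Rightarrow> addr" where
  "lift_edge t' e' = inv_into (edges t' - {e'}) (collapse_addr t' e')"

lemma K_bdry_osym:
  "orients es (edges t) \<Longrightarrow> bd_K (osym t es) =
     (\<Sum>(t', e')\<in>expansions t. osym t' (e' # map (lift_edge t' e') es))"
  by (simp add: orients_def K_bd_osym K_expand_def expansions_def lift_edge_def)

lemma finite_expansions: "finite (expansions t)"
proof -
  have "expansions t \<subseteq> (SIGMA t':ptrees (leaf_count t). edges t')" by (auto simp: expansions_def)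
  then show ?thesis by (rule finite_subset) (simp add: finite_ptrees)
qed

lemma lift_edge_eq:
  assumes "(t', e') \<in> expansions t" "c \<in> edges t'" "c \<noteq> e'" "collapse_addr t' e' c = d"
  shows "lift_edge t' e' d = c"
proof -
  have "inj_on (collapse_addr t' e') (edges t' - {e'})"
    using bij_collapse_addr assms(1) by (auto simp: expansions_def bij_betw_def)
  then show ?thesis using assms unfolding lift_edge_def by (auto intro: inv_into_f_eq)
qed

lemma lift_edge:
  assumes "(t', e') \<in> expansions t" "d \<in> edges t"
  shows "lift_edge t' e' d \<in> edges t'" "lift_edge t' e' d \<noteq> e'" "collapse_addr t' e' (lift_edge t' e' d) = d"
proof -
  have b: "bij_betw (collapse_addr t' e') (edges t' - {e'}) (edges t)"
    using assms bij_collapse_addr by (auto simp: expansions_def)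
  with assms(2) have d: "d \<in> collapse_addr t' e' ` (edges t' - {e'})" by (simp add: bij_betw_def)
  from inv_into_into[OF d] f_inv_into_f[OF d]
  show "lift_edge t' e' d \<in> edges t'" "lift_edge t' e' d \<noteq> e'" "collapse_addr t' e' (lift_edge t' e' d) = d"
    by (auto simp: lift_edge_def)
qed

lemma orients_expansion:
  assumes "(t', e') \<in> expansions t" "orients es (edges t)"
  shows "orients (e' # map (lift_edge t' e') es) (edges t')"
proof -
  have b: "bij_betw (collapse_addr t' e') (edges t' - {e'}) (edges t)" and e: "e' \<in> edges t'"
    using assms bij_collapse_addr by (auto simp: expansions_def)
  from bij_betw_inv_into[OF b] have "bij_betw (lift_edge t' e') (edges t) (edges t' - {e'})"
    by (simp add: lift_edge_def)
  then have "inj_on (lift_edge t' e') (set es)" "lift_edge t' e' ` set es = edges t' - {e'}"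
    using assms(2) by (auto simp: bij_betw_def orients_def)
  then show ?thesis using assms(2) e by (auto simp: orients_def distinct_map)
qed

text \<open>Consider the edge of the expansion that becomes the grafting edge, and cut the expansion there: the
additional edge lies either above the cut, and then expands \<open>s\<close>, or in the remaining tree, and then
expands \<open>t\<close>.  In the second case the address of the grafting edge changes under the collapse.\<close>

lemma expansions_graft:
  assumes t: "t \<in> ptrees r" and s: "s \<in> ptrees m" and i: "1 \<le> i" "i \<le> r"
  defines "F \<equiv> \<lambda>(t', e'). (graft i t' s, e' :: addr)" and "G \<equiv> \<lambda>(s', e'). (graft i t s', leaf_addr t i @ e')"
  shows "expansions (graft i t s) = F ` expansions t \<union> G ` expansions s"
    and "F ` expansions t \<inter> G ` expansions s = {}"
    and "inj_on F (expansions t)" "inj_on G (expansions s)"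
    and "\<And>t' e'. (t', e') \<in> expansions t \<Longrightarrow> t' \<in> ptrees r \<and> e' \<in> edges t' \<and> collapse_addr t' e' (leaf_addr t' i) = leaf_addr t i"
proof -
  let ?p = "leaf_addr t i"
  have ci: "i \<le> leaf_count t" and r: "leaf_count t = r" and m: "leaf_count s = m" using t s i by (auto simp: ptrees_iff)
  have l: "subtree t ?p = Some Leaf" by (rule subtree_leaf_addr_ptrees[OF t i])
  have gts: "graft i t s \<in> ptrees (r + m - 1)" by (rule graft_ptrees[OF t s i])
  have lg: "leaf_count (graft i t s) = r + m - 1" using gts by (simp add: ptrees_iff)
  show E: "t' \<in> ptrees r \<and> e' \<in> edges t' \<and> collapse_addr t' e' (leaf_addr t' i) = leaf_addr t i"
    if "(t', e') \<in> expansions t" for t' e'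
    using that i r leaf_addr_collapse[of e' t' i] by (auto simp: expansions_def ptrees_iff)
  have FE: "F (t', e') \<in> expansions (graft i t s)" if x: "(t', e') \<in> expansions t" for t' e'
  proof -
    from E[OF x] have t': "t' \<in> ptrees r" "e' \<in> edges t'" "collapse_addr t' e' (leaf_addr t' i) = ?p" by auto
    have "collapse (graft i t' s) e' = graft i t s"
      unfolding graft_def collapse_subst_outer[OF t'(2) subtree_leaf_addr_ptrees[OF t'(1) i]]
      using x t'(3) by (simp add: expansions_def)
    moreover have "graft i t' s \<in> ptrees (r + m - 1)" by (rule graft_ptrees[OF t'(1) s i])
    moreover have "e' \<in> edges (graft i t' s)" unfolding graft_edges[OF t'(1) s i] using t' by blast
    ultimately show ?thesis by (simp add: F_def expansions_def lg)
  qed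
  have GE: "G (s', e') \<in> expansions (graft i t s)" if x: "(s', e') \<in> expansions s" for s' e'
  proof -
    from x have s': "s' \<in> ptrees m" "e' \<in> edges s'" "collapse s' e' = s" by (auto simp: expansions_def m)
    then have "e' \<noteq> []" by (auto simp: internal_edges_def)
    then have "collapse (graft i t s') (?p @ e') = graft i t s"
      using s' by (simp add: graft_def collapse_subst_inner[OF l])
    moreover have "graft i t s' \<in> ptrees (r + m - 1)" by (rule graft_ptrees[OF t s'(1) i])
    moreover have "?p @ e' \<in> edges (graft i t s')" unfolding graft_edges[OF t s'(1) i] using s' by blast
    ultimately show ?thesis by (simp add: G_def expansions_def lg)
  qed
  have p: "?p \<in> edges (graft i t s)" unfolding graft_edges[OF t s i] by blast
  have lF: "lift_edge (graft i t' s) e' ?p = leaf_addr t' i" if x: "(t', e') \<in> expansions t" for t' e'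
  proof (rule lift_edge_eq)
    from E[OF x] have t': "t' \<in> ptrees r" "e' \<in> edges t'" "collapse_addr t' e' (leaf_addr t' i) = ?p" by auto
    show "(graft i t' s, e') \<in> expansions (graft i t s)" using FE[OF x] by (simp add: F_def)
    show "leaf_addr t' i \<in> edges (graft i t' s)" unfolding graft_edges[OF t'(1) s i] by blast
    show "leaf_addr t' i \<noteq> e'" using leaf_addr_not_prefix[OF t'(1) i t'(2)] by auto
    show "collapse_addr (graft i t' s) e' (leaf_addr t' i) = ?p"
      unfolding graft_def collapse_addr_subst[OF t'(2) subtree_leaf_addr_ptrees[OF t'(1) i]] by (rule t'(3))
  qed
  have lG: "lift_edge (graft i t s') (?p @ e') ?p = ?p" if x: "(s', e') \<in> expansions s" for s' e'
  proof (rule lift_edge_eq)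
    from x have s': "s' \<in> ptrees m" "e' \<in> edges s'" and ne: "e' \<noteq> []" by (auto simp: expansions_def m internal_edges_def)
    show "(graft i t s', ?p @ e') \<in> expansions (graft i t s)" using GE[OF x] by (simp add: G_def)
    show "?p \<in> edges (graft i t s')" unfolding graft_edges[OF t s'(1) i] by blast
    show "?p \<noteq> ?p @ e'" using ne by simp
    show "collapse_addr (graft i t s') (?p @ e') ?p = ?p"
      using collapse_addr_subst_inner[OF l ne, of s' "[]"] collapse_addr_Nil[OF s'(2)] by (simp add: graft_def)
  qed
  show "F ` expansions t \<inter> G ` expansions s = {}"
  proof (rule ccontr)
    assume "F ` expansions t \<inter> G ` expansions s \<noteq> {}"
    then obtain t' e' s' d' where x: "(t', e') \<in> expansions t" "(s', d') \<in> expansions s" and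
      eq: "graft i t' s = graft i t s'" "e' = ?p @ d'" by (auto simp: F_def G_def)
    from lF[OF x(1)] lG[OF x(2)] eq have "leaf_addr t' i = ?p" by simp
    with eq E[OF x(1)] leaf_addr_not_prefix[of t' r i e'] i show False by simp
  qed
  show "inj_on F (expansions t)"
  proof (rule inj_onI, clarsimp simp: F_def)
    fix t1 t2 e assume x: "(t1, e) \<in> expansions t" "(t2, e) \<in> expansions t" and eq: "graft i t1 s = graft i t2 s"
    from lF[OF x(1)] lF[OF x(2)] eq have "leaf_addr t1 i = leaf_addr t2 i" by simp
    from graft_inj(1)[OF _ i _ i eq this] E[OF x(1)] E[OF x(2)] show "t1 = t2" by simp
  qed
  show "inj_on G (expansions s)"
    using graft_inj(3)[OF t i t i _ refl] by (auto simp: inj_on_def G_def)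
  show "expansions (graft i t s) = F ` expansions t \<union> G ` expansions s"
  proof (rule subset_antisym)
    show "F ` expansions t \<union> G ` expansions s \<subseteq> expansions (graft i t s)" using FE GE by auto
    show "expansions (graft i t s) \<subseteq> F ` expansions t \<union> G ` expansions s"
    proof (rule subrelI)
      fix T e assume x: "(T, e) \<in> expansions (graft i t s)"
      then have T: "T \<in> ptrees (r + m - 1)" "e \<in> edges T" "collapse T e = graft i t s"
        by (auto simp: expansions_def lg)
      \<comment> \<open>the edge of the expansion that becomes the grafting edge\<close>
      define p' where "p' = lift_edge T e ?p"
      have p': "p' \<in> edges T" "p' \<noteq> e" "collapse_addr T e p' = ?p" unfolding p'_def by (rule lift_edge[OF x p])+
      from cut_ptree[OF T(1) p'(1)] obtain r' m' i' t1 s1 where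
        c: "t1 \<in> ptrees r'" "s1 \<in> ptrees m'" "1 \<le> i'" "i' \<le> r'" "T = graft i' t1 s1"
          "leaf_addr t1 i' = p'" "r + m - 1 + 1 = r' + m'" "subtree T p' = Some s1" .
      have l1: "subtree t1 p' = Some Leaf" using subtree_leaf_addr_ptrees[OF c(1,3,4)] c(6) by simp
      show "(T, e) \<in> F ` expansions t \<union> G ` expansions s"
      proof (cases "prefix p' e")
        case True
        then obtain d where d: "e = p' @ d" "d \<noteq> []" using p'(2) by (auto simp: prefix_def)
        with T(2) c(5,6) have ds: "d \<in> edges s1"
          using subtree_subst_append[of t1 p' s1 d] l1 by (auto simp: internal_edges_def graft_def)
        have "collapse T e = graft i' t1 (collapse s1 d)"
          unfolding c(5) d graft_def c(6) by (rule collapse_subst_inner[OF l1 d(2)])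
        moreover have "?p = p'"
          using p'(3) collapse_addr_subst_inner[OF l1 d(2), of s1 "[]"] collapse_addr_Nil[OF ds] unfolding c(5) d graft_def c(6) by simp
        ultimately have "t = t1" "i = i'" "s = collapse s1 d"
          using graft_inj[OF t i c(1,3,4), of s "collapse s1 d"] T(3) c(6) by auto
        moreover from this have "m = m'" using collapse_ptrees[OF c(2) ds] s by (simp add: ptrees_iff)
        ultimately have "(s1, d) \<in> expansions s" "(T, e) = G (s1, d)" using c ds d \<open>?p = p'\<close> m by (auto simp: expansions_def G_def)
        then show ?thesis by blast
      next
        case False
        have et: "e \<in> edges t1"
          using T(2) graft_edges[OF c(1-4)] c(5,6) False p'(2) by auto
        have q: "leaf_addr (collapse t1 e) i' = ?p"
          using leaf_addr_collapse[OF et c(3)] c p'(3) collapse_addr_subst[OF et l1, of s1] by (simp add: ptrees_iff graft_def)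
        have "collapse T e = graft i' (collapse t1 e) s1"
          using collapse_subst_outer[OF et l1, of s1] q collapse_addr_subst[OF et l1, of s1] p'(3) c(5,6) by (simp add: graft_def)
        with graft_inj[OF t i collapse_ptrees[OF c(1) et] c(3,4), of s s1] T(3) q
        have eqs: "t = collapse t1 e" "i = i'" "s = s1" by auto
        moreover from this have "r = r'" using collapse_ptrees[OF c(1) et] t by (simp add: ptrees_iff)
        ultimately have "(t1, e) \<in> expansions t" "(T, e) = F (t1, e)" using c et r by (auto simp: expansions_def F_def)
        then show ?thesis by blast
      qed
    qed
  qed
qed

text \<open>In an expansion of \<open>t\<close> the additional edge already stands in front of the orientation of the
composite.  In an expansion of \<open>s\<close> it has to be moved past the \<open>length es\<close> edges of \<open>t\<close>, and the
degree of \<open>s\<close> drops by one, which changes the sign of the composition by \<open>(-1)^r\<close>; together this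
gives \<open>(-1)^k\<close>.\<close>

lemma K_derivation_osym:
  assumes t: "t \<in> ptrees r" "orients es (edges t)" and s: "s \<in> ptrees m" "orients ds (edges s)"
    and i: "1 \<le> i" "i \<le> r" and k: "length es + k + 2 = r"
  shows "bd_K (circ_K i (osym t es) (osym s ds)) =
    circ_K i (bd_K (osym t es)) (osym s ds)
    + scale ((-1) ^ k) (circ_K i (osym t es) (bd_K (osym s ds)))"
proof -
  obtain l where l: "m = card (edges s) + l + 2" using ptrees_degree[OF s(1)] .
  note s' = s(1)[unfolded l]
  let ?p = "leaf_addr t i"
  let ?L = "es @ map ((@) ?p) ds @ [?p]" and ?c = "(-1) ^ (r * l + i * (length ds + l + 1)) :: 'a"
  define F where "F = (\<lambda>(t', e'). (graft i t' s, e' :: addr))"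
  define G where "G = (\<lambda>(s', e'). (graft i t s', ?p @ e'))"
  define h where "h = (\<lambda>(T, e). scale ?c (osym T (e # map (lift_edge T e) ?L)))"
  note X = expansions_graft[OF t(1) s(1) i, folded F_def G_def]
  have l': "subtree t ?p = Some Leaf" by (rule subtree_leaf_addr_ptrees[OF t(1) i])
  have np: "\<not> prefix ?p d" if "d \<in> set es" for d
    using leaf_addr_not_prefix[OF t(1) i] t(2) that by (auto simp: orients_def)
  have "bd_K (circ_K i (osym t es) (osym s ds)) = sum h (expansions (graft i t s))"
    unfolding K_circ_osym[OF t(2) s(2) t(1) s'] chain_linear_scale[OF bdry_linear(1)]
      K_bdry_osym[OF orients_graft[OF t(1) s(1) i t(2) s(2)]] scale_sum h_def
    by (simp only: split_def)
  also have "\<dots> = sum h (F ` expansions t) + sum h (G ` expansions s)"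
    unfolding X(1) using X(2) by (intro sum.union_disjoint) (simp_all add: finite_expansions)
  also have "\<dots> = (\<Sum>x\<in>expansions t. h (F x)) + (\<Sum>x\<in>expansions s. h (G x))"
    using X(3,4) by (simp add: sum.reindex)
  also have "(\<Sum>x\<in>expansions t. h (F x)) = (\<Sum>(t', e')\<in>expansions t. circ_K i (osym t' (e' # map (lift_edge t' e') es)) (osym s ds))"
  proof (rule sum.cong[OF refl], clarify)
    fix t' e' assume x: "(t', e') \<in> expansions t"
    let ?q = "leaf_addr t' i"
    have t': "t' \<in> ptrees r" "e' \<in> edges t'" "collapse_addr t' e' ?q = ?p" using X(5)[OF x] by auto
    have ne: "e' \<noteq> []" using t' by (auto simp: internal_edges_def)
    have xx: "(graft i t' s, e') \<in> expansions (graft i t s)" unfolding X(1) F_def using x by (auto simp: image_iff intro!: bexI[of _ "(t', e')"])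
    have c: "collapse_addr (graft i t' s) e' = collapse_addr t' e'"
      unfolding graft_def by (rule collapse_addr_subst[OF t'(2) subtree_leaf_addr_ptrees[OF t'(1) i]])
    have nq: "\<not> prefix ?q e'" by (rule leaf_addr_not_prefix[OF t'(1) i t'(2)])
    have "lift_edge (graft i t' s) e' d = lift_edge t' e' d" if "d \<in> set es" for d
    proof (rule lift_edge_eq[OF xx])
      have "d \<in> edges t" using that t(2) by (auto simp: orients_def)
      note le = lift_edge[OF x this]
      show "lift_edge t' e' d \<in> edges (graft i t' s)" unfolding graft_edges[OF t'(1) s(1) i] using le by blast
      show "lift_edge t' e' d \<noteq> e'" "collapse_addr (graft i t' s) e' (lift_edge t' e' d) = d" unfolding c using le by auto
    qed
    moreover have "lift_edge (graft i t' s) e' (?p @ d) = ?q @ d" if "d \<in> set ds \<or> d = []" for d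
    proof (rule lift_edge_eq[OF xx])
      show "?q @ d \<in> edges (graft i t' s)" unfolding graft_edges[OF t'(1) s(1) i] using s(2) that by (auto simp: orients_def)
      show "?q @ d \<noteq> e'" using nq by auto
      show "collapse_addr (graft i t' s) e' (?q @ d) = ?p @ d"
        unfolding c collapse_addr_append[OF nq ne] t'(3) ..
    qed
    ultimately have m: "map (lift_edge (graft i t' s) e') ?L = map (lift_edge t' e') es @ map ((@) ?q) ds @ [?q]"
      by (simp add: o_def) (metis append_Nil2)
    show "h (F (t', e')) = circ_K i (osym t' (e' # map (lift_edge t' e') es)) (osym s ds)"
      unfolding K_circ_osym[OF orients_expansion[OF x t(2)] s(2) t'(1) s'] F_def h_def split_conv m by simp
  qed
  also have "\<dots> = circ_K i (bd_K (osym t es)) (osym s ds)"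
    unfolding K_bdry_osym[OF t(2)] chain_linear_sum[OF K_circ_linear(1)] by (simp only: split_def)
  also have "(\<Sum>x\<in>expansions s. h (G x)) = (\<Sum>(s', e')\<in>expansions s. scale ((-1) ^ k) (circ_K i (osym t es) (osym s' (e' # map (lift_edge s' e') ds))))"
  proof (rule sum.cong[OF refl], clarify)
    fix s1 e' assume x: "(s1, e') \<in> expansions s"
    have s1: "s1 \<in> ptrees m" "e' \<in> edges s1" "collapse s1 e' = s"
      using x s(1) by (auto simp: expansions_def ptrees_iff)
    have ne: "e' \<noteq> []" using s1 by (auto simp: internal_edges_def)
    have c1: "card (edges s1) = card (edges s) + 1" using card_internal_edges_collapse[OF s1(2)] s1(3) by simp
    obtain j where j: "m = card (edges s1) + j + 2" using ptrees_degree[OF s1(1)] .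
    then have lj: "l = j + 1" using l c1 by simp
    have xx: "(graft i t s1, ?p @ e') \<in> expansions (graft i t s)"
      unfolding X(1) G_def using x by (auto simp: image_iff intro!: bexI[of _ "(s1, e')"])
    have "lift_edge (graft i t s1) (?p @ e') d = d" if "d \<in> set es" for d
    proof (rule lift_edge_eq[OF xx])
      show "d \<in> edges (graft i t s1)" unfolding graft_edges[OF t(1) s1(1) i] using t(2) that by (auto simp: orients_def)
      show "d \<noteq> ?p @ e'" using np[OF that] by auto
      show "collapse_addr (graft i t s1) (?p @ e') d = d" by (rule collapse_addr_not_prefix[OF ne np[OF that]])
    qed
    moreover have "lift_edge (graft i t s1) (?p @ e') (?p @ d) = ?p @ lift_edge s1 e' d" if "d \<in> set ds" for d
    proof (rule lift_edge_eq[OF xx])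
      have "d \<in> edges s" using that s(2) by (auto simp: orients_def)
      note le = lift_edge[OF x this]
      show "?p @ lift_edge s1 e' d \<in> edges (graft i t s1)" unfolding graft_edges[OF t(1) s1(1) i] using le by blast
      show "?p @ lift_edge s1 e' d \<noteq> ?p @ e'" using le by simp
      show "collapse_addr (graft i t s1) (?p @ e') (?p @ lift_edge s1 e' d) = ?p @ d"
        using le by (simp add: graft_def collapse_addr_subst_inner[OF l' ne])
    qed
    moreover have "lift_edge (graft i t s1) (?p @ e') ?p = ?p"
    proof (rule lift_edge_eq[OF xx])
      show "?p \<in> edges (graft i t s1)" unfolding graft_edges[OF t(1) s1(1) i] by blast
      show "?p \<noteq> ?p @ e'" using ne by simp
      show "collapse_addr (graft i t s1) (?p @ e') ?p = ?p"
        using collapse_addr_subst_inner[OF l' ne, of s1 "[]"] collapse_addr_Nil[OF s1(2)] by (simp add: graft_def)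
    qed
    ultimately have m: "map (lift_edge (graft i t s1) (?p @ e')) ?L = es @ map ((@) ?p) (map (lift_edge s1 e') ds) @ [?p]"
      by (simp add: o_def map_idI)
    have "h (G (s1, e')) = scale ?c (osym (graft i t s1) ([?p @ e'] @ es @ map ((@) ?p) (map (lift_edge s1 e') ds) @ [?p]))"
      unfolding G_def h_def split_conv m by simp
    also have "\<dots> = scale (?c * (-1) ^ length es) (osym (graft i t s1) (es @ map ((@) ?p) (e' # map (lift_edge s1 e') ds) @ [?p]))"
      by (simp add: osym_swap_blocks[of _ "[]" "[?p @ e']" es, simplified] scale_scale)
    also have "?c * (-1) ^ length es = (-1) ^ k * (-1) ^ (r * j + i * (length (e' # map (lift_edge s1 e') ds) + j + 1))"
      unfolding power_add[symmetric] lj k[symmetric]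
      by (rule sign_cong) (cases "even k"; cases "even j"; cases "even i"; cases "even (length es)"; simp)
    finally show "h (G (s1, e')) = scale ((-1) ^ k) (circ_K i (osym t es) (osym s1 (e' # map (lift_edge s1 e') ds)))"
      unfolding K_circ_osym[OF t(2) orients_expansion[OF x s(2)] t(1) s1(1)[unfolded j]] by (simp only: scale_scale)
  qed
  also have "\<dots> = scale ((-1) ^ k) (circ_K i (osym t es) (bd_K (osym s ds)))"
    unfolding K_bdry_osym[OF s(2)] chain_linear_sum[OF K_circ_linear(2)] scale_sum by (simp only: split_def)
  finally show ?thesis .
qed

section \<open>The standard orientation in closed form\<close>

abbreviation binary :: "ptree \<Rightarrow> bool" where
  "binary \<equiv> every_arity (\<lambda>k. k = 2)"

lemma binary_Node: "binary (Node ts) \<longleftrightarrow> (\<exists>A B. ts = [A, B] \<and> binary A \<and> binary B)"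
proof
  assume b: "binary (Node ts)"
  then obtain A B where "ts = [A, B]"
    by (auto simp: every_arity_Node numeral_2_eq_2 length_Suc_conv)
  with b show "\<exists>A B. ts = [A, B] \<and> binary A \<and> binary B" by (auto simp: every_arity_Node)
qed (auto simp: every_arity_Node)

lemma binary_induct [consumes 1, case_names Leaf Node]:
  assumes "binary t" and "P Leaf"
    and "\<And>A B. binary A \<Longrightarrow> P A \<Longrightarrow> binary B \<Longrightarrow> P B \<Longrightarrow> P (Node [A, B])"
  shows "P t"
  using assms(1)
proof (induction t)
  case (Node ts)
  from Node.prems obtain A B where "ts = [A, B]" "binary A" "binary B" by (auto simp: binary_Node)
  with Node.IH assms(3) show ?case by simp
qed (rule assms(2))

lemma binary_ptrees_ptrees: "t \<in> binary_ptrees n \<Longrightarrow> t \<in> ptrees n"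
  by (simp add: binary_ptrees_def)

lemma finite_binary_ptrees: "finite (binary_ptrees n)"
  by (rule finite_subset[OF _ finite_ptrees[of n]]) (auto simp: binary_ptrees_ptrees)

lemma vertices_Node2: "vertices (Node [A, B]) = insert [] ((#) 0 ` vertices A \<union> (#) (Suc 0) ` vertices B)"
  by (simp add: vertices_Node lessThan_Suc Un_commute)

lemma leaf_addrs_Node2: "leaf_addrs (Node [A, B]) = map ((#) 0) (leaf_addrs A) @ map ((#) (Suc 0)) (leaf_addrs B)"
  by (simp add: leaf_addrs_Node del: leaf_addrs.simps)

text \<open>The symmetric order of the vertices: the vertex that separates leaf \<open>i\<close> from leaf \<open>i + 1\<close> comes at
position \<open>i\<close>.\<close>

fun inorder :: "ptree \<Rightarrow> addr list" where
  "inorder (Node [A, B]) = map ((#) 0) (inorder A) @ [] # map ((#) (Suc 0)) (inorder B)"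
| "inorder _ = []"

lemma set_inorder: "binary t \<Longrightarrow> set (inorder t) = vertices t"
  by (induction t rule: binary_induct) (auto simp: vertices_Node2)

lemma distinct_inorder: "binary t \<Longrightarrow> distinct (inorder t)"
  by (induction t rule: binary_induct) (auto simp: distinct_map)

lemma length_inorder: "binary t \<Longrightarrow> length (inorder t) + 1 = leaf_count t"
  by (induction t rule: binary_induct) (auto simp: leaf_count_Node)

text \<open>The coefficient of the standard orientation relative to the increasing order of the edges, as shown
by \<open>standard_orientation_sound\<close>.\<close>

definition std_sign :: "ptree \<Rightarrow> int" where
  "std_sign t = wedge_sign (inorder t)"

lemma std_sign_square: "binary t \<Longrightarrow> std_sign t * std_sign t = 1"
  unfolding std_sign_def by (rule wedge_sign_square[OF distinct_inorder])

lemma std_sign_orients: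
  assumes "binary t" "t \<noteq> Leaf" "orients es (edges t)"
  shows "orients ([] # es) (set (inorder t))" "wedge_sign ([] # es) = wedge_sign es"
proof -
  have "[] \<notin> set es" using assms by (auto simp: orients_def internal_edges_def)
  then show "orients ([] # es) (set (inorder t))" "wedge_sign ([] # es) = wedge_sign es"
    using assms by (auto simp: set_inorder vertices_internal_edges orients_def)
qed

subsection \<open>Elementary moves\<close>

lemma move_edge_Nil [simp]: "move_edge v [] = []"
  by (cases v) (auto simp: move_edge_def)

lemma move_edge_Cons [simp]:
  "move_edge (i # v) (j # d) = (if i = j then j # move_edge v d else j # d)"
  by (simp add: move_edge_def)

lemma move_edge_root: "move_edge [] d = move_rel d"
  by (simp add: move_edge_def)

text \<open>An elementary move does not change which leaves a vertex separates, except that \<open>v\<close> and the vertex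
above it on the replaced edge exchange their roles.\<close>

lemma inorder_move:
  assumes "binary t"
  shows "subtree t v = Some (Node [A, Node [B, C]]) \<Longrightarrow>
    \<exists>X Q Y. map (move_edge v) (inorder t) = X @ v # Q @ (v @ [0]) # Y \<and>
      inorder (subst t v (Node [Node [A, B], C])) = X @ (v @ [0]) # Q @ v # Y"
  using assms
proof (induction t arbitrary: v rule: binary_induct)
  case Leaf
  then show ?case by (cases v) auto
next
  case (Node S T)
  show ?case
  proof (cases v)
    case Nil
    then show ?thesis using Node.prems
      by (intro exI[of _ "map ((#) 0 \<circ> (#) 0) (inorder A)"] exI[of _ "map ((#) 0 \<circ> (#) (Suc 0)) (inorder B)"]
            exI[of _ "map ((#) (Suc 0)) (inorder C)"])
         (simp add: move_edge_root o_def)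
  next
    case (Cons i w)
    with Node.prems have i: "i = 0 \<or> i = Suc 0" by (auto split: if_splits)
    from i show ?thesis
    proof
      assume i: "i = 0"
      with Cons Node.prems have "subtree S w = Some (Node [A, Node [B, C]])" by simp
      from Node.IH(1)[OF this] obtain X Q Y where *:
        "map (move_edge w) (inorder S) = X @ w # Q @ (w @ [0]) # Y"
        "inorder (subst S w (Node [Node [A, B], C])) = X @ (w @ [0]) # Q @ w # Y" by blast
      have "map (move_edge v) (map ((#) 0) (inorder S)) = map ((#) 0) (map (move_edge w) (inorder S))"
        by (simp add: Cons i)
      with * show ?thesis
        by (intro exI[of _ "map ((#) 0) X"] exI[of _ "map ((#) 0) Q"] exI[of _ "map ((#) 0) Y @ [] # map ((#) (Suc 0)) (inorder T)"])
           (simp add: Cons i)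
    next
      assume i: "i = Suc 0"
      with Cons Node.prems have "subtree T w = Some (Node [A, Node [B, C]])" by simp
      from Node.IH(2)[OF this] obtain X Q Y where *:
        "map (move_edge w) (inorder T) = X @ w # Q @ (w @ [0]) # Y"
        "inorder (subst T w (Node [Node [A, B], C])) = X @ (w @ [0]) # Q @ w # Y" by blast
      have "map (move_edge v) (map ((#) (Suc 0)) (inorder T)) = map ((#) (Suc 0)) (map (move_edge w) (inorder T))"
        by (simp add: Cons i)
      with * show ?thesis
        by (intro exI[of _ "map ((#) 0) (inorder S) @ [] # map ((#) (Suc 0)) X"] exI[of _ "map ((#) (Suc 0)) Q"] exI[of _ "map ((#) (Suc 0)) Y"])
           (simp add: Cons i)
    qed
  qed
qed

lemma subst_vertex:
  assumes "subtree t p = Some u"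
  shows "every_arity P (subst t p s) \<longleftrightarrow> every_arity P (subst t p Leaf) \<and> every_arity P s"
    and "every_arity P t \<longleftrightarrow> every_arity P (subst t p Leaf) \<and> every_arity P u"
    and "leaf_count (subst t p s) + leaf_count u = leaf_count t + leaf_count s"
proof -
  let ?t = "subst t p Leaf"
  have l: "subtree ?t p = Some Leaf" and s: "subst t p s = subst ?t p s" and t: "t = subst ?t p u"
    using assms by (simp_all add: subtree_subst_same subst_subst_same subst_subtree)
  show "every_arity P (subst t p s) \<longleftrightarrow> every_arity P ?t \<and> every_arity P s" unfolding s by (rule every_arity_subst[OF l])
  have "every_arity P (subst ?t p u) \<longleftrightarrow> every_arity P ?t \<and> every_arity P u" by (rule every_arity_subst[OF l])
  then show "every_arity P t \<longleftrightarrow> every_arity P ?t \<and> every_arity P u" unfolding t[symmetric] .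
  have "leaf_count (subst ?t p u) + 1 = leaf_count ?t + leaf_count u" "leaf_count (subst ?t p s) + 1 = leaf_count ?t + leaf_count s"
    by (rule leaf_count_subst[OF l])+
  then show "leaf_count (subst t p s) + leaf_count u = leaf_count t + leaf_count s"
    unfolding t[symmetric] s[symmetric] by simp
qed

lemma move_binary:
  assumes "binary t" "elementary_move v t t'"
  shows "binary t'" "t' \<noteq> Leaf" "leaf_count t' = leaf_count t"
proof -
  from assms(2) obtain A B C where s: "subtree t v = Some (Node [A, Node [B, C]])" "t' = subst t v (Node [Node [A, B], C])"
    by (auto simp: elementary_move_def)
  show "binary t'"
    using assms(1) subst_vertex(1)[OF s(1), of "\<lambda>k. k = 2" "Node [Node [A, B], C]"] subst_vertex(2)[OF s(1), of "\<lambda>k. k = 2"] s(2)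
    by (auto simp: binary_Node)
  show "leaf_count t' = leaf_count t" using subst_vertex(3)[OF s(1), of "Node [Node [A, B], C]"] s(2) by (simp add: leaf_count_Node)
  show "t' \<noteq> Leaf" using s by (cases t; cases v) auto
qed

text \<open>On all vertices, the root included, the identification of edges is a bijection.  It changes the
lists of edges and the symmetric order by the same relative sign, except for the transposition in
\<open>inorder_move\<close>.\<close>

lemma move_orientation:
  assumes t: "binary t" and m: "elementary_move v t t'" and es: "orients es (edges t)"
  shows "orients (map (move_edge v) es) (edges t')"
    and "std_sign t' * wedge_sign (map (move_edge v) es) = - (std_sign t * wedge_sign es)"
proof -
  let ?f = "move_edge v"
  from m obtain A B C where s: "subtree t v = Some (Node [A, Node [B, C]])" "t' = subst t v (Node [Node [A, B], C])"
    by (auto simp: elementary_move_def)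
  obtain X Q Y where *: "map ?f (inorder t) = X @ v # Q @ (v @ [0]) # Y" "inorder t' = X @ (v @ [0]) # Q @ v # Y"
    using inorder_move[OF t s(1)] s(2) by blast
  have t': "binary t'" "t' \<noteq> Leaf" and tl: "t \<noteq> Leaf" using move_binary[OF t m] s(1) by (auto, cases v, auto)
  have d: "distinct (map ?f (inorder t))" "set (map ?f (inorder t)) = vertices t'"
    using distinct_inorder[OF t'(1)] set_inorder[OF t'(1)] unfolding * by auto
  note r = std_sign_orients[OF t tl es]
  have "set ([] # es) = set (inorder t)" using r(1) by (simp add: orients_def)
  then have "inj_on ?f (set ([] # es))" and im: "?f ` set ([] # es) = vertices t'"
    using d by (auto simp: distinct_map)
  then have "distinct (map ?f ([] # es))" using r(1) by (auto simp: orients_def distinct_map)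
  moreover have "set (map ?f ([] # es)) = vertices t'" using im by simp
  moreover from calculation have "[] \<notin> set (map ?f es)" by simp
  ultimately show o: "orients (map ?f es) (edges t')"
    unfolding orients_def internal_edges_vertices by (metis distinct.simps(2) Diff_insert_absorb list.simps(9,15) move_edge_Nil)
  have "wedge_sign (map ?f ([] # es)) = wedge_sign (inorder t) * wedge_sign ([] # es) * wedge_sign (map ?f (inorder t))"
    using wedge_sign_reorder[of "inorder t" "[] # es" "[]" ?f "[]"] r(1) distinct_inorder[OF t] by (simp add: orients_def)
  moreover have "wedge_sign (map ?f (inorder t)) = - std_sign t'"
    unfolding * std_sign_def by (rule wedge_sign_transpose)
  moreover have "wedge_sign (map ?f ([] # es)) = wedge_sign (map ?f es)"
    using std_sign_orients(2)[OF t' o] by simp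
  ultimately have "wedge_sign (map ?f es) = - (std_sign t * wedge_sign es * std_sign t')"
    using r(2) by (simp only: std_sign_def mult_minus_right)
  then have "std_sign t' * wedge_sign (map ?f es) = - (std_sign t * wedge_sign es * (std_sign t' * std_sign t'))"
    by (simp add: ac_simps)
  then show "std_sign t' * wedge_sign (map ?f es) = - (std_sign t * wedge_sign es)"
    by (simp add: std_sign_square[OF t'(1)])
qed

lemma binary_right_comb: "binary (right_comb m)"
  by (induction m) (auto simp: binary_Node)

lemma inorder_right_comb: "inorder (right_comb m) = map (\<lambda>j. replicate j (Suc 0)) [0..<m]"
proof (induction m)
  case (Suc m)
  have "map (\<lambda>j. replicate j (Suc 0)) [0..<Suc m] = [] # map (\<lambda>j. replicate (Suc j) (Suc 0)) [0..<m]"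
    by (simp add: upt_conv_Cons map_Suc_upt[symmetric] o_def del: upt_Suc)
  then show ?case using Suc by (simp add: o_def)
qed simp

text \<open>The symmetric order of the right comb is the increasing order, and each move contributes the same
sign to the inductive definition and to \<open>std_sign\<close>.\<close>

lemma standard_orientation_sound:
  "standard_orientation t \<epsilon> es \<Longrightarrow> binary t \<and> t \<noteq> Leaf \<and> orients es (edges t) \<and> \<epsilon> * wedge_sign es = std_sign t"
proof (induction rule: standard_orientation.induct)
  case (max n)
  let ?t = "right_comb (n - 1)" and ?es = "map (\<lambda>j. replicate j 1) [1..<n - 1] :: addr list"
  obtain m where n: "n = Suc (Suc m)" using max by (metis add_2_eq_Suc le_Suc_ex)
  have i: "inorder ?t = [] # ?es" unfolding n inorder_right_comb by (simp add: upt_conv_Cons del: upt_Suc)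
  have b: "binary ?t" "?t \<noteq> Leaf" by (rule binary_right_comb, simp add: n)
  have "distinct ([] # ?es)" "set ([] # ?es) = vertices ?t"
    using distinct_inorder[OF b(1)] set_inorder[OF b(1)] i by auto
  then have o: "orients ?es (edges ?t)" by (auto simp: orients_def internal_edges_vertices)
  have "sorted_wrt (<) (map (\<lambda>j. replicate j (1::nat)) [1..<k])" for k
  proof (induction k)
    case (Suc k)
    have "replicate a (1::nat) < replicate b 1" if "a < b" for a b
      using that
    proof (induction a arbitrary: b)
      case 0 then show ?case by (cases b) auto
    next
      case (Suc a) then show ?case by (cases b) auto
    qed
    with Suc show ?case by (auto simp: sorted_wrt_append)
  qed simp
  then have "sorted ?es" "distinct ?es" by (auto simp: strict_sorted_iff)
  then have "wedge_sign ?es = 1" by (rule wedge_sign_sorted)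
  then show ?case using b o std_sign_orients(2)[OF b o] i by (simp add: std_sign_def)
next
  case (move t \<epsilon> es v t')
  then have IH: "binary t" "orients es (edges t)" "\<epsilon> * wedge_sign es = std_sign t" by auto
  have b: "binary t'" using move_binary(1)[OF IH(1) move.hyps(2)] .
  let ?w = "wedge_sign es" and ?w' = "wedge_sign (map (move_edge v) es)"
  note mo = move_orientation[OF IH(1) move.hyps(2) IH(2)]
  have w: "?w * ?w = 1" "?w' * ?w' = 1" using IH(2) mo(1) by (auto simp: orients_def wedge_sign_square)
  have "std_sign t' = std_sign t' * ?w' * ?w'" using w by (simp add: mult.assoc)
  also have "\<dots> = - (\<epsilon> * (?w * ?w)) * ?w'" unfolding mo(2) IH(3)[symmetric] by (simp add: mult.assoc)
  finally show ?case using move_binary[OF IH(1) move.hyps(2)] mo(1) w by simp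
qed

subsection \<open>Every binary tree is reached from the right comb\<close>

abbreviation reaches :: "ptree \<Rightarrow> ptree \<Rightarrow> bool" where
  "reaches \<equiv> (\<lambda>t t'. \<exists>v. elementary_move v t t')\<^sup>*\<^sup>*"

lemma elementary_move_child:
  "elementary_move v A A' \<Longrightarrow> elementary_move (0 # v) (Node [A, B]) (Node [A', B])"
  "elementary_move v B B' \<Longrightarrow> elementary_move (Suc 0 # v) (Node [A, B]) (Node [A, B'])"
  by (auto simp: elementary_move_def)

lemma reaches_child:
  "reaches A A' \<Longrightarrow> reaches (Node [A, B]) (Node [A', B])"
  "reaches B B' \<Longrightarrow> reaches (Node [A, B]) (Node [A, B'])"
proof -
  show "reaches A A' \<Longrightarrow> reaches (Node [A, B]) (Node [A', B])"
    by (induction rule: rtranclp_induct) (auto intro: rtranclp.rtrancl_into_rtrancl elementary_move_child)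
  show "reaches B B' \<Longrightarrow> reaches (Node [A, B]) (Node [A, B'])"
    by (induction rule: rtranclp_induct) (auto intro: rtranclp.rtrancl_into_rtrancl elementary_move_child)
qed

text \<open>A move at the root transfers one vertex from the right spine to the left subtree, after the right
subtree has been brought into the required form by induction.\<close>

lemma right_comb_reaches_join: "reaches (right_comb (Suc (a + b))) (Node [right_comb a, right_comb b])"
proof (induction a)
  case (Suc a)
  have "reaches (right_comb (Suc (Suc a + b))) (Node [Leaf, Node [right_comb a, right_comb b]])"
    using reaches_child(2)[OF Suc] by simp
  moreover have "elementary_move [] (Node [Leaf, Node [right_comb a, right_comb b]]) (Node [right_comb (Suc a), right_comb b])"
    by (simp add: elementary_move_def)
  ultimately show ?case by (metis (mono_tags, lifting) rtranclp.rtrancl_into_rtrancl)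
qed simp

lemma right_comb_reaches: "binary t \<Longrightarrow> reaches (right_comb (length (inorder t))) t"
proof (induction t rule: binary_induct)
  case (Node A B)
  have "reaches (right_comb (length (inorder (Node [A, B])))) (Node [right_comb (length (inorder A)), right_comb (length (inorder B))])"
    using right_comb_reaches_join by simp
  also have "reaches \<dots> (Node [A, right_comb (length (inorder B))])" by (rule reaches_child(1)[OF Node.IH(1)])
  also have "reaches \<dots> (Node [A, B])" by (rule reaches_child(2)[OF Node.IH(2)])
  finally show ?case .
qed simp

lemma standard_orientation_exists:
  assumes "binary t" "t \<noteq> Leaf"
  shows "\<exists>\<epsilon> es. standard_orientation t \<epsilon> es"
proof -
  obtain A B where t: "t = Node [A, B]" using assms by (cases t) (auto simp: binary_Node)
  let ?n = "length (inorder t) + 1"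
  have "standard_orientation u \<epsilon> es \<Longrightarrow> reaches u u' \<Longrightarrow> \<exists>\<epsilon> es. standard_orientation u' \<epsilon> es" for u u' \<epsilon> es
    by (rotate_tac, induction rule: rtranclp_induct) (auto intro: standard_orientation.move)
  moreover have "standard_orientation (right_comb (?n - 1)) 1 (map (\<lambda>j. replicate j 1) [1..<?n - 1])"
    by (rule standard_orientation.max) (simp add: t)
  ultimately show ?thesis using right_comb_reaches[OF assms(1)] by (metis add_diff_cancel_right')
qed

lemma standard_chain_closed_form:
  assumes "binary t" "t \<noteq> Leaf"
  shows "standard_chain t = scale (of_int (std_sign t)) (basis (t, edges t))"
proof -
  let ?x = "scale (of_int (std_sign t)) (basis (t, edges t)) :: mtree \<Rightarrow>\<^sub>0 'a"
  have x: "scale (of_int \<epsilon>) (osym (t, edges t) es) = ?x" if "standard_orientation t \<epsilon> es" for \<epsilon> es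
    using standard_orientation_sound[OF that] by (simp add: osym_single scale_scale flip: of_int_mult)
  show ?thesis unfolding standard_chain_def
  proof (rule the_equality)
    show "\<exists>\<epsilon> es. standard_orientation t \<epsilon> es \<and> ?x = scale (of_int \<epsilon>) (osym (t, edges t) es)"
      using standard_orientation_exists[OF assms] x by metis
  qed (use x in blast)
qed

lemma standard_chain_osym:
  assumes "binary t" "t \<noteq> Leaf" "orients es (edges t)"
  shows "standard_chain t = scale (of_int (std_sign t * wedge_sign es)) (osym (t, edges t) es)"
  using assms by (simp add: standard_chain_closed_form single_osym[of es] orients_def scale_scale)

section \<open>Construction of the comparison map\<close>

subsection \<open>Chain spaces\<close>

lemma keys_subset_add: "keys x \<subseteq> S \<Longrightarrow> keys y \<subseteq> S \<Longrightarrow> keys (x + y) \<subseteq> S"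
  using keys_add[of x y] by blast

lemma keys_subset_scale: "keys x \<subseteq> S \<Longrightarrow> keys (scale c x) \<subseteq> S"
proof -
  have "keys (scale c x) \<subseteq> keys x" by (auto simp: in_keys_iff)
  then show "keys x \<subseteq> S \<Longrightarrow> keys (scale c x) \<subseteq> S" by blast
qed

lemma keys_subset_sum: "(\<And>a. a \<in> A \<Longrightarrow> keys (f a) \<subseteq> S) \<Longrightarrow> keys (sum f A) \<subseteq> S"
proof (induction A rule: infinite_finite_induct)
  case (insert a A)
  then have "keys (f a) \<subseteq> S" "keys (sum f A) \<subseteq> S" by auto
  then show ?case using insert.hyps by (simp add: keys_subset_add)
qed auto

lemma keys_subset_osym: "b \<in> S \<Longrightarrow> keys (osym b es) \<subseteq> S"
  by (auto simp: osym_def)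

lemma keys_subset_lin_ext:
  "(\<And>b. b \<in> keys x \<Longrightarrow> keys (f b) \<subseteq> S) \<Longrightarrow> keys (lin_ext f x) \<subseteq> S"
  unfolding lin_ext_def by (intro keys_subset_sum keys_subset_scale)

lemma W_chain_closed:
  "x \<in> chain_space W_operad n k \<Longrightarrow> y \<in> chain_space W_operad n k \<Longrightarrow> x + y \<in> chain_space W_operad n k"
  "x \<in> chain_space W_operad n k \<Longrightarrow> scale c x \<in> chain_space W_operad n k"
  unfolding W_chain_iff by (auto intro!: keys_subset_add keys_subset_scale del: subsetI)

lemma W_graft_metric:
  assumes "(t, M) \<in> metric_trees r a" "(s, N) \<in> metric_trees m b" "1 \<le> i" "i \<le> r"
  shows "(graft i t s, M \<union> (@) (leaf_addr t i) ` N) \<in> metric_trees (r + m - 1) (a + b)"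
proof -
  from assms have t: "t \<in> ptrees r" "M \<subseteq> edges t" "card M = a" and s: "s \<in> ptrees m" "N \<subseteq> edges s" "card N = b"
    by (auto simp: metric_trees_def)
  have o: "orients (sorted_list_of_set M) M" "orients (sorted_list_of_set N) N"
    using finite_subset[OF t(2)] finite_subset[OF s(2)] by (auto intro: orients_exists)
  have "card (M \<union> (@) (leaf_addr t i) ` N) = a + b"
    using orients_length[OF orients_W_graft[OF t(1) assms(3,4) o t(2)]] t(3) s(3) by simp
  moreover have "M \<union> (@) (leaf_addr t i) ` N \<subseteq> edges (graft i t s)"
    unfolding graft_edges[OF t(1) s(1) assms(3,4)] using t(2) s(2) by blast
  ultimately show ?thesis using graft_ptrees[OF t(1) s(1) assms(3,4)] by (simp add: metric_trees_def)
qed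

lemma W_circ_chain:
  assumes "x \<in> chain_space W_operad r a" "y \<in> chain_space W_operad m b" "1 \<le> i" "i \<le> r"
  shows "circ_W i x y \<in> chain_space W_operad (r + m - 1) (a + b)"
proof -
  have "keys (W_graft i T (sorted_list_of_set (snd T)) S (sorted_list_of_set (snd S)) :: mtree \<Rightarrow>\<^sub>0 'a)
      \<subseteq> metric_trees (r + m - 1) (a + b)"
    if "T \<in> keys x" "S \<in> keys y" for T S
    unfolding W_graft_def Let_def
    by (rule keys_subset_osym, rule W_graft_metric) (use assms that in \<open>auto simp: W_chain_iff\<close>)
  then show ?thesis
    unfolding W_chain_iff by (simp add: W_operad_def) (intro keys_subset_lin_ext; simp)
qed

lemma W_derivation:
  assumes x: "x \<in> chain_space W_operad r a" and y: "y \<in> chain_space W_operad m b" and i: "1 \<le> i" "i \<le> r"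
  shows "bd_W (circ_W i x y) =
    circ_W i (bd_W x) y + scale ((-1) ^ a) (circ_W i x (bd_W y))"
proof (rule chain_bilinear_eq_on[of "\<lambda>x y. bd_W (circ_W i x y)"
      "\<lambda>x y. circ_W i (bd_W x) y + scale ((-1) ^ a) (circ_W i x (bd_W y))"])
  fix T S assume "T \<in> keys x" "S \<in> keys y"
  then have "T \<in> metric_trees r a" "S \<in> metric_trees m b" using x y unfolding W_chain_iff by auto
  then obtain t M s N where T: "T = (t, M)" "t \<in> ptrees r" "M \<subseteq> edges t" "finite M" "card M = a"
    and S: "S = (s, N)" "s \<in> ptrees m" "N \<subseteq> edges s" "finite N"
    by (elim metric_tree_cases)
  have a: "a = length (sorted_list_of_set M)" using T by simp
  show "bd_W (circ_W i (basis T) (basis S)) =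
      (circ_W i (bd_W (basis T)) (basis S) + scale ((-1) ^ a) (circ_W i (basis T) (bd_W (basis S))) :: mtree \<Rightarrow>\<^sub>0 'a)"
    unfolding T(1) S(1) single_sorted[OF T(4), of "(t, M)"] single_sorted[OF S(4), of "(s, N)"] a
    using T S i by (intro W_derivation_osym orients_exists) auto
qed (intro chain_linear_intros)+

subsection \<open>Corollas\<close>

lemma leaf_count_corolla [simp]: "leaf_count (corolla n) = n"
  by (simp add: corolla_def leaf_count_Node sum_list_replicate)

lemma internal_edges_corolla [simp]: "edges (corolla n) = {}"
proof -
  have "vertices (corolla n) = {[]}" by (auto simp: corolla_def vertices_Node)
  then show ?thesis by (simp add: internal_edges_vertices)
qed

lemma corolla_ptrees: "2 \<le> n \<Longrightarrow> corolla n \<in> ptrees n"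
  by (auto simp: ptrees_iff corolla_def every_arity_Node) (simp add: corolla_def[symmetric])

lemma corolla_iff:
  assumes "t \<in> ptrees n" shows "edges t = {} \<longleftrightarrow> t = corolla n"
proof
  assume e: "edges t = {}"
  obtain ts where t: "t = Node ts" using assms by (cases t) (auto simp: ptrees_iff)
  have "u = Leaf" if u: "u \<in> set ts" for u
  proof (rule ccontr)
    assume "u \<noteq> Leaf"
    moreover obtain j where "j < length ts" "ts ! j = u" using u by (auto simp: in_set_conv_nth)
    ultimately have "[j] \<in> edges t" by (cases u) (auto simp: t internal_edges_def)
    with e show False by simp
  qed
  then have "ts = replicate (length ts) Leaf" by (simp add: replicate_length_same)
  then have "t = corolla (length ts)" by (simp add: t corolla_def)
  moreover from this assms have "n = length ts" by (simp add: ptrees_iff)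
  ultimately show "t = corolla n" by simp
qed simp

lemma less_append: "q \<noteq> [] \<Longrightarrow> p < p @ (q :: addr)"
  by (induction p) (auto simp: neq_Nil_conv)

text \<open>An edge above the lexicographically last edge would be greater, so only leaves lie above it.\<close>

lemma cut_last_edge:
  assumes t: "t \<in> ptrees n" and e: "edges t \<noteq> {}"
  obtains x r k m where "x \<in> ptrees r" "1 \<le> k" "k \<le> r" "2 \<le> m" "t = graft k x (corolla m)" "n + 1 = r + m"
    "edges t = insert (leaf_addr x k) (edges x)" "\<And>d. d \<in> edges x \<Longrightarrow> d < leaf_addr x k"
proof -
  obtain z where z: "z \<in> edges t" "\<And>d. d \<in> edges t \<Longrightarrow> d \<le> z"
    using that[OF Max_in[OF finite_internal_edges e] Max_ge[OF finite_internal_edges]] by blast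
  from cut_ptree[OF t z(1)] obtain r m k x s where
    c: "x \<in> ptrees r" "s \<in> ptrees m" "1 \<le> k" "k \<le> r" "t = graft k x s" "leaf_addr x k = z" "n + 1 = r + m" .
  note ge = graft_edges[OF c(1-4), folded c(5)]
  have "edges s = {}"
  proof (rule ccontr)
    assume "edges s \<noteq> {}"
    then obtain d where d: "d \<in> edges s" by blast
    then have "z @ d \<in> edges t" unfolding ge c(6) using d by blast
    from z(2)[OF this] less_append[of d z] d show False by (auto simp: internal_edges_def)
  qed
  then have s: "s = corolla m" using corolla_iff[OF c(2)] by simp
  have et: "edges t = insert (leaf_addr x k) (edges x)" using ge by (simp add: s)
  have "leaf_addr x k \<notin> edges x" using leaf_addr_not_prefix[OF c(1,3,4)] by (metis prefix_order.refl)
  then have less: "d < leaf_addr x k" if "d \<in> edges x" for d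
    using z(2)[of d] that unfolding et c(6) by (auto simp: order_le_less)
  show ?thesis by (rule that[OF c(1,3,4) ptrees_ge_2[OF c(2)] c(5)[unfolded s] c(7) et less])
qed

text \<open>Freeness on corollas as an induction principle: removing the last edge of a tree cuts off a
corolla.\<close>

lemma ptree_induct [consumes 1, case_names corolla graft]:
  assumes t: "t \<in> ptrees n"
    and corolla: "\<And>n. 2 \<le> n \<Longrightarrow> P (corolla n) n"
    and graft: "\<And>x r i m. x \<in> ptrees r \<Longrightarrow> P x r \<Longrightarrow> 1 \<le> i \<Longrightarrow> i \<le> r \<Longrightarrow> 2 \<le> m \<Longrightarrow>
      (\<And>d. d \<in> edges x \<Longrightarrow> d < leaf_addr x i) \<Longrightarrow> P (graft i x (corolla m)) (r + m - 1)"
  shows "P t n"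
  using t
proof (induction "card (edges t)" arbitrary: t n rule: less_induct)
  case less
  show ?case
  proof (cases "edges t = {}")
    case True
    then show ?thesis using corolla[OF ptrees_ge_2[OF less.prems]] corolla_iff[OF less.prems] by simp
  next
    case False
    from cut_last_edge[OF less.prems False] obtain x r k m where
      x: "x \<in> ptrees r" "1 \<le> k" "k \<le> r" "2 \<le> m" "t = graft k x (corolla m)" "n + 1 = r + m"
      "edges t = insert (leaf_addr x k) (edges x)" "\<And>d. d \<in> edges x \<Longrightarrow> d < leaf_addr x k" by metis
    have "leaf_addr x k \<notin> edges x" using x(8) by blast
    then have less_card: "card (edges x) < card (edges t)" by (simp add: x(7))
    have "n = r + m - 1" using x(6) by simp
    then show ?thesis using graft[OF x(1) less.hyps[OF less_card x(1)] x(2-4,8)] unfolding x(5) by simp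
  qed
qed

lemma keys_circ_K:
  "keys (circ_K i x y) \<subseteq> {graft i t s | t s. t \<in> keys x \<and> s \<in> keys y}"
  unfolding K_operad_def K_graft_def
  by simp (intro keys_subset_lin_ext keys_subset_scale keys_subset_osym, blast)

subsection \<open>The comparison map on trees\<close>

definition binary_sum :: "nat \<Rightarrow> (mtree \<Rightarrow>\<^sub>0 'k::field)" where
  "binary_sum n = (\<Sum>t\<in>binary_ptrees n. standard_chain t)"

lemma card_internal_edges_binary:
  assumes "t \<in> binary_ptrees n" shows "card (edges t) + 2 = n"
proof -
  have t: "binary t" "t \<noteq> Leaf" "leaf_count t = n" using assms by (auto simp: binary_ptrees_iff)
  have "card (vertices t) + 1 = n"
    using length_inorder[OF t(1)] distinct_card[OF distinct_inorder[OF t(1)]] set_inorder[OF t(1)] t(3) by simp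
  moreover have "vertices t = insert [] (edges t)" "[] \<notin> edges t"
    using t by (auto simp: vertices_internal_edges internal_edges_def)
  ultimately show ?thesis by simp
qed

lemma binary_sum_chain: "binary_sum (k + 2) \<in> chain_space W_operad (k + 2) k"
  unfolding binary_sum_def W_chain_iff
proof (rule keys_subset_sum)
  fix t assume t: "t \<in> binary_ptrees (k + 2)"
  then have "(t, edges t) \<in> metric_trees (k + 2) k"
    using card_internal_edges_binary[OF t] by (simp add: metric_trees_def binary_ptrees_ptrees)
  then show "keys (standard_chain t) \<subseteq> metric_trees (k + 2) k"
    using t by (simp add: standard_chain_closed_form binary_ptrees_iff keys_subset_scale)
qed

definition leaf_index :: "ptree \<Rightarrow> addr \<Rightarrow> nat" where
  "leaf_index t p = (THE i. 1 \<le> i \<and> i \<le> leaf_count t \<and> leaf_addr t i = p)"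

lemma leaf_index: "1 \<le> i \<Longrightarrow> i \<le> leaf_count t \<Longrightarrow> leaf_index t (leaf_addr t i) = i"
  unfolding leaf_index_def by (rule the_equality) (auto simp: leaf_addr_inj)

text \<open>The sign of \<open>c(r) \<circ>\<^sub>i c(m)\<close> in the cellular operad; the degree \<open>m - 2\<close> of \<open>c(m)\<close> has the parity
of \<open>m\<close>.\<close>

abbreviation graft_sign :: "nat \<Rightarrow> nat \<Rightarrow> nat \<Rightarrow> 'a::ring_1" where
  "graft_sign r i m \<equiv> (-1) ^ (r * m + i * (m + 1))"

text \<open>The image of a tree with its edges in increasing order; the number counts the edges that are still to
be cut, and each step cuts off the corolla above the last edge.\<close>

primrec comparison_steps :: "nat \<Rightarrow> ptree \<Rightarrow> (mtree \<Rightarrow>\<^sub>0 'k::field)" where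
  "comparison_steps 0 t = binary_sum (leaf_count t)"
| "comparison_steps (Suc n) t =
    (let p = Max (edges t); u = subst t p Leaf; i = leaf_index u p; m = leaf_count (the (subtree t p))
     in scale (graft_sign (leaf_count u) i m) (circ_W i (comparison_steps n u) (binary_sum m)))"

definition comparison :: "(ptree \<Rightarrow>\<^sub>0 'k::field) \<Rightarrow> (mtree \<Rightarrow>\<^sub>0 'k)" where
  "comparison = lin_ext (\<lambda>t. comparison_steps (card (edges t)) t)"

lemma comparison_linear: "chain_linear comparison"
  unfolding comparison_def by (rule chain_linear_lin_ext)

lemma comparison_osym:
  "comparison (osym t es) = scale (of_int (wedge_sign es)) (comparison_steps (card (edges t)) t)"
  by (simp add: comparison_def osym_def lin_ext_single)

lemma comparison_corolla: "comparison (osym (corolla n) []) = binary_sum n"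
  by (simp add: comparison_osym)

lemma wedge_sign_append_greatest: "(\<And>d. d \<in> set es \<Longrightarrow> d < p) \<Longrightarrow> wedge_sign (es @ [p]) = wedge_sign es"
proof (induction es)
  case (Cons a es)
  have "\<not> p < a" "p \<noteq> a" using Cons.prems[of a] by auto
  then show ?case using Cons by auto
qed simp

lemma comparison_last_edge:
  assumes t: "t \<in> ptrees r" "orients es (edges t)" and i: "1 \<le> i" "i \<le> r" and m: "2 \<le> m"
    and p: "\<And>d. d \<in> edges t \<Longrightarrow> d < leaf_addr t i"
  shows "comparison (osym (graft i t (corolla m)) (es @ [leaf_addr t i])) =
    scale (graft_sign r i m) (circ_W i (comparison (osym t es)) (binary_sum m) :: mtree \<Rightarrow>\<^sub>0 'k::field)"
proof -
  let ?p = "leaf_addr t i" and ?T = "graft i t (corolla m)"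
  have l: "subtree t ?p = Some Leaf" by (rule subtree_leaf_addr_ptrees[OF t(1) i])
  have E: "edges ?T = insert ?p (edges t)"
    using graft_edges[OF t(1) corolla_ptrees[OF m] i] by simp
  have np: "?p \<notin> edges t" using p by blast
  have M: "Max (edges ?T) = ?p" unfolding E using p by (intro Max_eqI) (auto intro: less_imp_le)
  have u: "subst ?T ?p Leaf = t" "subtree ?T ?p = Some (corolla m)"
    unfolding graft_def using l by (simp_all add: subst_subst_same subst_subtree subtree_subst_same)
  have c: "card (edges ?T) = Suc (card (edges t))" unfolding E using np by simp
  have r: "leaf_count t = r" using t by (simp add: ptrees_iff)
  have "comparison_steps (card (edges ?T)) ?T =
      scale (graft_sign r i m) (circ_W i (comparison_steps (card (edges t)) t) (binary_sum m) :: mtree \<Rightarrow>\<^sub>0 'k)"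
    unfolding c comparison_steps.simps Let_def M u r using leaf_index[of i t] i r by simp
  moreover have "wedge_sign (es @ [?p]) = wedge_sign es"
    using t(2) p by (intro wedge_sign_append_greatest) (auto simp: orients_def)
  ultimately show ?thesis
    unfolding comparison_osym by (simp add: chain_linear_scale[OF W_circ_linear(1)] scale_scale mult.commute)
qed

lemma osym_reorder:
  assumes "orients es A" "orients es' A"
  shows "osym b (es @ ds) = scale (of_int (wedge_sign es' * wedge_sign es)) (osym b (es' @ ds))"
  using alternating_reorder[OF osym_alternating[of b "[]" "\<lambda>x. x" ds], of es' es] assms by (simp add: orients_def)

lemma comparison_chain:
  "t \<in> ptrees n \<Longrightarrow> card (edges t) + k + 2 = n \<Longrightarrow> orients es (edges t) \<Longrightarrow>
     (comparison (osym t es) :: mtree \<Rightarrow>\<^sub>0 'k::field) \<in> chain_space W_operad n k"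
proof (induction arbitrary: k es rule: ptree_induct)
  case (corolla n)
  then have "es = []" "n = k + 2" by (auto simp: orients_def)
  then show ?case using binary_sum_chain[of k] by (simp add: comparison_corolla)
next
  case (graft x r i m)
  let ?z = "leaf_addr x i" and ?t = "graft i x (corolla m)" and ?fs = "edge_list x"
  obtain j where j: "r = card (edges x) + j + 2" using ptrees_degree[OF graft.hyps(1)] .
  obtain h where h: "m = h + 2" using graft.hyps(4) by (metis add.commute le_Suc_ex)
  have o: "orients ?fs (edges x)" by (rule orients_edge_list)
  have oz: "orients (?fs @ [?z]) (edges ?t)"
    using orients_graft[OF graft.hyps(1) corolla_ptrees[OF graft.hyps(4)] graft.hyps(2,3) o, of "[]"] by (simp add: orients_def)
  have "k = j + h" "r + (h + 2) - 1 = r + m - 1"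
    using graft.prems(1) orients_length[OF oz] orients_length[OF o] j h by auto
  then have w: "(circ_W i (comparison (osym x ?fs)) (binary_sum m) :: mtree \<Rightarrow>\<^sub>0 'k) \<in> chain_space W_operad (r + m - 1) k"
    using W_circ_chain[OF graft.IH[OF j[symmetric] o] binary_sum_chain[of h] graft.hyps(2,3)] unfolding h by simp
  have "osym ?t es = scale (of_int (wedge_sign (?fs @ [?z]) * wedge_sign es)) (osym ?t (?fs @ [?z]) :: ptree \<Rightarrow>\<^sub>0 'k)"
    using osym_reorder[OF graft.prems(2) oz, of ?t "[]"] by simp
  moreover have "comparison (osym ?t (?fs @ [?z])) =
      scale (graft_sign r i m) (circ_W i (comparison (osym x ?fs)) (binary_sum m) :: mtree \<Rightarrow>\<^sub>0 'k)"
    by (rule comparison_last_edge[OF graft.hyps(1) o graft.hyps(2-5)])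
  ultimately show ?case using w by (simp only: chain_linear_scale[OF comparison_linear] W_chain_closed(2))
qed

text \<open>The recursive definition removes the last edge \<open>z\<close>.  If the edge \<open>p\<close> that carries the grafted
corolla is not the last one, \<open>z\<close> is an edge of \<open>t\<close>, and both edges can be removed in either order.
Removing \<open>z\<close> first is the definition, and \<open>p\<close> can then be removed by the induction hypothesis.
Removing \<open>p\<close> first is the right-hand side of the claim.  The results agree by the parallel
associativity law.  Its sign is \<open>(-1)\<close> to the product of the degrees of the two corollas; the exchange
of \<open>p\<close> and \<open>z\<close> in the orientation and the four composition signs make up for it.\<close>

lemma comparison_top_edge:
  "t \<in> ptrees r \<Longrightarrow> orients es (edges t) \<Longrightarrow> 1 \<le> i \<Longrightarrow> i \<le> r \<Longrightarrow> 2 \<le> m \<Longrightarrow>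
    comparison (osym (graft i t (corolla m)) (es @ [leaf_addr t i])) =
    scale (graft_sign r i m) (circ_W i (comparison (osym t es)) (binary_sum m) :: mtree \<Rightarrow>\<^sub>0 'k::field)"
proof (induction "card (edges t)" arbitrary: t r es i rule: less_induct)
  case less
  let ?p = "leaf_addr t i" and ?T = "graft i t (corolla m)"
  show ?case
  proof (cases "\<forall>d\<in>edges t. d < ?p")
    case True
    then show ?thesis using less.prems by (intro comparison_last_edge) auto
  next
    case False
    then have "edges t \<noteq> {}" by auto
    from cut_last_edge[OF less.prems(1) this] obtain x r' k m' where
      x: "x \<in> ptrees r'" "1 \<le> k" "k \<le> r'" "2 \<le> m'" "t = graft k x (corolla m')" "r + 1 = r' + m'"
      "edges t = insert (leaf_addr x k) (edges x)" "\<And>d. d \<in> edges x \<Longrightarrow> d < leaf_addr x k" by blast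
    let ?z = "leaf_addr x k"
    have lt: "subtree t ?p = Some Leaf" by (rule subtree_leaf_addr_ptrees[OF less.prems(1,3,4)])
    have "?p \<notin> edges t" using leaf_not_vertex[OF lt] by (simp add: internal_edges_vertices)
    \<comment> \<open>As \<open>p\<close> is not below \<open>z\<close> and \<open>z\<close> carries only leaves, \<open>p < z\<close> makes \<open>p\<close> a leaf of \<open>x\<close> to the left of \<open>z\<close>.\<close>
    with False x(7,8) have pz: "?p < ?z" by (auto simp: not_less order_le_less intro: less_trans)
    have zx: "?z \<notin> edges x" using x(8) by blast
    have lx: "subtree x ?z = Some Leaf" by (rule subtree_leaf_addr_ptrees[OF x(1-3)])
    have "\<not> prefix ?z ?p" using pz less_append by (auto simp: prefix_def) (metis append_Nil2 less_append less_asym)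
    moreover have "\<not> prefix ?p ?z"
      using not_prefix_leaf_vertex[OF lt] x(7) by (auto simp: internal_edges_vertices)
    ultimately have "subtree x ?p = Some Leaf"
      using lt by (simp add: x(5) graft_def subtree_subst_not_prefix)
    from leaf_addr_index[OF this] obtain i0 where i0: "1 \<le> i0" "i0 \<le> leaf_count x" "leaf_addr x i0 = ?p" .
    have rx: "leaf_count x = r'" using x(1) by (simp add: ptrees_iff)
    have i0k: "i0 < k"
    proof (rule ccontr)
      assume "\<not> i0 < k"
      then consider "i0 = k" | "k < i0" by linarith
      then have "?z \<le> leaf_addr x i0"
        by cases (use leaf_addr_less[of k i0 x] x i0 in \<open>auto intro: less_imp_le\<close>)
      with i0 pz show False by simp
    qed
    have "leaf_addr t i0 = ?p"
      using leaf_addr_graft_before[of k x i0 "corolla m'"] x i0 i0k rx by simp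
    with leaf_addr_inj[of i0 t i] have ii: "i0 = i"
      using less.prems i0 i0k x rx by (simp add: ptrees_iff)
    have ik: "i < k" using i0k ii by simp
    have ir: "i \<le> r'" using ik x by simp
    have px: "leaf_addr x i = ?p" using i0 ii by simp
    note gp = graft_graft_parallel[OF x(1) corolla_ptrees[OF less.prems(5)] less.prems(3) ik x(3)]
    let ?y = "graft i x (corolla m)"
    have T: "?T = graft (k + m - 1) ?y (corolla m')" and zy: "leaf_addr ?y (k + m - 1) = ?z"
      using gp by (simp_all add: x(5))
    have y: "?y \<in> ptrees (r' + m - 1)" by (rule graft_ptrees[OF x(1) corolla_ptrees[OF less.prems(5)] less.prems(3) ir])
    have Ey: "edges ?y = insert ?p (edges x)"
      using graft_edges[OF x(1) corolla_ptrees[OF less.prems(5)] less.prems(3) ir] by (simp add: px)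
    have ppx: "?p \<notin> edges x" using \<open>?p \<notin> edges t\<close> x(7) by simp
    define fs where "fs = edge_list x"
    have o: "orients fs (edges x)" unfolding fs_def by (rule orients_edge_list)
    have op: "orients (fs @ [?p]) (edges ?y)" using o ppx by (auto simp: orients_def Ey)
    have oz: "orients (fs @ [?z]) (edges t)" using o zx x(7) by (auto simp: orients_def)
    have cx: "card (edges x) < card (edges t)" using x(7) zx by simp
    let ?X = "comparison (osym x fs) :: mtree \<Rightarrow>\<^sub>0 'k"
    obtain j where j: "r' = card (edges x) + j + 2" using ptrees_degree[OF x(1)] .
    have X: "?X \<in> chain_space W_operad r' j" by (rule comparison_chain[OF x(1) j[symmetric] o])
    obtain h h' where h: "m = h + 2" "m' = h' + 2" using x(4) less.prems(5) by (metis add.commute le_Suc_ex)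
    have c1: "comparison (osym ?T ((fs @ [?p]) @ [?z])) =
       scale (graft_sign (r' + m - 1) (k + m - 1) m') (circ_W (k + m - 1) (comparison (osym ?y (fs @ [?p]))) (binary_sum m') :: mtree \<Rightarrow>\<^sub>0 'k)"
      unfolding T zy[symmetric]
    proof (rule comparison_last_edge[OF y op[unfolded zy[symmetric]]])
      show "1 \<le> k + m - 1" "k + m - 1 \<le> r' + m - 1" using x less.prems(5) by auto
      show "2 \<le> m'" by fact
      show "d < leaf_addr ?y (k + m - 1)" if "d \<in> edges ?y" for d
        using that x(8) pz unfolding zy Ey by auto
    qed
    have c2: "comparison (osym ?y (fs @ [?p])) = scale (graft_sign r' i m) (circ_W i ?X (binary_sum m) :: mtree \<Rightarrow>\<^sub>0 'k)"
      using less.hyps[OF cx x(1) o less.prems(3) ir less.prems(5)] by (simp only: px)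
    have c3: "comparison (osym t (fs @ [?z])) = scale (graft_sign r' k m') (circ_W k ?X (binary_sum m') :: mtree \<Rightarrow>\<^sub>0 'k)"
      unfolding x(5) using x by (intro comparison_last_edge o) auto
    have par: "circ_W (k + m - 1) (circ_W i ?X (binary_sum m)) (binary_sum m')
       = scale ((-1) ^ (h * h')) (circ_W i (circ_W k ?X (binary_sum m')) (binary_sum m) :: mtree \<Rightarrow>\<^sub>0 'k)"
      unfolding h by (rule W_circ_parallel[OF X binary_sum_chain binary_sum_chain less.prems(3) ik x(3)])
    have sw: "osym ?T ((fs @ [?z]) @ [?p]) = scale (-1) (osym ?T ((fs @ [?p]) @ [?z]) :: ptree \<Rightarrow>\<^sub>0 'k)"
      using osym_swap[of ?T fs ?z ?p "[]"] by (simp add: scale_minus)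
    obtain k' where k': "k = Suc k'" using x(2) by (cases k) auto
    have r: "r = r' + h' + 1" using x(6) h by simp
    \<comment> \<open>the factor \<open>-1\<close> comes from exchanging \<open>p\<close> and \<open>z\<close>, and \<open>h\<close>, \<open>h'\<close> are the degrees of the corollas\<close>
    have sg: "(-1) * (graft_sign (r' + m - 1) (k + m - 1) m' * (graft_sign r' i m * (-1) ^ (h * h')))
       = (graft_sign r i m * graft_sign r' k m' :: 'k)"
    proof -
      have "(-1) ^ (1 + ((r' + m - 1) * m' + (k + m - 1) * (m' + 1) + (r' * m + i * (m + 1) + h * h'))) =
        ((-1) ^ (r * m + i * (m + 1) + (r' * m' + k * (m' + 1))) :: 'k)"
        unfolding k' h r
        by (rule sign_cong) (cases "even r'"; cases "even k'"; cases "even i"; cases "even h"; cases "even h'"; simp)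
      then show ?thesis unfolding power_add power_one_right .
    qed
    have main: "comparison (osym ?T ((fs @ [?z]) @ [?p])) =
       scale (graft_sign r i m) (circ_W i (comparison (osym t (fs @ [?z]))) (binary_sum m) :: mtree \<Rightarrow>\<^sub>0 'k)"
      unfolding sw chain_linear_scale[OF comparison_linear] c1 c2 c3 chain_linear_scale[OF W_circ_linear(1)] par scale_scale sg ..
    show ?thesis
      unfolding osym_reorder[OF less.prems(2) oz, of _ "[?p]"] osym_reorder[OF less.prems(2) oz, of t "[]", simplified]
        chain_linear_scale[OF comparison_linear] chain_linear_scale[OF W_circ_linear(1)]
      using main by (simp add: scale_scale mult_ac)
  qed
qed

lemma basis_corolla: "basis (corolla m) = osym (corolla m) []"
  by (simp add: osym_def)

lemma comparison_circ_corolla: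
  assumes x: "keys x \<subseteq> ptrees r" and i: "1 \<le> i" "i \<le> r" and m: "2 \<le> m"
  shows "comparison (circ_K i x (basis (corolla m))) = (circ_W i (comparison x) (binary_sum m) :: mtree \<Rightarrow>\<^sub>0 'k::field)"
proof (rule chain_linear_eq_on[of "\<lambda>x. comparison (circ_K i x _)" "\<lambda>x. circ_W i (comparison x) _"])
  fix t assume "t \<in> keys x"
  then have t: "t \<in> ptrees r" using x by blast
  obtain h where h: "m = h + 2" using m by (metis add.commute le_Suc_ex)
  let ?es = "edge_list t"
  have o: "orients ?es (edges t)" by (rule orients_edge_list)
  have "circ_K i (osym t ?es) (osym (corolla m) []) =
      scale ((-1) ^ (r * h + i * (h + 1))) (osym (graft i t (corolla m)) (?es @ [leaf_addr t i]) :: ptree \<Rightarrow>\<^sub>0 'k)"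
    using K_circ_osym[OF o _ t, of "[]" "corolla m" h i] corolla_ptrees[OF m] h by (simp add: orients_def)
  then have "comparison (circ_K i (osym t ?es) (osym (corolla m) [])) =
      scale ((-1) ^ (r * h + i * (h + 1)) * graft_sign r i m) (circ_W i (comparison (osym t ?es)) (binary_sum m) :: mtree \<Rightarrow>\<^sub>0 'k)"
    by (simp only: chain_linear_scale[OF comparison_linear] comparison_top_edge[OF t o i m] scale_scale)
  moreover have "(-1) ^ (r * h + i * (h + 1)) * graft_sign r i m = ((-1) ^ 0 :: 'k)"
    unfolding power_add[symmetric] h by (rule sign_cong) (cases "even r"; cases "even h"; simp)
  ultimately show "comparison (circ_K i (basis t) (basis (corolla m))) = (circ_W i (comparison (basis t)) (binary_sum m) :: mtree \<Rightarrow>\<^sub>0 'k)"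
    by (simp add: osym_edge_list basis_corolla)
qed (intro chain_linear_intros chain_linear_comp[OF comparison_linear])+

text \<open>The composite is a single tree with an orientation of its edges, hence a basis element up to
sign.\<close>

lemma basis_as_composite:
  assumes x: "x \<in> ptrees r" "1 \<le> k" "k \<le> r" "2 \<le> m"
  obtains c :: "'k::field" where
    "basis (graft k x (corolla m)) = scale c (circ_K k (basis x) (basis (corolla m)))"
proof -
  let ?t = "graft k x (corolla m)" and ?es = "edge_list x @ [leaf_addr x k]"
  obtain h where h: "m = h + 2" using x(4) by (metis add.commute le_Suc_ex)
  have o: "orients (edge_list x) (edges x)" "orients [] (edges (corolla m))"
    using orients_edge_list by (auto simp: orients_def)
  have d: "distinct ?es" using orients_graft[OF x(1) corolla_ptrees[OF x(4)] x(2,3) o] by (simp add: orients_def)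
  have "circ_K k (basis x) (basis (corolla m)) = scale ((-1) ^ (r * h + k * (h + 1))) (osym ?t ?es :: ptree \<Rightarrow>\<^sub>0 'k)"
    using K_circ_osym[OF o x(1), of h k] corolla_ptrees[OF x(4)] h by (simp add: osym_edge_list basis_corolla)
  then have "basis ?t = scale (of_int (wedge_sign ?es) * (-1) ^ (r * h + k * (h + 1))) (circ_K k (basis x) (basis (corolla m)) :: ptree \<Rightarrow>\<^sub>0 'k)"
    using single_osym[OF d, of ?t] by (simp add: scale_scale mult.assoc flip: power_add mult_2)
  then show ?thesis by (rule that)
qed

text \<open>Induction on the second factor: a corolla grafted on \<open>s\<close> is, by sequential associativity, a corolla
grafted on the composite of \<open>t\<close> with the rest of \<open>s\<close>.\<close>

lemma comparison_circ_basis: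
  assumes t: "t \<in> ptrees r" and i: "1 \<le> i" "i \<le> r"
  shows "s \<in> ptrees m \<Longrightarrow> comparison (circ_K i (basis t) (basis s)) = (circ_W i (comparison (basis t)) (comparison (basis s)) :: mtree \<Rightarrow>\<^sub>0 'k::field)"
proof (induction rule: ptree_induct)
  case (corolla m)
  then show ?case
    using comparison_circ_corolla[of "basis t" r i m] t i by (simp add: basis_corolla comparison_corolla)
next
  case (graft x r' j m)
  let ?C = "basis (corolla m) :: ptree \<Rightarrow>\<^sub>0 'k" and ?X = "basis x :: ptree \<Rightarrow>\<^sub>0 'k" and ?t = "basis t :: ptree \<Rightarrow>\<^sub>0 'k"
  note x = graft.hyps(1) and j = graft.hyps(2,3) and m = graft.hyps(4)
  obtain c where c: "basis (graft j x (corolla m)) = scale c (circ_K j ?X ?C)" using basis_as_composite[OF x j m] .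
  obtain l where l: "r' = card (edges x) + l + 2" using ptrees_degree[OF x] .
  obtain a where a: "r = card (edges t) + a + 2" using ptrees_degree[OF t] .
  obtain h where h: "m = h + 2" using m by (metis add.commute le_Suc_ex)
  have tx: "keys (circ_K i ?t ?X) \<subseteq> ptrees (r + r' - 1)"
    using keys_circ_K[of i ?t ?X] graft_ptrees[OF t x i] t x i by auto
  have "comparison (circ_K i ?t (circ_K j ?X ?C)) = (comparison (circ_K (i + j - 1) (circ_K i ?t ?X) ?C) :: mtree \<Rightarrow>\<^sub>0 'k)"
    using K_circ_assoc[OF t orients_edge_list x orients_edge_list corolla_ptrees[OF m] _ i j, of "[]", where 'a = 'k]
    by (simp add: orients_def osym_edge_list basis_corolla)
  also have "\<dots> = circ_W (i + j - 1) (comparison (circ_K i ?t ?X)) (binary_sum m)"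
    using i j by (intro comparison_circ_corolla[OF tx _ _ m]) auto
  also have "\<dots> = circ_W i (comparison ?t) (circ_W j (comparison ?X) (binary_sum m))"
    unfolding graft.IH unfolding h osym_edge_list[symmetric]
    by (rule W_circ_assoc[OF comparison_chain[OF t a[symmetric] orients_edge_list] comparison_chain[OF x l[symmetric] orients_edge_list] binary_sum_chain i j])
  also have "circ_W j (comparison ?X) (binary_sum m) = comparison (circ_K j ?X ?C)"
    using comparison_circ_corolla[of ?X r' j m] x j m by simp
  finally show ?case
    unfolding c by (simp only: chain_linear_scale[OF K_circ_linear(2)] chain_linear_scale[OF comparison_linear] chain_linear_scale[OF W_circ_linear(2)])
qed

lemma comparison_circ:
  assumes x: "keys x \<subseteq> ptrees r" and y: "keys y \<subseteq> ptrees m" and i: "1 \<le> i" "i \<le> r"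
  shows "comparison (circ_K i x y) = circ_W i (comparison x) (comparison y)"
proof (rule chain_bilinear_eq_on[of "\<lambda>x y. comparison (circ_K i x y)" "\<lambda>x y. circ_W i (comparison x) (comparison y)"])
  fix t s assume "t \<in> keys x" "s \<in> keys y"
  then show "comparison (circ_K i (basis t) (basis s)) = circ_W i (comparison (basis t :: ptree \<Rightarrow>\<^sub>0 'a)) (comparison (basis s))"
    using x y i by (intro comparison_circ_basis[of t r _ s m]) auto
qed (intro chain_linear_intros comparison_linear chain_linear_comp[OF comparison_linear])+

section \<open>The boundary on corollas\<close>

text \<open>The boundary term of an edge \<open>e\<close>, written with \<open>e\<close> in front of the orientation, does not depend on
the order of the other edges.  Thus a convenient order can be chosen for each edge separately.\<close>

lemma wedge_sign_head_reorder:
  assumes G: "alternating (G :: addr list \<Rightarrow> ('b \<Rightarrow>\<^sub>0 'k::comm_ring_1))" and o: "orients ds A" "orients ds' A"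
  shows "scale (of_int (wedge_sign (e # ds'))) (G ds') = scale (of_int (wedge_sign (e # ds))) (G ds)"
proof -
  have o': "distinct ds" "distinct ds'" "set ds = set ds'" using o by (auto simp: orients_def)
  let ?c = "wedge_sign ds * wedge_sign ds'"
  have "wedge_sign (e # ds') = ?c * wedge_sign (e # ds)"
    using wedge_sign_reorder[OF o', of "[e]" "\<lambda>x. x" "[]"] by simp
  moreover have "G ds' = scale (of_int ?c) (G ds)" by (rule alternating_reorder[OF G o'])
  ultimately have "scale (of_int (wedge_sign (e # ds'))) (G ds') = scale (of_int (wedge_sign (e # ds) * (?c * ?c))) (G ds)"
    by (simp only: scale_scale ac_simps flip: of_int_mult)
  also have "?c * ?c = 1"
    using wedge_sign_cases[OF o'(1)] wedge_sign_cases[OF o'(2)] by auto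
  finally show ?thesis by simp
qed

lemma face_alternating: "alternating (face t M e :: addr list \<Rightarrow> (mtree \<Rightarrow>\<^sub>0 'k::comm_ring_1))"
  unfolding face_def
  using osym_alternating[of _ "[]" "collapse_addr t e" "[]"] osym_alternating[of _ "[]" "\<lambda>d. d" "[]"]
  by (intro alternating_diff) simp_all

definition other_edges :: "addr set \<Rightarrow> addr \<Rightarrow> addr list" where
  "other_edges M e = sorted_list_of_set (M - {e})"

text \<open>Moving the edge number \<open>i\<close> to the front absorbs the sign \<open>(-1)^i\<close> of its face; one sign remains,
which makes collapsed faces negative and non-metric faces positive.\<close>

lemma W_bdry_single:
  assumes M: "finite M"
  shows "bd_W (basis (t, M)) =
    (\<Sum>e\<in>M. scale (of_int (wedge_sign (e # other_edges M e))) (- face t M e (other_edges M e)) :: mtree \<Rightarrow>\<^sub>0 'k::field)"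
proof -
  define es where "es = sorted_list_of_set M"
  have o: "orients es M" unfolding es_def by (rule orients_exists[OF M])
  define rest where "rest i = take i es @ drop (Suc i) es" for i
  have "scale ((-1) ^ Suc i) (face t M (es ! i) (rest i)) =
      (scale (of_int (wedge_sign (es ! i # other_edges M (es ! i)))) (- face t M (es ! i) (other_edges M (es ! i))) :: mtree \<Rightarrow>\<^sub>0 'k)"
    if i: "i < length es" for i
  proof -
    have r: "orients (rest i) (M - {es ! i})" unfolding rest_def by (rule orients_remove_nth[OF o i])
    have d: "orients (other_edges M (es ! i)) (M - {es ! i})" unfolding other_edges_def using M by (intro orients_exists) simp
    have "1 = wedge_sign es" unfolding es_def by (simp add: wedge_sign_sorted M)
    also have "es = [] @ take i es @ [es ! i] @ drop (Suc i) es" using i by (simp add: id_take_nth_drop[symmetric])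
    also have "wedge_sign \<dots> = (-1) ^ (length (take i es) * length [es ! i]) * wedge_sign ([] @ [es ! i] @ take i es @ drop (Suc i) es)"
      by (rule wedge_sign_swap_blocks)
    finally have "(-1) ^ i * wedge_sign (es ! i # rest i) = 1" using i by (simp add: rest_def)
    then have "wedge_sign (es ! i # rest i) = (-1) ^ i"
      by (cases "even i") auto
    then have "scale ((-1) ^ Suc i) (face t M (es ! i) (rest i)) =
        - scale (of_int (wedge_sign (es ! i # rest i))) (face t M (es ! i) (rest i) :: mtree \<Rightarrow>\<^sub>0 'k)"
      by (simp add: scale_minus del: wedge_sign.simps)
    also have "\<dots> = - scale (of_int (wedge_sign (es ! i # other_edges M (es ! i)))) (face t M (es ! i) (other_edges M (es ! i)))"
      by (simp only: wedge_sign_head_reorder[OF face_alternating d r])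
    finally show ?thesis by (simp add: scale_minus del: wedge_sign.simps)
  qed
  then have "bd_W (basis (t, M)) = (\<Sum>i<length es.
      scale (of_int (wedge_sign (es ! i # other_edges M (es ! i)))) (- face t M (es ! i) (other_edges M (es ! i))) :: mtree \<Rightarrow>\<^sub>0 'k)"
    unfolding single_sorted[OF M, of "(t, M)"] es_def[symmetric] W_bdry_osym[OF o] by (intro sum.cong) (auto simp: rest_def)
  also have "\<dots> = (\<Sum>e\<in>M. scale (of_int (wedge_sign (e # other_edges M e))) (- face t M e (other_edges M e)))"
  proof (rule sum.reindex_bij_betw)
    show "bij_betw ((!) es) {..<length es} M"
      using o bij_betw_nth[of es "{..<length es}" M] by (simp add: orients_def)
  qed
  finally show ?thesis .
qed

definition collapse_term :: "ptree \<Rightarrow> addr \<Rightarrow> (mtree \<Rightarrow>\<^sub>0 'k::field)" where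
  "collapse_term t e = (let M = edges t; ds = other_edges M e in
     scale (of_int (std_sign t * wedge_sign (e # ds)))
       (osym (collapse t e, collapse_addr t e ` (M - {e})) (map (collapse_addr t e) ds)))"

definition nonmetric_term :: "ptree \<Rightarrow> addr \<Rightarrow> (mtree \<Rightarrow>\<^sub>0 'k::field)" where
  "nonmetric_term t e = (let M = edges t; ds = other_edges M e in
     scale (of_int (std_sign t * wedge_sign (e # ds))) (osym (t, M - {e}) ds))"

lemma orients_other_edges: "orients (other_edges (edges t) e) (edges t - {e})"
  unfolding other_edges_def by (rule orients_exists) simp

lemma collapse_term_orients:
  assumes "orients ds (edges t - {e})"
  shows "collapse_term t e = scale (of_int (std_sign t * wedge_sign (e # ds)))
     (osym (collapse t e, collapse_addr t e ` (edges t - {e})) (map (collapse_addr t e) ds))"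
proof -
  have "alternating (\<lambda>ds. osym (collapse t e, collapse_addr t e ` (edges t - {e})) (map (collapse_addr t e) ds) :: mtree \<Rightarrow>\<^sub>0 'a)"
    using osym_alternating[of _ "[]" "collapse_addr t e" "[]"] by simp
  from wedge_sign_head_reorder[OF this assms orients_other_edges] show ?thesis
    unfolding collapse_term_def Let_def of_int_mult scale_scale[symmetric] by simp
qed

lemma nonmetric_term_orients:
  assumes "orients ds (edges t - {e})"
  shows "nonmetric_term t e = scale (of_int (std_sign t * wedge_sign (e # ds))) (osym (t, edges t - {e}) ds)"
proof -
  have "alternating (osym (t, edges t - {e}) :: _ \<Rightarrow> mtree \<Rightarrow>\<^sub>0 'a)"
    using osym_alternating[of _ "[]" "\<lambda>x. x" "[]"] by simp
  from wedge_sign_head_reorder[OF this assms orients_other_edges] show ?thesis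
    unfolding nonmetric_term_def Let_def of_int_mult scale_scale[symmetric] by simp
qed

lemma bdry_standard_chain:
  assumes "t \<in> binary_ptrees n"
  shows "bd_W (standard_chain t) = (\<Sum>e\<in>edges t. nonmetric_term t e - collapse_term t e)"
proof -
  have t: "binary t" "t \<noteq> Leaf" using assms by (auto simp: binary_ptrees_iff)
  show ?thesis
    unfolding standard_chain_closed_form[OF t] chain_linear_scale[OF bdry_linear(2)] W_bdry_single[OF finite_internal_edges] scale_sum scale_scale
    by (intro sum.cong refl) (simp add: face_def nonmetric_term_def collapse_term_def Let_def scale_diff del: wedge_sign.simps)
qed

subsection \<open>Collapsed faces cancel\<close>

lemma binary_edge_cases:
  assumes "binary t" "e \<in> edges t"
  obtains (left) v A B C where "e = v @ [Suc 0]" "subtree t v = Some (Node [A, Node [B, C]])"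
    | (right) v A B C where "e = v @ [0]" "subtree t v = Some (Node [Node [A, B], C])"
proof -
  from assms(2) obtain us v j where u: "subtree t e = Some (Node us)" and e: "e = v @ [j]"
    by (cases e rule: rev_cases) (auto simp: internal_edges_def)
  then obtain s where s: "subtree t v = Some s" "subtree s [j] = Some (Node us)"
    by (auto simp: subtree_append split: option.splits)
  then obtain ts where ts: "s = Node ts" by (cases s) auto
  have "binary s" using subst_vertex(2)[OF s(1), of "\<lambda>k. k = 2"] assms(1) by simp
  then obtain X Y where xy: "s = Node [X, Y]" "binary X" "binary Y" by (auto simp: ts binary_Node)
  from s(2) have "j < 2" "[X, Y] ! j = Node us" by (auto simp: xy split: if_splits)
  then consider "j = 0" "X = Node us" | "j = Suc 0" "Y = Node us" by (auto simp: less_2_cases_iff)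
  then show ?thesis using xy e s(1) left right by cases (auto simp: binary_Node)
qed

text \<open>Both trees collapse to the tree with three subtrees \<open>A\<close>, \<open>B\<close>, \<open>C\<close> at \<open>v\<close>, and the identification of
edges under the move is compatible with the two collapses.\<close>

lemma move_collapse:
  assumes "subtree t v = Some (Node [A, Node [B, C]])"
  defines "t' \<equiv> subst t v (Node [Node [A, B], C])"
  shows "collapse t' (v @ [0]) = collapse t (v @ [Suc 0])"
    and "d \<in> edges t \<Longrightarrow> d \<noteq> v @ [Suc 0] \<Longrightarrow>
      collapse_addr t' (v @ [0]) (move_edge v d) = collapse_addr t (v @ [Suc 0]) d"
    and "move_edge v (v @ [Suc 0]) = v @ [0]"
proof -
  have s': "subtree t' v = Some (Node [Node [A, B], C])" unfolding t'_def using assms(1) by (intro subtree_subst_same) simp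
  show "move_edge v (v @ [Suc 0]) = v @ [0]" by (simp add: move_edge_def)
  show "collapse t' (v @ [0]) = collapse t (v @ [Suc 0])"
    unfolding collapse_def Let_def by (simp add: s' assms(1)) (simp add: t'_def subst_subst_same)
  have e': "subtree t' (v @ [0]) = Some (Node [A, B])" and e: "subtree t (v @ [Suc 0]) = Some (Node [B, C])"
    using s' assms(1) by (simp_all add: subtree_append)
  assume d: "d \<in> edges t" "d \<noteq> v @ [Suc 0]"
  show "collapse_addr t' (v @ [0]) (move_edge v d) = collapse_addr t (v @ [Suc 0]) d"
  proof (cases "take (length v) d = v")
    case True
    then obtain r where r: "d = v @ r" by (metis append_take_drop_id)
    with d(1) assms(1) have "r \<in> vertices (Node [A, Node [B, C]])"
      by (auto simp: internal_edges_def vertices_def subtree_append)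
    with d(2) r consider "r = []" | a where "r = 0 # a" | a where "r = Suc 0 # 0 # a" | a where "r = Suc 0 # Suc 0 # a"
      by (auto simp: vertices_Node2)
    then show ?thesis
      by cases (simp_all add: r move_edge_def collapse_addr_def Let_def e e')
  next
    case False
    then show ?thesis by (simp add: move_edge_def collapse_addr_def)
  qed
qed

lemma collapse_term_move:
  assumes t: "binary t" and s: "subtree t v = Some (Node [A, Node [B, C]])"
  shows "collapse_term (subst t v (Node [Node [A, B], C])) (v @ [0]) = - collapse_term t (v @ [Suc 0])"
proof -
  let ?t = "subst t v (Node [Node [A, B], C])" and ?e = "v @ [Suc 0]" and ?f = "move_edge v"
  let ?ds = "other_edges (edges t) ?e" and ?M = "edges t - {?e}"
  have m: "elementary_move v t ?t" using s by (auto simp: elementary_move_def)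
  have e: "?e \<in> edges t" using s by (simp add: internal_edges_def subtree_append)
  note mc = move_collapse[OF s]
  have ds: "orients ?ds ?M" by (rule orients_other_edges)
  then have o: "orients (?e # ?ds) (edges t)" using e by (auto simp: orients_def)
  note mo = move_orientation[OF t m o, unfolded list.map mc(3)]
  have o': "orients (map ?f ?ds) (edges ?t - {v @ [0]})"
    using mo(1) unfolding orients_def by (metis distinct.simps(2) Diff_insert_absorb list.simps(15))
  then have M': "edges ?t - {v @ [0]} = ?f ` ?M" using ds by (auto simp: orients_def)
  have im: "collapse_addr ?t (v @ [0]) ` (?f ` ?M) = collapse_addr t ?e ` ?M"
    unfolding image_image using mc(2) by (intro image_cong) auto
  have mp: "map (collapse_addr ?t (v @ [0])) (map ?f ?ds) = map (collapse_addr t ?e) ?ds"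
    using mc(2) ds by (auto simp: orients_def)
  show ?thesis
    unfolding collapse_term_orients[OF o'] collapse_term_orients[OF ds] M' im mp mc(1) mo(2) by (simp add: scale_minus del: wedge_sign.simps)
qed

fun rotate_left :: "ptree \<Rightarrow> ptree" where
  "rotate_left (Node [A, Node [B, C]]) = Node [Node [A, B], C]"
| "rotate_left t = t"

fun rotate_right :: "ptree \<Rightarrow> ptree" where
  "rotate_right (Node [Node [A, B], C]) = Node [A, Node [B, C]]"
| "rotate_right t = t"

text \<open>The terms of left-leaning edges are the negatives of the terms of right-leaning edges.  The two
halves of the sum are compared, instead of showing that the sum is its own negative, in order to cover
characteristic two.\<close>

lemma collapse_terms_cancel: "(\<Sum>t\<in>binary_ptrees n. \<Sum>e\<in>edges t. collapse_term t e) = (0 :: mtree \<Rightarrow>\<^sub>0 'k::field)"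
proof -
  let ?P = "SIGMA t:binary_ptrees n. edges t"
  let ?L = "{x \<in> ?P. last (snd x) = Suc 0}" and ?R = "{x \<in> ?P. last (snd x) = 0}"
  let ?g = "\<lambda>x. collapse_term (fst x) (snd x) :: mtree \<Rightarrow>\<^sub>0 'k"
  define l where "l = (\<lambda>(t, e). (subst t (butlast e) (rotate_left (the (subtree t (butlast e)))), butlast e @ [0::nat]))"
  define r where "r = (\<lambda>(t, e). (subst t (butlast e) (rotate_right (the (subtree t (butlast e)))), butlast e @ [Suc 0]))"
  have fin: "finite ?P" by (simp add: finite_binary_ptrees)
  have split: "A = {x \<in> A. p x} \<union> {x \<in> A. q x}" if "\<And>x. x \<in> A \<Longrightarrow> p x \<or> q x" for A :: "(ptree \<times> addr) set" and p q
    using that by blast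
  have P: "?P = ?L \<union> ?R"
  proof (rule split)
    fix x assume x: "x \<in> ?P"
    then have "binary (fst x)" "snd x \<in> edges (fst x)" by (auto simp: binary_ptrees_iff)
    then show "last (snd x) = Suc 0 \<or> last (snd x) = 0" by (cases rule: binary_edge_cases) auto
  qed
  have L: "l x \<in> ?R \<and> r (l x) = x \<and> ?g (l x) = - ?g x" if "x \<in> ?L" for x
  proof -
    obtain t e where x: "x = (t, e)" "t \<in> binary_ptrees n" "e \<in> edges t" "last e = Suc 0" using \<open>x \<in> ?L\<close> by auto
    have b: "binary t" using x by (simp add: binary_ptrees_iff)
    from b x(3) show ?thesis
    proof (cases rule: binary_edge_cases)
      case (left v A B C)
      let ?t = "subst t v (Node [Node [A, B], C])"
      have s: "subtree ?t v = Some (Node [Node [A, B], C])" using left by (intro subtree_subst_same) simp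
      have "elementary_move v t ?t" using left by (auto simp: elementary_move_def)
      from move_binary[OF b this] x(2) have "?t \<in> binary_ptrees n" by (simp add: binary_ptrees_iff)
      moreover have "v @ [0] \<in> edges ?t" using s by (simp add: internal_edges_def subtree_append)
      ultimately show ?thesis
        using left s collapse_term_move[OF b left(2)] by (simp add: x(1) l_def r_def subst_subst_same subst_subtree)
    qed (use x in auto)
  qed
  have R: "r x \<in> ?L \<and> l (r x) = x" if "x \<in> ?R" for x
  proof -
    obtain t e where x: "x = (t, e)" "t \<in> binary_ptrees n" "e \<in> edges t" "last e = 0" using \<open>x \<in> ?R\<close> by auto
    have b: "binary t" "t \<noteq> Leaf" "leaf_count t = n" using x by (auto simp: binary_ptrees_iff)
    from b(1) x(3) show ?thesis
    proof (cases rule: binary_edge_cases)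
      case (right v A B C)
      let ?t = "subst t v (Node [A, Node [B, C]])"
      have s: "subtree ?t v = Some (Node [A, Node [B, C]])" using right by (intro subtree_subst_same) simp
      have "binary ?t" using b(1) subst_vertex(1)[OF right(2), of "\<lambda>k. k = 2" "Node [A, Node [B, C]]"] subst_vertex(2)[OF right(2), of "\<lambda>k. k = 2"]
        by (auto simp: binary_Node)
      moreover have "leaf_count ?t = n" using subst_vertex(3)[OF right(2), of "Node [A, Node [B, C]]"] b(3) by (simp add: leaf_count_Node)
      moreover have "?t \<noteq> Leaf" using s by (cases v) auto
      ultimately have "?t \<in> binary_ptrees n" by (simp add: binary_ptrees_iff)
      moreover have "v @ [Suc 0] \<in> edges ?t" using s by (simp add: internal_edges_def subtree_append)
      ultimately show ?thesis
        using right s by (simp add: x(1) l_def r_def subst_subst_same subst_subtree)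
    qed (use x in auto)
  qed
  have "(\<Sum>t\<in>binary_ptrees n. \<Sum>e\<in>edges t. collapse_term t e) = sum ?g ?P"
    by (simp add: sum.Sigma finite_binary_ptrees split_def)
  also have "\<dots> = sum ?g (?L \<union> ?R)" by (rule arg_cong[OF P])
  also have "\<dots> = sum ?g ?L + sum ?g ?R"
  proof (rule sum.union_disjoint)
    show "finite ?L" "finite ?R" by (rule finite_subset[OF _ fin], blast)+
    show "?L \<inter> ?R = {}" by (rule equals0I) (simp, elim conjE, simp)
  qed
  also have "sum ?g ?R = (\<Sum>x\<in>?L. - ?g x)"
  proof (rule sum.reindex_bij_witness[of _ l r])
    show "l (r x) = x" "r x \<in> ?L" if "x \<in> ?R" for x using R[OF that] by (rule conjunct2, rule conjunct1)
    show "r (l x) = x" "l x \<in> ?R" if "x \<in> ?L" for x using L[OF that] by (rule conjunct1[OF conjunct2], rule conjunct1)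
    show "- ?g (r x) = ?g x" if "x \<in> ?R" for x
      using L[OF conjunct1[OF R[OF that]]] conjunct2[OF R[OF that]] by (metis add.inverse_inverse)
  qed
  finally show ?thesis by (simp add: sum_negf)
qed

subsection \<open>The remaining faces are composites\<close>

text \<open>The leaf has the same number of leaves to its left as it has entries of the symmetric order to its
left, because consecutive leaves are separated by exactly one vertex.\<close>

lemma inorder_subst_split:
  assumes "binary t" and "binary s"
  shows "subtree t p = Some Leaf \<Longrightarrow> \<exists>X Y Z W. leaf_addrs t = X @ p # Y \<and> inorder t = Z @ W \<and> length Z = length X \<and>
    inorder (subst t p s) = Z @ map ((@) p) (inorder s) @ W"
  using assms(1)
proof (induction t arbitrary: p rule: binary_induct)
  case Leaf
  then have "p = []" by (cases p) auto
  then show ?case by (intro exI[of _ "[]"]) (simp add: map_idI)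
next
  case (Node A B)
  obtain j q where p: "p = j # q" using Node.prems by (cases p) auto
  from Node.prems p have "j = 0 \<or> j = Suc 0" by (auto split: if_splits)
  then show ?case
  proof
    assume j: "j = 0"
    with Node.prems p have "subtree A q = Some Leaf" by simp
    from Node.IH(1)[OF this] obtain X Y Z W where *: "leaf_addrs A = X @ q # Y" "inorder A = Z @ W" "length Z = length X"
      "inorder (subst A q s) = Z @ map ((@) q) (inorder s) @ W" by blast
    show ?thesis unfolding leaf_addrs_Node2
      by (rule exI[of _ "map ((#) 0) X"], rule exI[of _ "map ((#) 0) Y @ map ((#) (Suc 0)) (leaf_addrs B)"],
          rule exI[of _ "map ((#) 0) Z"], rule exI[of _ "map ((#) 0) W @ [] # map ((#) (Suc 0)) (inorder B)"])
         (simp add: * p j)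
  next
    assume j: "j = Suc 0"
    with Node.prems p have "subtree B q = Some Leaf" by simp
    from Node.IH(2)[OF this] obtain X Y Z W where *: "leaf_addrs B = X @ q # Y" "inorder B = Z @ W" "length Z = length X"
      "inorder (subst B q s) = Z @ map ((@) q) (inorder s) @ W" by blast
    have "length (leaf_addrs A) = Suc (length (inorder A))" using length_inorder[OF Node.hyps(1)] by (simp add: leaf_count_def)
    then show ?thesis unfolding leaf_addrs_Node2
      by (intro exI[of _ "map ((#) 0) (leaf_addrs A) @ map ((#) (Suc 0)) X"] exI[of _ "map ((#) (Suc 0)) Y"]
          exI[of _ "map ((#) 0) (inorder A) @ [] # map ((#) (Suc 0)) Z"] exI[of _ "map ((#) (Suc 0)) W"])
         (simp add: * p j)
  qed
qed

lemma inorder_graft: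
  assumes "binary t" "binary s" "1 \<le> i" "i \<le> leaf_count t"
  obtains Z W where "inorder t = Z @ W" "length Z = i - 1"
    "inorder (graft i t s) = Z @ map ((@) (leaf_addr t i)) (inorder s) @ W"
proof -
  define p where "p = leaf_addr t i"
  have l: "subtree t p = Some Leaf" unfolding p_def by (rule subtree_leaf_addr[OF assms(3,4)])
  from inorder_subst_split[OF assms(1,2) l] obtain X Y Z W where
    *: "leaf_addrs t = X @ p # Y" "inorder t = Z @ W" "length Z = length X"
    "inorder (subst t p s) = Z @ map ((@) p) (inorder s) @ W" by blast
  have "leaf_addr t (Suc (length X)) = p" "Suc (length X) \<le> leaf_count t"
    by (simp_all add: leaf_addr_def leaf_count_def *(1))
  then have "Suc (length X) = i" using leaf_addr_inj[of "Suc (length X)" t i] assms(3,4) by (simp add: p_def)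
  then show ?thesis using that[OF *(2)] * by (auto simp: graft_def p_def)
qed

lemma graft_binary:
  assumes "t \<in> ptrees r" "1 \<le> i" "i \<le> r"
  shows "binary (graft i t s) \<longleftrightarrow> binary t \<and> binary s"
  unfolding graft_def by (rule every_arity_subst[OF subtree_leaf_addr_ptrees[OF assms]])

text \<open>With \<open>I\<close> and \<open>J\<close> the symmetric orders of the factors, \<open>J\<close> is first moved in front of \<open>I\<close>, past
\<open>i - 1\<close> entries.  Then \<open>I\<close> and \<open>J\<close> are replaced by root followed by edges, at the cost of the two
signs on the right-hand side.  Finally the blocks are exchanged and the edge \<open>p\<close>, which is the root of
the second factor, is moved to the front.  The exponents add up to \<open>r m + i (m + 1)\<close> modulo two.\<close>

lemma std_sign_graft:
  assumes t: "t \<in> binary_ptrees r" "orients es (edges t)" and s: "s \<in> binary_ptrees m" "orients ds (edges s)"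
    and i: "1 \<le> i" "i \<le> r"
  shows "std_sign (graft i t s) * wedge_sign (leaf_addr t i # es @ map ((@) (leaf_addr t i)) ds)
    = graft_sign r i m * ((std_sign t * wedge_sign es) * (std_sign s * wedge_sign ds))"
proof -
  let ?p = "leaf_addr t i"
  have bt: "binary t" "t \<noteq> Leaf" "leaf_count t = r" and bs: "binary s" "s \<noteq> Leaf" "leaf_count s = m"
    using t s by (auto simp: binary_ptrees_iff)
  let ?I = "inorder t" and ?J = "inorder s" and ?E = "[] # es" and ?D = "[] # ds" and ?q = "map ((@) ?p)"
  from inorder_graft[OF bt(1) bs(1) i(1)] i(2) bt(3) obtain Z W where
    Z: "?I = Z @ W" "length Z = i - 1" "inorder (graft i t s) = Z @ ?q ?J @ W" by auto
  have lE: "length es + 2 = r" "length ds + 2 = m"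
    using card_internal_edges_binary[OF t(1)] card_internal_edges_binary[OF s(1)] orients_length[OF t(2)] orients_length[OF s(2)] by auto
  have lJ: "length ?J + 1 = m" using length_inorder[OF bs(1)] bs(3) by simp
  note oE = std_sign_orients[OF bt(1,2) t(2)] and oD = std_sign_orients[OF bs(1,2) s(2)]
  have dd: "distinct ?I" "distinct ?E" "set ?I = set ?E" "distinct ?J" "distinct ?D" "set ?J = set ?D"
    using oE(1) oD(1) distinct_inorder[OF bt(1)] distinct_inorder[OF bs(1)] by (auto simp: orients_def)
  define U where "U = wedge_sign (?q ?J @ ?I)"
  have g: "std_sign (graft i t s) = (-1) ^ ((i - 1) * length ?J) * U"
    using wedge_sign_swap_blocks[of "[]" Z "?q ?J" W] by (simp add: std_sign_def Z U_def)
  have V1: "wedge_sign (?q ?D @ ?I) = std_sign s * wedge_sign ds * U"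
    using wedge_sign_reorder[OF dd(4-6), of "[]" "(@) ?p" ?I] oD(2) by (simp add: std_sign_def U_def del: wedge_sign.simps)
  have V2: "wedge_sign (?q ?D @ ?E) = std_sign t * wedge_sign es * wedge_sign (?q ?D @ ?I)"
    using wedge_sign_reorder[OF dd(1-3), of "?q ?D" "\<lambda>x. x" "[]"] oE(2) by (simp add: std_sign_def del: wedge_sign.simps)
  have V3: "wedge_sign (?q ?D @ ?E) = (-1) ^ (length ?D * length ?E) * wedge_sign (?E @ ?q ?D)"
    using wedge_sign_swap_blocks[of "[]" "?q ?D" ?E "[]"] by (simp del: wedge_sign.simps)
  have V4: "wedge_sign (?E @ ?q ?D) = (-1) ^ length es * wedge_sign ([] # ?p # es @ ?q ds)"
    using wedge_sign_swap_blocks[of "[[]]" es "[?p]" "?q ds"] by (simp del: wedge_sign.simps)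
  have "[] \<notin> set (?p # es @ ?q ds)"
    using leaf_not_Nil[OF subtree_leaf_addr_ptrees[OF binary_ptrees_ptrees[OF t(1)] i] bt(2)] t(2)
    by (auto simp: orients_def internal_edges_def)
  then have V5: "wedge_sign ([] # ?p # es @ ?q ds) = wedge_sign (?p # es @ ?q ds)" by (rule wedge_sign_root)
  have "distinct (?q ?J @ ?I)"
  proof -
    have "set ?I \<inter> set (?q ?J) = {}"
      using vertices_subst_disjoint[OF subtree_leaf_addr_ptrees[OF binary_ptrees_ptrees[OF t(1)] i], of "set ?J"] by (simp add: set_inorder[OF bt(1)])
    then show ?thesis using dd by (auto simp: distinct_map inj_on_def)
  qed
  then have UU: "U * U = 1" unfolding U_def by (rule wedge_sign_square)
  let ?w = "wedge_sign (?p # es @ ?q ds)" and ?c = "std_sign t * wedge_sign es * (std_sign s * wedge_sign ds)"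
  let ?k = "length ?D * length ?E + length es"
  have "?c * U = (-1) ^ ?k * ?w" using V1 V2 V3 V4 V5 by (simp only: power_add mult.assoc)
  then have "(-1) ^ ?k * (?c * U) = ((-1) ^ ?k * (-1) ^ ?k) * ?w" by (simp only: mult.assoc)
  then have w: "?w = (-1) ^ ?k * (?c * U)" by (simp add: power_add[symmetric] mult_2[symmetric])
  have "std_sign (graft i t s) * ?w = (-1) ^ ((i - 1) * length ?J) * (-1) ^ ?k * (?c * (U * U))"
    unfolding g w by (simp only: ac_simps)
  also have "(-1) ^ ((i - 1) * length ?J) * (-1) ^ ?k = (graft_sign r i m :: int)"
  proof -
    obtain i' where i': "i = Suc i'" using i(1) by (cases i) auto
    have m: "m = length ds + 2" "r = length es + 2" "length ?J = length ds + 1" using lE lJ by auto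
    show ?thesis unfolding power_add[symmetric] i' m
      by (rule sign_cong) (cases "even i'"; cases "even (length es)"; cases "even (length ds)"; simp)
  qed
  finally show ?thesis by (simp only: UU mult_1_right)
qed

lemma nonmetric_term_graft:
  assumes t: "t \<in> binary_ptrees r" and s: "s \<in> binary_ptrees m" and i: "1 \<le> i" "i \<le> r"
  shows "nonmetric_term (graft i t s) (leaf_addr t i) =
    scale (graft_sign r i m) (circ_W i (standard_chain t) (standard_chain s) :: mtree \<Rightarrow>\<^sub>0 'k::field)"
proof -
  let ?p = "leaf_addr t i" and ?es = "edge_list t" and ?ds = "edge_list s"
  note tp = binary_ptrees_ptrees[OF t] and sp = binary_ptrees_ptrees[OF s]
  have bt: "binary t" "t \<noteq> Leaf" "binary s" "s \<noteq> Leaf" using t s by (auto simp: binary_ptrees_iff)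
  have ot: "orients ?es (edges t)" and os: "orients ?ds (edges s)" by (rule orients_edge_list)+
  let ?ws = "?es @ map ((@) ?p) ?ds"
  have o: "orients ?ws (edges t \<union> (@) ?p ` edges s)" by (rule orients_W_graft[OF tp i ot os]) simp
  have "?p \<notin> edges t \<union> (@) ?p ` edges s"
    using leaf_addr_not_prefix[OF tp i] by (force simp: internal_edges_def)
  then have E: "edges (graft i t s) - {?p} = edges t \<union> (@) ?p ` edges s"
    unfolding graft_edges[OF tp sp i] by blast
  have "nonmetric_term (graft i t s) ?p =
      scale (of_int (std_sign (graft i t s) * wedge_sign (?p # ?ws))) (osym (graft i t s, edges t \<union> (@) ?p ` edges s) ?ws :: mtree \<Rightarrow>\<^sub>0 'k)"
    using nonmetric_term_orients[of ?ws "graft i t s" ?p] o unfolding E by blast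
  also have "\<dots> = scale (graft_sign r i m) (scale (of_int (std_sign s * wedge_sign ?ds)) (scale (of_int (std_sign t * wedge_sign ?es))
      (circ_W i (osym (t, edges t) ?es) (osym (s, edges s) ?ds))))"
    unfolding std_sign_graft[OF t ot s os i] W_circ_osym[OF ot os] scale_scale
    by (simp only: of_int_mult of_int_power of_int_minus of_int_1 mult_ac)
  also have "\<dots> = scale (graft_sign r i m) (circ_W i (standard_chain t) (standard_chain s))"
    unfolding standard_chain_osym[OF bt(1,2) ot] standard_chain_osym[OF bt(3,4) os]
      chain_linear_scale[OF W_circ_linear(1)] chain_linear_scale[OF W_circ_linear(2)] ..
  finally show ?thesis .
qed

text \<open>The possible leaf numbers and positions \<open>(r, m, i)\<close> of a composite \<open>\<circ>\<^sub>i\<close> of arity \<open>n\<close>.\<close>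

definition composite_types :: "nat \<Rightarrow> (nat \<times> nat \<times> nat) set" where
  "composite_types n = {(r, m, i). 2 \<le> r \<and> 2 \<le> m \<and> 1 \<le> i \<and> i \<le> r \<and> r + m = n + 1}"

lemma finite_composite_types: "finite (composite_types n)"
  by (rule finite_subset[of _ "{..n} \<times> {..n} \<times> {..n}"]) (auto simp: composite_types_def)

text \<open>A binary tree with a distinguished edge is the same as a composite of two binary trees.\<close>

lemma sum_binary_edges:
  "(\<Sum>t\<in>binary_ptrees n. \<Sum>e\<in>edges t. f t e) =
    (\<Sum>(r, m, i)\<in>composite_types n. \<Sum>t\<in>binary_ptrees r. \<Sum>s\<in>binary_ptrees m. f (graft i t s) (leaf_addr t i) :: 'c::comm_monoid_add)"
proof -
  let ?A = "SIGMA x:composite_types n. case x of (r, m, i) \<Rightarrow> binary_ptrees r \<times> binary_ptrees m"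
  let ?P = "SIGMA t:binary_ptrees n. edges t"
  let ?h = "\<lambda>((r::nat, m::nat, i), t, s). (graft i t s, leaf_addr t i)"
  have inj: "inj_on ?h ?A"
  proof (rule inj_onI)
    fix x y assume xy: "x \<in> ?A" "y \<in> ?A" "?h x = ?h y"
    obtain r m i t s r' m' i' t' s' where x: "x = ((r, m, i), t, s)" "y = ((r', m', i'), t', s')"
      by (metis surj_pair)
    have c: "(r, m, i) \<in> composite_types n" "(r', m', i') \<in> composite_types n"
      and b: "t \<in> binary_ptrees r" "s \<in> binary_ptrees m" "t' \<in> binary_ptrees r'" "s' \<in> binary_ptrees m'"
      and eq: "graft i t s = graft i' t' s'" "leaf_addr t i = leaf_addr t' i'"
      using xy by (auto simp: x)
    have "t = t'" "i = i'" "s = s'"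
      using graft_inj[OF binary_ptrees_ptrees[OF b(1)] _ _ binary_ptrees_ptrees[OF b(3)] _ _ eq] c by (auto simp: composite_types_def)
    moreover from this b have "r = r'" "m = m'" by (auto simp: binary_ptrees_iff)
    ultimately show "x = y" by (simp add: x)
  qed
  have im: "?h ` ?A = ?P"
  proof (rule subset_antisym)
    show "?h ` ?A \<subseteq> ?P"
    proof (rule image_subsetI)
      fix x assume "x \<in> ?A"
      then obtain r m i t s where x: "x = ((r, m, i), t, s)" and c: "(r, m, i) \<in> composite_types n"
        and b: "t \<in> binary_ptrees r" "s \<in> binary_ptrees m" by auto
      note p = binary_ptrees_ptrees[OF b(1)] binary_ptrees_ptrees[OF b(2)]
      have i: "1 \<le> i" "i \<le> r" "r + m - 1 = n" using c by (auto simp: composite_types_def)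
      have "graft i t s \<in> ptrees n" using graft_ptrees[OF p i(1,2)] i(3) by simp
      moreover have "binary (graft i t s)" using graft_binary[OF p(1) i(1,2)] b by (simp add: binary_ptrees_iff)
      ultimately show "?h x \<in> ?P"
        by (simp add: x graft_edges[OF p i(1,2)] binary_ptrees_iff ptrees_iff)
    qed
    show "?P \<subseteq> ?h ` ?A"
    proof (rule subrelI)
      fix t e assume "(t, e) \<in> ?P"
      then have t: "t \<in> binary_ptrees n" "e \<in> edges t" by auto
      from cut_ptree[OF binary_ptrees_ptrees[OF t(1)] t(2)] obtain r m i u s where
        c: "u \<in> ptrees r" "s \<in> ptrees m" "1 \<le> i" "i \<le> r" "t = graft i u s" "leaf_addr u i = e" "n + 1 = r + m" .
      then have "binary u" "binary s" using graft_binary[OF c(1,3,4)] t(1) by (auto simp: binary_ptrees_iff)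
      then have "((r, m, i), u, s) \<in> ?A"
        using c ptrees_ge_2[OF c(1)] ptrees_ge_2[OF c(2)] by (auto simp: composite_types_def binary_ptrees_iff ptrees_iff)
      then show "(t, e) \<in> ?h ` ?A" using c(5,6) by (force simp: image_iff)
    qed
  qed
  have fA: "\<forall>x\<in>composite_types n. finite (case x of (r, m, i) \<Rightarrow> binary_ptrees r \<times> binary_ptrees m)"
    by (auto simp: finite_binary_ptrees)
  have "(\<Sum>t\<in>binary_ptrees n. \<Sum>e\<in>edges t. f t e) = (\<Sum>(t, e)\<in>?P. f t e)"
    by (simp add: sum.Sigma finite_binary_ptrees)
  also have "\<dots> = (\<Sum>x\<in>?A. case ?h x of (t, e) \<Rightarrow> f t e)"
    unfolding im[symmetric] by (subst sum.reindex[OF inj]) (simp add: o_def)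
  also have "\<dots> = (\<Sum>x\<in>composite_types n. \<Sum>y\<in>(case x of (r, m, i) \<Rightarrow> binary_ptrees r \<times> binary_ptrees m). case ?h (x, y) of (t, e) \<Rightarrow> f t e)"
    using sum.Sigma[OF finite_composite_types fA, of "\<lambda>x y. case ?h (x, y) of (t, e) \<Rightarrow> f t e"] by (simp add: split_def)
  also have "\<dots> = (\<Sum>(r, m, i)\<in>composite_types n. \<Sum>t\<in>binary_ptrees r. \<Sum>s\<in>binary_ptrees m. f (graft i t s) (leaf_addr t i))"
    by (intro sum.cong refl) (auto simp: sum.cartesian_product split_def)
  finally show ?thesis .
qed

lemma bdry_binary_sum:
  "bd_W (binary_sum n) =
    (\<Sum>(r, m, i)\<in>composite_types n. scale (graft_sign r i m) (circ_W i (binary_sum r) (binary_sum m)))"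
proof -
  have "bd_W (binary_sum n) = (\<Sum>t\<in>binary_ptrees n. \<Sum>e\<in>edges t. nonmetric_term t e - collapse_term t e :: mtree \<Rightarrow>\<^sub>0 'a)"
    unfolding binary_sum_def chain_linear_sum[OF bdry_linear(2)] by (intro sum.cong refl bdry_standard_chain)
  also have "\<dots> = (\<Sum>t\<in>binary_ptrees n. \<Sum>e\<in>edges t. nonmetric_term t e)"
    by (simp add: sum_subtractf collapse_terms_cancel)
  also have "\<dots> = (\<Sum>(r, m, i)\<in>composite_types n. \<Sum>t\<in>binary_ptrees r. \<Sum>s\<in>binary_ptrees m. nonmetric_term (graft i t s) (leaf_addr t i))"
    by (rule sum_binary_edges)
  also have "\<dots> = (\<Sum>(r, m, i)\<in>composite_types n. \<Sum>t\<in>binary_ptrees r. \<Sum>s\<in>binary_ptrees m.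
      scale (graft_sign r i m) (circ_W i (standard_chain t) (standard_chain s)))"
    by (intro sum.cong refl) (auto simp: composite_types_def nonmetric_term_graft intro!: sum.cong)
  also have "\<dots> = (\<Sum>(r, m, i)\<in>composite_types n. scale (graft_sign r i m) (circ_W i (binary_sum r) (binary_sum m)))"
    unfolding binary_sum_def chain_linear_sum[OF W_circ_linear(1)] unfolding chain_linear_sum[OF W_circ_linear(2)] scale_sum ..
  finally show ?thesis .
qed

text \<open>The collapse has no edges just if the expansion has one, that is, if it is a composite of two
corollas.\<close>

lemma expansions_corolla:
  assumes "2 \<le> n"
  shows "expansions (corolla n) = (\<lambda>(r, m, i). (graft i (corolla r) (corolla m), leaf_addr (corolla r) i)) ` composite_types n"
    and "inj_on (\<lambda>(r, m, i). (graft i (corolla r) (corolla m), leaf_addr (corolla r) i)) (composite_types n)"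
proof -
  let ?h = "\<lambda>(r, m, i). (graft i (corolla r) (corolla m), leaf_addr (corolla r) i)"
  show "inj_on ?h (composite_types n)"
  proof (rule inj_onI)
    fix x y assume xy: "x \<in> composite_types n" "y \<in> composite_types n" "?h x = ?h y"
    obtain r m i r' m' i' where x: "x = (r, m, i)" "y = (r', m', i')" by (metis surj_pair)
    have c: "(r, m, i) \<in> composite_types n" "(r', m', i') \<in> composite_types n"
      and eq: "graft i (corolla r) (corolla m) = graft i' (corolla r') (corolla m')" "leaf_addr (corolla r) i = leaf_addr (corolla r') i'"
      using xy by (auto simp: x)
    have "corolla r = corolla r'" "i = i'" "corolla m = corolla m'"
      using graft_inj[OF corolla_ptrees[of r] _ _ corolla_ptrees[of r'] _ _ eq] c by (auto simp: composite_types_def)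
    then show "x = y" unfolding x by (metis leaf_count_corolla)
  qed
  show "expansions (corolla n) = ?h ` composite_types n"
  proof (rule subset_antisym)
    show "?h ` composite_types n \<subseteq> expansions (corolla n)"
    proof (rule image_subsetI)
      fix x assume "x \<in> composite_types n"
      then obtain r m i where x: "x = (r, m, i)" "(r, m, i) \<in> composite_types n" by (metis surj_pair)
      then have c: "2 \<le> r" "2 \<le> m" "1 \<le> i" "i \<le> r" "r + m - 1 = n" by (auto simp: composite_types_def)
      note p = corolla_ptrees[OF c(1)] corolla_ptrees[OF c(2)]
      let ?t = "graft i (corolla r) (corolla m)"
      have t: "?t \<in> ptrees n" using graft_ptrees[OF p c(3,4)] c(5) by simp
      have E: "edges ?t = {leaf_addr (corolla r) i}" using graft_edges[OF p c(3,4)] by simp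
      then have e: "leaf_addr (corolla r) i \<in> edges ?t" by simp
      have "card (edges (collapse ?t (leaf_addr (corolla r) i))) = 0"
        using card_internal_edges_collapse[OF e] E by simp
      then have "collapse ?t (leaf_addr (corolla r) i) = corolla n"
        using corolla_iff[OF collapse_ptrees[OF t e]] by simp
      then show "?h x \<in> expansions (corolla n)" using t e by (simp add: x expansions_def ptrees_iff)
    qed
    show "expansions (corolla n) \<subseteq> ?h ` composite_types n"
    proof (rule subrelI)
      fix t e assume "(t, e) \<in> expansions (corolla n)"
      then have t: "t \<in> ptrees n" "e \<in> edges t" "collapse t e = corolla n" by (auto simp: expansions_def)
      from cut_ptree[OF t(1,2)] obtain r m i u s where
        c: "u \<in> ptrees r" "s \<in> ptrees m" "1 \<le> i" "i \<le> r" "t = graft i u s" "leaf_addr u i = e" "n + 1 = r + m" .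
      have l: "subtree u (leaf_addr u i) = Some Leaf" by (rule subtree_leaf_addr_ptrees[OF c(1,3,4)])
      have "card (edges t) = 1" using card_internal_edges_collapse[OF t(2)] t(3) by simp
      then have "card (edges u) = 0" "card (edges s) = 0"
        using card_internal_edges_subst[OF l, of s] c by (auto simp: graft_def ptrees_iff)
      then have "u = corolla r" "s = corolla m" using corolla_iff[OF c(1)] corolla_iff[OF c(2)] by auto
      moreover have "(r, m, i) \<in> composite_types n"
        using c ptrees_ge_2[OF c(1)] ptrees_ge_2[OF c(2)] by (simp add: composite_types_def)
      ultimately show "(t, e) \<in> ?h ` composite_types n" using c(5,6) by (force simp: image_iff)
    qed
  qed
qed

lemma bdry_corolla:
  assumes "2 \<le> n"
  shows "bd_K (osym (corolla n) []) =
    (\<Sum>(r, m, i)\<in>composite_types n. scale (graft_sign r i m) (circ_K i (osym (corolla r) []) (osym (corolla m) []) :: ptree \<Rightarrow>\<^sub>0 'k::field))"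
proof -
  let ?h = "\<lambda>(r, m, i). (graft i (corolla r) (corolla m), leaf_addr (corolla r) i)"
  have "bd_K (osym (corolla n) []) = (\<Sum>(t, e)\<in>expansions (corolla n). osym t [e] :: ptree \<Rightarrow>\<^sub>0 'k)"
    by (subst K_bdry_osym) (simp_all add: orients_def)
  also have "\<dots> = (\<Sum>x\<in>composite_types n. case ?h x of (t, e) \<Rightarrow> osym t [e])"
    unfolding expansions_corolla(1)[OF assms] by (subst sum.reindex[OF expansions_corolla(2)[OF assms]]) (simp add: o_def)
  also have "\<dots> = (\<Sum>(r, m, i)\<in>composite_types n. scale (graft_sign r i m) (circ_K i (osym (corolla r) []) (osym (corolla m) [])))"
  proof (rule sum.cong[OF refl])
    fix x assume "x \<in> composite_types n"
    then obtain r m i where x: "x = (r, m, i)" "(r, m, i) \<in> composite_types n" by (metis surj_pair)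
    then have c: "2 \<le> r" "2 \<le> m" by (auto simp: composite_types_def)
    then obtain h where h: "m = h + 2" by (metis add.commute le_Suc_ex)
    have o: "orients [] (edges (corolla k))" for k by (simp add: orients_def)
    have "scale (graft_sign r i m) (circ_K i (osym (corolla r) []) (osym (corolla m) [])) =
      scale (graft_sign r i m * (-1) ^ (r * h + i * (h + 1))) (osym (graft i (corolla r) (corolla m)) [leaf_addr (corolla r) i] :: ptree \<Rightarrow>\<^sub>0 'k)"
      using K_circ_osym[OF o o corolla_ptrees[OF c(1)], of m h i, where 'a = 'k] corolla_ptrees[OF c(2)] h by (simp add: scale_scale)
    also have "graft_sign r i m * (-1) ^ (r * h + i * (h + 1)) = ((-1) ^ 0 :: 'k)"
      unfolding power_add[symmetric] h by (rule sign_cong) (cases "even r"; cases "even h"; simp)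
    finally show "(case ?h x of (t, e) \<Rightarrow> osym t [e]) = (case x of (r, m, i) \<Rightarrow>
        scale (graft_sign r i m) (circ_K i (osym (corolla r) []) (osym (corolla m) []) :: ptree \<Rightarrow>\<^sub>0 'k))" by (simp add: x)
  qed
  finally show ?thesis .
qed

lemma comparison_bdry_corolla:
  assumes "2 \<le> n"
  shows "comparison (bd_K (osym (corolla n) [])) = bd_W (binary_sum n)"
proof -
  have "comparison (circ_K i (osym (corolla r) []) (osym (corolla m) [])) = (circ_W i (binary_sum r) (binary_sum m) :: mtree \<Rightarrow>\<^sub>0 'a)"
    if "(r, m, i) \<in> composite_types n" for r m i
    using comparison_circ[OF keys_subset_osym[OF corolla_ptrees[of r]] keys_subset_osym[OF corolla_ptrees[of m]], of i "[]" "[]"] that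
    by (simp add: composite_types_def comparison_corolla)
  then show ?thesis
    unfolding bdry_corolla[OF assms] bdry_binary_sum chain_linear_sum[OF comparison_linear]
    by (intro sum.cong refl) (auto simp: chain_linear_scale[OF comparison_linear])
qed

section \<open>The comparison map is a morphism of operads of chain complexes\<close>

lemma K_chain_iff: "x \<in> chain_space K_operad n k \<longleftrightarrow> keys x \<subseteq> {t \<in> ptrees n. card (edges t) + k + 2 = n}"
  by (auto simp: K_operad_def)

lemma keys_bdry_K:
  assumes "t \<in> ptrees n" "orients es (edges t)"
  shows "keys (bd_K (osym t es) :: ptree \<Rightarrow>\<^sub>0 'k::field)
    \<subseteq> {t' \<in> ptrees n. card (edges t') = card (edges t) + 1}"
  unfolding K_bdry_osym[OF assms(2)]
proof (rule keys_subset_sum, clarify)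
  fix t' e' x assume x: "(t', e') \<in> expansions t" and k: "x \<in> keys (osym t' (e' # map (lift_edge t' e') es) :: ptree \<Rightarrow>\<^sub>0 'k)"
  then have "x = t'" using keys_subset_osym[of t' "{t'}"] by blast
  then show "x \<in> ptrees n \<and> card (edges x) = card (edges t) + 1"
    using x assms(1) card_internal_edges_collapse[of e' t'] by (auto simp: expansions_def ptrees_iff)
qed

text \<open>For \<open>k = 0\<close> the truncated difference does no harm: an expansion would have more edges than
\<open>internal_edges_bound\<close> permits, so the boundary is zero.\<close>

lemma bdry_K_chain:
  assumes "x \<in> chain_space K_operad n k" shows "bd_K x \<in> chain_space K_operad n (k - 1)"
proof -
  have "keys (K_expand t (edge_list t) :: ptree \<Rightarrow>\<^sub>0 'a) \<subseteq> {t \<in> ptrees n. card (edges t) + (k - 1) + 2 = n}"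
    if "t \<in> keys x" for t
  proof -
    have t: "t \<in> ptrees n" "card (edges t) + k + 2 = n" using assms that by (auto simp: K_chain_iff)
    have "K_expand t (edge_list t) = (bd_K (osym t (edge_list t)) :: ptree \<Rightarrow>\<^sub>0 'a)"
      using orients_edge_list[of t] by (simp add: K_bd_osym orients_def)
    then have "keys (K_expand t (edge_list t) :: ptree \<Rightarrow>\<^sub>0 'a)
        \<subseteq> {t' \<in> ptrees n. card (edges t') = card (edges t) + 1}"
      using keys_bdry_K[OF t(1) orients_edge_list] by metis
    also have "\<dots> \<subseteq> {t \<in> ptrees n. card (edges t) + (k - 1) + 2 = n}"
      using t(2) internal_edges_bound by fastforce
    finally show ?thesis .
  qed
  then show ?thesis unfolding K_chain_iff by (simp add: K_operad_def keys_subset_lin_ext)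
qed

text \<open>Both boundaries are derivations, and the signs in the two Leibniz rules agree because the degree \<open>l\<close>
of \<open>x\<close> is preserved by the comparison map.\<close>

lemma comparison_bdry_basis:
  "t \<in> ptrees n \<Longrightarrow> comparison (bd_K (basis t)) = (bd_W (comparison (basis t)) :: mtree \<Rightarrow>\<^sub>0 'k::field)"
proof (induction rule: ptree_induct)
  case (corolla n)
  then show ?case by (simp add: basis_corolla comparison_bdry_corolla comparison_corolla)
next
  case (graft x r j m)
  let ?C = "basis (corolla m) :: ptree \<Rightarrow>\<^sub>0 'k" and ?X = "basis x :: ptree \<Rightarrow>\<^sub>0 'k"
  note x = graft.hyps(1) and j = graft.hyps(2,3) and m = graft.hyps(4)
  note ox = orients_edge_list[of x]
  have oc: "orients [] (edges (corolla m))" by (simp add: orients_def)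
  obtain c where c: "basis (graft j x (corolla m)) = scale c (circ_K j ?X ?C)" using basis_as_composite[OF x j m] .
  obtain l where l: "r = card (edges x) + l + 2" using ptrees_degree[OF x] .
  then have l': "length (edge_list x) + l + 2 = r" using orients_length[OF ox] by simp
  obtain h where h: "m = h + 2" using m by (metis add.commute le_Suc_ex)
  note cm = corolla_ptrees[OF m]
  have k: "keys ?X \<subseteq> ptrees r" "keys ?C \<subseteq> ptrees m" using x cm by auto
  have kb: "keys (bd_K ?X) \<subseteq> ptrees r" "keys (bd_K ?C) \<subseteq> ptrees m"
    using keys_bdry_K[OF x ox, where 'k = 'k] keys_bdry_K[OF cm oc, where 'k = 'k] by (auto simp: osym_edge_list basis_corolla)
  have "bd_K (circ_K j ?X ?C) = circ_K j (bd_K ?X) ?C + scale ((-1) ^ l) (circ_K j ?X (bd_K ?C))"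
    using K_derivation_osym[OF x ox cm oc j l', where 'a = 'k] by (simp add: osym_edge_list basis_corolla)
  then have "comparison (bd_K (circ_K j ?X ?C)) =
      circ_W j (comparison (bd_K ?X)) (comparison ?C) + scale ((-1) ^ l) (circ_W j (comparison ?X) (comparison (bd_K ?C)))"
    by (simp only: chain_linear_add[OF comparison_linear] chain_linear_scale[OF comparison_linear]
        comparison_circ[OF kb(1) k(2) j] comparison_circ[OF k(1) kb(2) j])
  also have "\<dots> = bd_W (circ_W j (comparison ?X) (binary_sum m))"
    unfolding graft.IH basis_corolla comparison_corolla comparison_bdry_corolla[OF m]
    unfolding h osym_edge_list[symmetric]
    by (rule W_derivation[OF comparison_chain[OF x l[symmetric] ox] binary_sum_chain j, symmetric])
  also have "circ_W j (comparison ?X) (binary_sum m) = comparison (circ_K j ?X ?C)"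
    by (rule comparison_circ_corolla[OF k(1) j m, symmetric])
  finally show ?case
    unfolding c by (simp only: chain_linear_scale[OF bdry_linear(1)] chain_linear_scale[OF comparison_linear] chain_linear_scale[OF bdry_linear(2)])
qed

lemma comparison_bdry:
  assumes "x \<in> chain_space K_operad n k"
  shows "comparison (bd_K x) = bd_W (comparison x)"
proof (rule chain_linear_eq_on[of "\<lambda>x. comparison (bd_K x)" "\<lambda>x. bd_W (comparison x)"])
  show "comparison (bd_K (basis t)) = bd_W (comparison (basis t :: ptree \<Rightarrow>\<^sub>0 'a))" if "t \<in> keys x" for t
    using assms that by (intro comparison_bdry_basis) (auto simp: K_chain_iff)
qed (intro chain_linear_intros comparison_linear chain_linear_comp[OF comparison_linear])+

lemma comparison_map_comparison: "comparison_map comparison"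
proof -
  have "comparison x \<in> chain_space W_operad n k" if "x \<in> chain_space K_operad n k" for n k and x :: "ptree \<Rightarrow>\<^sub>0 'a"
    unfolding comparison_def W_chain_iff
  proof (rule keys_subset_lin_ext)
    fix t assume "t \<in> keys x"
    then have "t \<in> ptrees n" "card (edges t) + k + 2 = n" using that by (auto simp: K_chain_iff)
    from comparison_chain[OF this orients_edge_list, where 'k = 'a]
    show "keys (comparison_steps (card (edges t)) t :: mtree \<Rightarrow>\<^sub>0 'a) \<subseteq> metric_trees n k"
      unfolding W_chain_iff osym_edge_list by (simp add: comparison_def lin_ext_single)
  qed
  moreover have "comparison (circ_K i x y) = circ_W i (comparison x) (comparison y)"
    if "x \<in> chain_space K_operad r k" "y \<in> chain_space K_operad s l" "1 \<le> i" "i \<le> r" for r s k l i and x y :: "ptree \<Rightarrow>\<^sub>0 'a"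
    using that by (intro comparison_circ[of _ r _ s]) (auto simp: K_chain_iff)
  ultimately show ?thesis
    unfolding comparison_map_def graded_operad_hom_def
    by (simp add: comparison_corolla binary_sum_def chain_linear_add[OF comparison_linear] chain_linear_scale[OF comparison_linear])
qed

lemma comparison_mapD:
  assumes "comparison_map q"
  shows "x \<in> chain_space K_operad n k \<Longrightarrow> y \<in> chain_space K_operad n k \<Longrightarrow> q (x + y) = q x + q y"
    and "x \<in> chain_space K_operad n k \<Longrightarrow> q (scale c x) = scale c (q x)"
    and "x \<in> chain_space K_operad r k \<Longrightarrow> y \<in> chain_space K_operad s l \<Longrightarrow> 1 \<le> i \<Longrightarrow> i \<le> r \<Longrightarrow>
      q (circ_K i x y) = circ_W i (q x) (q y)"
    and "2 \<le> n \<Longrightarrow> q (osym (corolla n) []) = binary_sum n"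
proof -
  note h = assms[unfolded comparison_map_def graded_operad_hom_def, folded binary_sum_def]
  note h1 = conjunct1[OF h] and h2 = conjunct2[OF h]
  show "x \<in> chain_space K_operad n k \<Longrightarrow> y \<in> chain_space K_operad n k \<Longrightarrow> q (x + y) = q x + q y"
    using conjunct1[OF conjunct2[OF h1]] by blast
  show "x \<in> chain_space K_operad n k \<Longrightarrow> q (scale c x) = scale c (q x)"
    using conjunct1[OF conjunct2[OF conjunct2[OF h1]]] by blast
  show "x \<in> chain_space K_operad r k \<Longrightarrow> y \<in> chain_space K_operad s l \<Longrightarrow> 1 \<le> i \<Longrightarrow> i \<le> r \<Longrightarrow>
      q (circ_K i x y) = circ_W i (q x) (q y)"
    using conjunct2[OF conjunct2[OF conjunct2[OF h1]]] by blast
  show "2 \<le> n \<Longrightarrow> q (osym (corolla n) []) = binary_sum n" using h2 by blast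
qed

lemma comparison_map_basis:
  assumes q: "comparison_map q"
  shows "t \<in> ptrees n \<Longrightarrow> q (basis t) = (comparison (basis t) :: mtree \<Rightarrow>\<^sub>0 'k::field)"
proof (induction rule: ptree_induct)
  case (corolla n)
  then show ?case by (simp add: basis_corolla comparison_mapD(4)[OF q] comparison_corolla)
next
  case (graft x r j m)
  let ?C = "basis (corolla m) :: ptree \<Rightarrow>\<^sub>0 'k" and ?X = "basis x :: ptree \<Rightarrow>\<^sub>0 'k" and ?t = "graft j x (corolla m)"
  note x = graft.hyps(1) and j = graft.hyps(2,3) and m = graft.hyps(4)
  note cm = corolla_ptrees[OF m]
  obtain c where c: "basis ?t = scale c (circ_K j ?X ?C)" using basis_as_composite[OF x j m] .
  obtain l where l: "r = card (edges x) + l + 2" using ptrees_degree[OF x] .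
  obtain h where h: "m = h + 2" using m by (metis add.commute le_Suc_ex)
  have t: "?t \<in> ptrees (r + m - 1)" by (rule graft_ptrees[OF x cm j])
  obtain k where k: "r + m - 1 = card (edges ?t) + k + 2" using ptrees_degree[OF t] .
  have X: "?X \<in> chain_space K_operad r l" and C: "?C \<in> chain_space K_operad m h"
    unfolding K_chain_iff using x l cm h by simp_all
  have "circ_K j ?X ?C \<in> chain_space K_operad (r + m - 1) k"
    using keys_circ_K[of j ?X ?C] x cm j t k by (auto simp: K_chain_iff)
  then have "q (basis ?t) = scale c (q (circ_K j ?X ?C))"
    unfolding c by (rule comparison_mapD(2)[OF q])
  also have "q (circ_K j ?X ?C) = circ_W j (q ?X) (q ?C)"
    by (rule comparison_mapD(3)[OF q X C j])
  also have "\<dots> = comparison (circ_K j ?X ?C)"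
    unfolding graft.IH using comparison_circ_corolla[of ?X r j m] x j m by (simp add: basis_corolla comparison_mapD(4)[OF q])
  finally show ?case unfolding c chain_linear_scale[OF comparison_linear] .
qed

text \<open>A comparison map is additive only on the chain spaces, so the argument is assembled from its basis
elements within one chain space.\<close>

lemma comparison_map_unique:
  assumes q: "comparison_map q" and x: "x \<in> chain_space K_operad n k"
  shows "q x = (comparison x :: mtree \<Rightarrow>\<^sub>0 'k::field)"
proof -
  let ?S = "{t \<in> ptrees n. card (edges t) + k + 2 = n}"
  let ?f = "\<lambda>t. scale (Poly_Mapping.lookup x t) (basis t)"
  have add: "q (y + z) = q y + q z" if "keys y \<subseteq> ?S" "keys z \<subseteq> ?S" for y z
    by (rule comparison_mapD(1)[OF q]) (use that in \<open>simp_all add: K_chain_iff\<close>)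
  have scal: "q (scale c y) = scale c (q y)" if "keys y \<subseteq> ?S" for y c
    by (rule comparison_mapD(2)[OF q]) (use that in \<open>simp add: K_chain_iff\<close>)
  have f: "keys (?f t) \<subseteq> ?S" if "t \<in> ?S" for t
    using that by (intro keys_subset_scale) auto
  have "q (sum ?f A) = comparison (sum ?f A)" if "finite A" "A \<subseteq> ?S" for A
    using that
  proof (induction A rule: finite_induct)
    case empty
    then show ?case using scal[of 0 0] chain_linear_zero[OF comparison_linear] by simp
  next
    case (insert t A)
    then have t: "t \<in> ?S" and A: "A \<subseteq> ?S" by auto
    have "q (basis t) = comparison (basis t)"
      using comparison_map_basis[OF q, of t n] t by simp
    then have "q (?f t) = comparison (?f t)"
      using scal[of "basis t"] t by (simp add: chain_linear_scale[OF comparison_linear])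
    moreover have "q (?f t + sum ?f A) = q (?f t) + q (sum ?f A)"
      using A by (intro add keys_subset_sum f t) auto
    ultimately show ?case
      using insert.hyps insert.IH[OF A] by (simp add: chain_linear_add[OF comparison_linear])
  qed
  from this[of "keys x"] x show ?thesis
    unfolding K_chain_iff chain_as_sum[symmetric] by simp
qed

theorem proposition6:
  "(\<exists>q :: (ptree \<Rightarrow>\<^sub>0 'k::field) \<Rightarrow> (mtree \<Rightarrow>\<^sub>0 'k). comparison_map q)
   \<and> (\<forall>(q :: (ptree \<Rightarrow>\<^sub>0 'k) \<Rightarrow> (mtree \<Rightarrow>\<^sub>0 'k)) q'. comparison_map q \<and> comparison_map q' \<longrightarrow>
        (\<forall>n k. \<forall>x\<in>chain_space K_operad n k. q x = q' x))
   \<and> (\<forall>q :: (ptree \<Rightarrow>\<^sub>0 'k) \<Rightarrow> (mtree \<Rightarrow>\<^sub>0 'k). comparison_map q \<longrightarrow>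
        (\<forall>n\<ge>2. q (bdry K_operad (osym (corolla n) [])) = bdry W_operad (q (osym (corolla n) [])))
      \<and> dg_operad_hom K_operad W_operad q)"
proof (intro conjI allI impI ballI)
  show "\<exists>q :: (ptree \<Rightarrow>\<^sub>0 'k) \<Rightarrow> (mtree \<Rightarrow>\<^sub>0 'k). comparison_map q" using comparison_map_comparison by blast
next
  fix q q' :: "(ptree \<Rightarrow>\<^sub>0 'k) \<Rightarrow> (mtree \<Rightarrow>\<^sub>0 'k)" and n k and x :: "ptree \<Rightarrow>\<^sub>0 'k"
  assume "comparison_map q \<and> comparison_map q'" "x \<in> chain_space K_operad n k"
  then show "q x = q' x" using comparison_map_unique[of q x n k] comparison_map_unique[of q' x n k] by simp
next
  fix q :: "(ptree \<Rightarrow>\<^sub>0 'k) \<Rightarrow> (mtree \<Rightarrow>\<^sub>0 'k)"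
  assume q: "comparison_map q"
  have bd: "q (bdry K_operad x) = bdry W_operad (q x)" if "x \<in> chain_space K_operad n k" for n k x
    using comparison_map_unique[OF q that] comparison_map_unique[OF q bdry_K_chain[OF that]] comparison_bdry[OF that] by simp
  then show "dg_operad_hom K_operad W_operad q"
    using q unfolding dg_operad_hom_def comparison_map_def by blast
  fix n :: nat assume n: "2 \<le> n"
  have "osym (corolla n) [] \<in> chain_space K_operad n (n - 2)"
    unfolding K_chain_iff using n by (intro keys_subset_osym) (simp add: corolla_ptrees)
  then show "q (bdry K_operad (osym (corolla n) [])) = bdry W_operad (q (osym (corolla n) []))" by (rule bd)
qed

end
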